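(* Let $N$ be a large but fixed number of spins ($N\ge N_0$, with $N_0$ as in the context), let $H_{\rm Ising}$ be an Ising Hamiltonian on $N$ spins with $\lVert H_{\rm Ising}\rVert\le C_0N$ and non-degenerate ground state, and let $c,l,c',c'',L>0$ be constants with $L<\frac{1}{3N-2}$. Let $a,b>0$ be the gap constants of the context. For $\delta>0$ and a twice-differentiable function $g:[0,\infty)\to\mathbb{R}$, put $$\Gamma(t)=(\delta t+c)^{-g(t)},\qquad H(t)=H_{\rm Ising}-\Gamma(t)\sum_{i=1}^N\sigma_i^x ,\qquad t\ge 0 .$$ Then the infinite-time excitation measure $P_{\rm excited}$ of the Schrödinger evolution generated by $H(t)$ and started in the ground state of $H(0)$ can be made arbitrarily small by choosing $\delta$ small, of the order of a small constant times $N^{-1/2}e^{-3bN}$. Precisely: for every $\varepsilon>0$ there is a constant $\kappa>0$, depending only on $\varepsilon,a,b,c,l,c',c'',L$, such that for every $\delta$ with $0<\delta\le \kappa\,N^{-1/2}e^{-3bN}$ and every twice-differentiable $g$ satisfying, for all $t\ge 0$, $$0<g(t)\le L,$$ $$|g'(t)|\le \frac{\delta\,c'}{(\delta t+c)^{1+l}},$$ $$|g''(t)|\,\bigl|\log(\delta t+c)\bigr|\le \delta^2\,c''\,(\delta t+c)^{-1-\frac{2N-1}{3N-2}},$$ one has $P_{\rm excited}\le\varepsilon$.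
   Context: Hilbert space: $(\mathbb{C}^2)^{\otimes N}$; $\sigma_i^x,\sigma_i^z$ are the Pauli $x$ and $z$ matrices acting on site $i$; $\lVert\cdot\rVert$ is the operator norm; $\hbar=1$. Ising Hamiltonian: $H_{\rm Ising}=-\sum_{i}J_i\sigma_i^z-\sum_{i,j}J_{ij}\sigma_i^z\sigma_j^z-\sum_{i,j,k}J_{ijk}\sigma_i^z\sigma_j^z\sigma_k^z-\cdots$ with arbitrary real many-body couplings, scaled so that $H_{\rm Ising}$ is of order $N$, i.e. $\lVert H_{\rm Ising}\rVert\le C_0N$ for a constant $C_0$ independent of $N$. The ground state of $H_{\rm Ising}$ is assumed non-degenerate. (For $\Gamma>0$ the ground state of $H_{\rm Ising}-\Gamma\sum_i\sigma_i^x$ is automatically non-degenerate by the Perron–Frobenius theorem.) The constant $c>0$ is of order $N^0$ (independent of $N$). Dynamics: $\ket{\psi(t)}$ solves $i\frac{d}{dt}\ket{\psi(t)}=H(t)\ket{\psi(t)}$ for $t\ge0$, with $\ket{\psi(0)}$ the normalized ground state of $H(0)$. Let $\ket{0(t)}$ be the normalized instantaneous ground state of $H(t)$. Define $$P_{\rm excited}=\lim_{t\to\infty}\bigl\lVert\,\ket{\psi(t)}\bra{\psi(t)}-\ket{0(t)}\bra{0(t)}\,\bigr\rVert ,$$ which bounds the square root of the final probability of being outside the instantaneous ground state. Gap constants (a known result, used to define $a$ and $b$): let $\Delta$ be the difference between the lowest and second-lowest eigenvalues of $H_{\rm Ising}-\Gamma\sum_i\sigma_i^x$. There are positive constants $a,b$,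 independent of $N$ and $\Gamma$ (they may depend on $C_0$ and $c$), and an $N_0$, such that for all $N\ge N_0$, all such $H_{\rm Ising}$, and all $0<\Gamma\le\max\{1,c^{-1}\}$ (a range containing all values of $\Gamma(t)$ considered here), $$\Delta\ge a\sqrt{N}\,e^{-bN}\,\Gamma^N .$$ Fix such $a,b,N_0$. *)

theory Defs
  imports
    "Jordan_Normal_Form.Spectral_Radius"
    "Jordan_Normal_Form.Matrix_Kernel"
    "HOL-Library.Multiset"
begin

type_synonym cvec = "complex Matrix.vec"
type_synonym cmat = "complex Matrix.mat"

section \<open>Operators on finite-dimensional Hilbert space\<close>

definition vnorm :: "cvec \<Rightarrow> real" where
  "vnorm v = sqrt (\<Sum>k<dim_vec v. (cmod (v $ k))\<^sup>2)"

definition op_norm :: "cmat \<Rightarrow> real" where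
  "op_norm A = Sup {vnorm (A *\<^sub>v v) | v. v \<in> carrier_vec (dim_col A) \<and> vnorm v \<le> 1}"

definition ketbra :: "cvec \<Rightarrow> cvec \<Rightarrow> cmat" where
  "ketbra u v = Matrix.mat (dim_vec u) (dim_vec v) (\<lambda>(r, s). u $ r * cnj (v $ s))"

definition mat_sum :: "nat \<Rightarrow> ('i \<Rightarrow> cmat) \<Rightarrow> 'i set \<Rightarrow> cmat" where
  "mat_sum n f I = Matrix.mat n n (\<lambda>(r, s). \<Sum>i\<in>I. f i $$ (r, s))"

definition kron :: "cmat \<Rightarrow> cmat \<Rightarrow> cmat" where
  "kron A B = Matrix.mat (dim_row A * dim_row B) (dim_col A * dim_col B)
     (\<lambda>(r, s). A $$ (r div dim_row B, s div dim_col B) * B $$ (r mod dim_row B, s mod dim_col B))"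

text \<open>All eigenvalues in increasing order, repeated according to multiplicity. The real part
  loses nothing for the Hermitian matrices to which this is applied.\<close>

definition eigenvalue_list :: "cmat \<Rightarrow> real list" where
  "eigenvalue_list A = sorted_list_of_multiset (image_mset Re (proots (char_poly A)))"

definition ground_energy :: "cmat \<Rightarrow> real" where
  "ground_energy A = eigenvalue_list A ! 0"

definition spectral_gap :: "cmat \<Rightarrow> real" where
  "spectral_gap A = eigenvalue_list A ! 1 - eigenvalue_list A ! 0"

definition ground_state :: "cmat \<Rightarrow> cvec \<Rightarrow> bool" where
  "ground_state A v \<longleftrightarrow> eigenvector A v (complex_of_real (ground_energy A)) \<and> vnorm v = 1"

text \<open>The eigenspace of the lowest eigenvalue is one-dimensional.\<close>

definition nondegenerate_ground :: "cmat \<Rightarrow> bool" where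
  "nondegenerate_ground A \<longleftrightarrow>
     kernel_dim (char_matrix A (complex_of_real (ground_energy A))) = 1"

section \<open>Spin systems\<close>

definition pauli_x :: cmat where
  "pauli_x = mat_of_rows_list 2 [[0, 1], [1, 0]]"

definition pauli_z :: cmat where
  "pauli_z = mat_of_rows_list 2 [[1, 0], [0, -1]]"

text \<open>Sites are numbered \<open>0, \<dots>, N - 1\<close>. The operator \<open>A\<close> acting on site \<open>i\<close> is the
  tensor product over all sites with \<open>A\<close> as factor \<open>i\<close> and the identity elsewhere.\<close>

definition site_op :: "nat \<Rightarrow> nat \<Rightarrow> cmat \<Rightarrow> cmat" where
  "site_op N i A = foldr kron (map (\<lambda>j. if j = i then A else 1\<^sub>m 2) [0..<N]) (1\<^sub>m 1)"

definition sigma_x :: "nat \<Rightarrow> nat \<Rightarrow> cmat" where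
  "sigma_x N i = site_op N i pauli_x"

definition sigma_z :: "nat \<Rightarrow> nat \<Rightarrow> cmat" where
  "sigma_z N i = site_op N i pauli_z"

text \<open>The many-body couplings are indexed by the nonempty set \<open>S\<close> of interacting sites, so that
  \<open>J {i}\<close>, \<open>J {i, j}\<close>, \dots are the local fields, pair couplings, and so on.\<close>

definition ising_hamiltonian :: "nat \<Rightarrow> (nat set \<Rightarrow> real) \<Rightarrow> cmat" where
  "ising_hamiltonian N J = - mat_sum (2 ^ N)
     (\<lambda>S. complex_of_real (J S) \<cdot>\<^sub>m
        foldr (\<lambda>i M. sigma_z N i * M) (sorted_list_of_set S) (1\<^sub>m (2 ^ N)))
     {S. S \<subseteq> {..<N} \<and> S \<noteq> {}}"

definition transverse_ising :: "nat \<Rightarrow> (nat set \<Rightarrow> real) \<Rightarrow> real \<Rightarrow> cmat" where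
  "transverse_ising N J \<Gamma> =
     ising_hamiltonian N J - complex_of_real \<Gamma> \<cdot>\<^sub>m mat_sum (2 ^ N) (sigma_x N) {..<N}"

definition admissible_ising :: "real \<Rightarrow> nat \<Rightarrow> (nat set \<Rightarrow> real) \<Rightarrow> bool" where
  "admissible_ising C0 N J \<longleftrightarrow>
     op_norm (ising_hamiltonian N J) \<le> C0 * real N \<and>
     nondegenerate_ground (ising_hamiltonian N J)"

definition gap_constants :: "real \<Rightarrow> real \<Rightarrow> real \<Rightarrow> real \<Rightarrow> nat \<Rightarrow> bool" where
  "gap_constants C0 c a b N0 \<longleftrightarrow>
     (\<forall>N J \<Gamma>. N0 \<le> N \<and> 1 \<le> N \<and> admissible_ising C0 N J \<and> 0 < \<Gamma> \<and> \<Gamma> \<le> max 1 (1 / c) \<longrightarrow>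
        spectral_gap (transverse_ising N J \<Gamma>) \<ge> a * sqrt (real N) * exp (- b * real N) * \<Gamma> ^ N)"

section \<open>Quantum annealing dynamics\<close>

definition annealing_field :: "real \<Rightarrow> real \<Rightarrow> (real \<Rightarrow> real) \<Rightarrow> real \<Rightarrow> real" where
  "annealing_field \<delta> c g t = (\<delta> * t + c) powr (- g t)"

definition annealing_hamiltonian ::
  "nat \<Rightarrow> (nat set \<Rightarrow> real) \<Rightarrow> real \<Rightarrow> real \<Rightarrow> (real \<Rightarrow> real) \<Rightarrow> real \<Rightarrow> cmat" where
  "annealing_hamiltonian N J \<delta> c g t = transverse_ising N J (annealing_field \<delta> c g t)"

text \<open>The time derivative is taken componentwise, and is one-sided at \<open>t = 0\<close>.\<close>

definition schrodinger_evolution :: "nat \<Rightarrow> (real \<Rightarrow> cmat) \<Rightarrow> (real \<Rightarrow> cvec) \<Rightarrow> bool" where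
  "schrodinger_evolution n H \<psi> \<longleftrightarrow>
     (\<forall>t\<ge>0. \<psi> t \<in> carrier_vec n \<and>
       (\<exists>D \<in> carrier_vec n.
          (\<forall>k<n. ((\<lambda>s. \<psi> s $ k) has_vector_derivative D $ k) (at t within {0..})) \<and>
          \<i> \<cdot>\<^sub>v D = H t *\<^sub>v \<psi> t))"

definition excitation :: "(real \<Rightarrow> cvec) \<Rightarrow> (real \<Rightarrow> cvec) \<Rightarrow> real \<Rightarrow> real" where
  "excitation \<psi> \<phi> t = op_norm (ketbra (\<psi> t) (\<psi> t) - ketbra (\<phi> t) (\<phi> t))"

definition P_excited :: "(real \<Rightarrow> cvec) \<Rightarrow> (real \<Rightarrow> cvec) \<Rightarrow> real" where
  "P_excited \<psi> \<phi> = Lim at_top (excitation \<psi> \<phi>)"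

end

(* The condition L < 1 / (3 N - 2) leaves only finitely many N for a given L, so constants may
   depend on N. For fixed N the proof is the adiabatic theorem with a reduced resolvent S = S(t),
   S (H - E) = 1 - P, whose norm is at most a constant times 1 / gap. With P' = - (P H' S + S H' P)
   and Z = S S H' P - P H' S S one has P' = - [H, Z]; hence, for the density matrix \<rho> of the
   evolved state, d/dt (tr (\<rho> P) - tr (\<rho> i Z)) = - tr (\<rho> i Z'). The gap bound and the
   conditions on g give |Z| = O(\<delta> s^(-\<eta>)) and |Z'| = O(\<delta>^2 s^(-1-\<eta>)) with
   s = \<delta> t + c and some \<eta> > 0. Integrating, tr (\<rho> P) converges and stays within O(\<delta>)
   of its initial value 1; the excitation measure is sqrt (1 - tr (\<rho> P)).

   Matrices of all sizes are embedded into one real normed algebra of finitely supported infinite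
   matrices with the Frobenius norm, so that the calculus of normed algebras applies although the
   dimension 2^N is a variable. *)
theory Submission
  imports Defs "HOL-Analysis.L2_Norm"
begin


section \<open>An algebra of finitely supported matrices\<close>

text \<open>The phase of the ground vector \<open>\<phi> t\<close> is arbitrary and may jump with t,
  so only its projection P is used and no regularity is given in advance. Differentiability is
  derived from exact identities between two times: the ground energy is Lipschitz in H, which makes
  P and S continuous; the variational principle then makes the energy differentiable, and with it P
  and S.

  The exponents arise as follows. |S| is O(\<Gamma>^(-N)), and \<Gamma>' and \<Gamma>'' each carry a
  factor \<Gamma>. Thus S^2 H' costs \<Gamma>^(-(2N-1)) and S^3 H'^2 costs \<Gamma>^(-(3N-2)), which
  is at most a constant times s^(L(3N-2)), against a decay s^(-2) of the squared logarithmic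
  derivative; integrability is L(3N-2) < 1. Under the same condition the cost s^(L(2N-1)) of S^2 H''
  stays below s^((2N-1)/(3N-2)), which is the extra decay demanded of g''.

  The couplings do not depend on time, so H' and H'' contain the transverse field only. Hence the
  constants are uniform in J, and the spectrum enters through a and b alone.\<close>

typedef finmat = "{f :: nat \<Rightarrow> nat \<Rightarrow> complex. \<exists>n. \<forall>i j. n \<le> i \<or> n \<le> j \<longrightarrow> f i j = 0}"
  morphisms entry Abs_finmat
  by (intro exI[of _ "\<lambda>i j. 0"]) auto

setup_lifting type_definition_finmat

definition supp_in :: "nat \<Rightarrow> finmat \<Rightarrow> bool" where
  "supp_in n A \<longleftrightarrow> (\<forall>i j. n \<le> i \<or> n \<le> j \<longrightarrow> entry A i j = 0)"

lemma supp_in_ex: "\<exists>n. supp_in n A"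
  using entry[of A] unfolding supp_in_def by simp

lemma supp_in_mono: "supp_in m A \<Longrightarrow> m \<le> n \<Longrightarrow> supp_in n A"
  unfolding supp_in_def by (meson order_trans)

lemma supp_in_common2: obtains n where "supp_in n A" "supp_in n B"
proof -
  obtain k l where "supp_in k A" "supp_in l B" using supp_in_ex by blast
  then have "supp_in (max k l) A" "supp_in (max k l) B" by (auto intro: supp_in_mono)
  then show ?thesis by (rule that)
qed

lemma supp_in_common3: obtains n where "supp_in n A" "supp_in n B" "supp_in n C"
proof -
  obtain k l where "supp_in k A" "supp_in k B" "supp_in l C"
    using supp_in_ex supp_in_common2 by metis
  then have "supp_in (max k l) A" "supp_in (max k l) B" "supp_in (max k l) C"
    by (auto intro: supp_in_mono)
  then show ?thesis by (rule that)
qed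

lemma supp_inD: "supp_in n A \<Longrightarrow> entry A i j \<noteq> 0 \<Longrightarrow> i < n \<and> j < n"
  unfolding supp_in_def by (meson not_le)

lemma finmat_eqI: "(\<And>i j. entry A i j = entry B i j) \<Longrightarrow> A = B"
  by (simp add: entry_inject[symmetric] fun_eq_iff)

instantiation finmat :: real_algebra
begin

lift_definition zero_finmat :: finmat is "\<lambda>i j. 0" by simp

lift_definition plus_finmat :: "finmat \<Rightarrow> finmat \<Rightarrow> finmat" is "\<lambda>f g i j. f i j + g i j"
proof -
  fix f g :: "nat \<Rightarrow> nat \<Rightarrow> complex"
  assume "\<exists>n. \<forall>i j. n \<le> i \<or> n \<le> j \<longrightarrow> f i j = 0" "\<exists>n. \<forall>i j. n \<le> i \<or> n \<le> j \<longrightarrow> g i j = 0"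
  then obtain k l where "\<forall>i j. k \<le> i \<or> k \<le> j \<longrightarrow> f i j = 0" "\<forall>i j. l \<le> i \<or> l \<le> j \<longrightarrow> g i j = 0"
    by blast
  then show "\<exists>n. \<forall>i j. n \<le> i \<or> n \<le> j \<longrightarrow> f i j + g i j = 0"
    by (intro exI[of _ "max k l"]) auto
qed

lift_definition uminus_finmat :: "finmat \<Rightarrow> finmat" is "\<lambda>f i j. - f i j" by simp

definition minus_finmat :: "finmat \<Rightarrow> finmat \<Rightarrow> finmat" where
  "minus_finmat A B = A + - B"

lift_definition scaleR_finmat :: "real \<Rightarrow> finmat \<Rightarrow> finmat" is "\<lambda>r f i j. r *\<^sub>R f i j" by auto

text \<open>Each row of the left factor has finite support, so the sum is finite without choosing a
  block size. \<open>entry_times\<close> recovers the usual product for every block that contains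
  the left factor.\<close>

lift_definition times_finmat :: "finmat \<Rightarrow> finmat \<Rightarrow> finmat" is
  "\<lambda>f g i j. \<Sum>k | f i k \<noteq> 0. f i k * g k j"
proof -
  fix f g :: "nat \<Rightarrow> nat \<Rightarrow> complex"
  assume "\<exists>n. \<forall>i j. n \<le> i \<or> n \<le> j \<longrightarrow> f i j = 0" "\<exists>n. \<forall>i j. n \<le> i \<or> n \<le> j \<longrightarrow> g i j = 0"
  then obtain k l where "\<forall>i j. k \<le> i \<or> k \<le> j \<longrightarrow> f i j = 0" "\<forall>i j. l \<le> i \<or> l \<le> j \<longrightarrow> g i j = 0"
    by blast
  then show "\<exists>n. \<forall>i j. n \<le> i \<or> n \<le> j \<longrightarrow> (\<Sum>k | f i k \<noteq> 0. f i k * g k j) = 0"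
    by (intro exI[of _ "max k l"]) (auto intro!: sum.neutral)
qed

lemma entry_times:
  assumes "supp_in n A"
  shows "entry (A * B) i j = (\<Sum>k<n. entry A i k * entry B k j)"
  unfolding times_finmat.rep_eq
  by (rule sum.mono_neutral_left) (use supp_inD[OF assms] in auto)

lemma entry_add [simp]: "entry (A + B) i j = entry A i j + entry B i j"
  by (simp add: plus_finmat.rep_eq)

lemma entry_scaleR [simp]: "entry (r *\<^sub>R A) i j = r *\<^sub>R entry A i j"
  by (simp add: scaleR_finmat.rep_eq)

lemma entry_uminus [simp]: "entry (- A) i j = - entry A i j"
  by (simp add: uminus_finmat.rep_eq)

lemma entry_zero [simp]: "entry 0 i j = 0"
  by (simp add: zero_finmat.rep_eq)

lemma supp_in_add: "supp_in n A \<Longrightarrow> supp_in n B \<Longrightarrow> supp_in n (A + B)"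
  by (simp add: supp_in_def)

lemma supp_in_scaleR: "supp_in n A \<Longrightarrow> supp_in n (r *\<^sub>R A)"
  by (simp add: supp_in_def)

lemma supp_in_times: "supp_in n A \<Longrightarrow> supp_in n B \<Longrightarrow> supp_in n (A * B)"
  by (auto simp: supp_in_def entry_times intro!: sum.neutral)

instance
proof
  fix A B C :: finmat and r s :: real
  show "A + B + C = A + (B + C)" "A + B = B + A" "0 + A = A" "- A + A = 0" "A - B = A + - B"
    by (auto intro!: finmat_eqI simp: minus_finmat_def)
  show "r *\<^sub>R (A + B) = r *\<^sub>R A + r *\<^sub>R B" "(r + s) *\<^sub>R A = r *\<^sub>R A + s *\<^sub>R A"
    "r *\<^sub>R s *\<^sub>R A = (r * s) *\<^sub>R A" "1 *\<^sub>R A = A"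
    by (auto intro!: finmat_eqI simp: algebra_simps)
  obtain n where n: "supp_in n A" "supp_in n B" "supp_in n C" by (rule supp_in_common3)
  show "(A * B) * C = A * (B * C)"
  proof (rule finmat_eqI)
    fix i j
    have "entry (A * B * C) i j = (\<Sum>k<n. (\<Sum>l<n. entry A i l * entry B l k) * entry C k j)"
      by (simp add: entry_times[OF supp_in_times[OF n(1,2)]] entry_times[OF n(1)])
    also have "\<dots> = (\<Sum>l<n. entry A i l * (\<Sum>k<n. entry B l k * entry C k j))"
      by (simp add: sum_distrib_left sum_distrib_right mult.assoc) (rule sum.swap)
    also have "\<dots> = entry (A * (B * C)) i j"
      by (simp add: entry_times[OF n(1)] entry_times[OF n(2)])
    finally show "entry (A * B * C) i j = entry (A * (B * C)) i j" .
  qed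
  show "(A + B) * C = A * C + B * C"
    by (rule finmat_eqI) (simp add: entry_times[OF supp_in_add[OF n(1,2)]] entry_times[OF n(1)]
        entry_times[OF n(2)] distrib_right sum.distrib)
  show "A * (B + C) = A * B + A * C"
    by (rule finmat_eqI) (simp add: entry_times[OF n(1)] distrib_left sum.distrib)
  show "r *\<^sub>R A * B = r *\<^sub>R (A * B)"
    by (rule finmat_eqI)
      (simp add: entry_times[OF n(1)] entry_times[OF supp_in_scaleR[OF n(1)]] scaleR_sum_right)
  show "A * r *\<^sub>R B = r *\<^sub>R (A * B)"
    by (rule finmat_eqI) (simp add: entry_times[OF n(1)] scaleR_sum_right)
qed

end

lemma entry_diff [simp]: "entry (A - B) i j = entry A i j - entry B i j"
  unfolding minus_finmat_def entry_add entry_uminus by simp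

instantiation finmat :: real_normed_algebra
begin

text \<open>The Frobenius norm, summed over the support so that no block size occurs. It is
  submultiplicative and equals 1 on projections onto unit vectors; the block identity has norm
  \<open>sqrt n\<close>, which only affects constants.\<close>

definition norm_finmat :: "finmat \<Rightarrow> real" where
  "norm_finmat A = L2_set (\<lambda>(i, j). cmod (entry A i j)) {(i, j). entry A i j \<noteq> 0}"

definition dist_finmat :: "finmat \<Rightarrow> finmat \<Rightarrow> real" where
  "dist_finmat A B = norm (A - B)"

definition sgn_finmat :: "finmat \<Rightarrow> finmat" where
  "sgn_finmat A = A /\<^sub>R norm A"

definition uniformity_finmat :: "(finmat \<times> finmat) filter" where
  "uniformity_finmat = (INF e\<in>{0<..}. principal {(x, y). dist x y < e})"

definition open_finmat :: "finmat set \<Rightarrow> bool" where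
  "open_finmat U \<longleftrightarrow> (\<forall>x\<in>U. \<forall>\<^sub>F (x', y) in uniformity. x' = x \<longrightarrow> y \<in> U)"

lemma norm_finmat:
  assumes "supp_in n A"
  shows "norm A = L2_set (\<lambda>(i, j). cmod (entry A i j)) ({..<n} \<times> {..<n})"
  unfolding norm_finmat_def L2_set_def
proof (intro arg_cong[where f = sqrt] sum.mono_neutral_left)
  show "{(i, j). entry A i j \<noteq> 0} \<subseteq> {..<n} \<times> {..<n}"
    using supp_inD[OF assms] by blast
qed auto

lemma norm_finmat_sq:
  assumes "supp_in n A"
  shows "(norm A)\<^sup>2 = (\<Sum>i<n. \<Sum>j<n. (cmod (entry A i j))\<^sup>2)"
  unfolding norm_finmat[OF assms] L2_set_def
  by (simp add: sum_nonneg sum.cartesian_product case_prod_unfold)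

instance
proof
  fix A B :: finmat and r :: real
  obtain n where n: "supp_in n A" "supp_in n B" by (rule supp_in_common2)
  show "dist A B = norm (A - B)" by (fact dist_finmat_def)
  show "sgn A = A /\<^sub>R norm A" by (fact sgn_finmat_def)
  show "uniformity = (INF e\<in>{0<..}. principal {(x, y::finmat). dist x y < e})"
    by (fact uniformity_finmat_def)
  show "open U = (\<forall>x\<in>U. \<forall>\<^sub>F (x', y) in uniformity. x' = x \<longrightarrow> y \<in> U)" for U :: "finmat set"
    by (fact open_finmat_def)
  show "norm A = 0 \<longleftrightarrow> A = 0"
  proof
    assume "norm A = 0"
    then have "\<forall>p\<in>{..<n} \<times> {..<n}. (case p of (i, j) \<Rightarrow> cmod (entry A i j)) = 0"
      unfolding norm_finmat[OF n(1)] by (subst (asm) L2_set_eq_0_iff) auto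
    then have "entry A i j = 0" if "i < n" "j < n" for i j using that by auto
    then show "A = 0" by (intro finmat_eqI) (metis entry_zero supp_inD[OF n(1)])
  qed (simp add: norm_finmat_def)
  show "norm (A + B) \<le> norm A + norm B"
  proof -
    have "norm (A + B) \<le> L2_set (\<lambda>p. (case p of (i, j) \<Rightarrow> cmod (entry A i j)) +
        (case p of (i, j) \<Rightarrow> cmod (entry B i j))) ({..<n} \<times> {..<n})"
      unfolding norm_finmat[OF supp_in_add[OF n]]
      by (rule L2_set_mono) (simp_all only: case_prod_unfold entry_add norm_triangle_ineq norm_ge_zero)
    also have "\<dots> \<le> norm A + norm B"
      unfolding norm_finmat[OF n(1)] norm_finmat[OF n(2)] by (rule L2_set_triangle_ineq)
    finally show ?thesis .
  qed
  show "norm (r *\<^sub>R A) = \<bar>r\<bar> * norm A"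
    unfolding norm_finmat[OF n(1)] norm_finmat[OF supp_in_scaleR[OF n(1)]]
    by (simp add: L2_set_right_distrib case_prod_unfold)
  show "norm (A * B) \<le> norm A * norm B"
  proof (rule power2_le_imp_le)
    \<comment> \<open>By Cauchy-Schwarz an entry of the product is at most the length of a row of A
      times the length of a column of B. The double sum of the squares of these bounds
      factorises.\<close>
    let ?a = "\<lambda>i. L2_set (\<lambda>k. cmod (entry A i k)) {..<n}"
    let ?b = "\<lambda>j. L2_set (\<lambda>k. cmod (entry B k j)) {..<n}"
    have sq: "(L2_set f {..<n})\<^sup>2 = (\<Sum>k<n. (f k)\<^sup>2)" for f :: "nat \<Rightarrow> real"
      by (simp add: L2_set_def sum_nonneg)
    have "(norm (A * B))\<^sup>2 = (\<Sum>i<n. \<Sum>j<n. (cmod (entry (A * B) i j))\<^sup>2)"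
      by (rule norm_finmat_sq[OF supp_in_times[OF n]])
    also have "\<dots> \<le> (\<Sum>i<n. \<Sum>j<n. (?a i * ?b j)\<^sup>2)"
    proof (intro sum_mono power_mono)
      fix i j
      have "cmod (entry (A * B) i j) \<le> (\<Sum>k<n. \<bar>cmod (entry A i k)\<bar> * \<bar>cmod (entry B k j)\<bar>)"
        unfolding entry_times[OF n(1)]
        by (rule order_trans[OF norm_sum]) (simp add: norm_mult)
      also have "\<dots> \<le> ?a i * ?b j" by (rule L2_set_mult_ineq)
      finally show "cmod (entry (A * B) i j) \<le> ?a i * ?b j" .
    qed auto
    also have "\<dots> = (\<Sum>i<n. (?a i)\<^sup>2) * (\<Sum>j<n. (?b j)\<^sup>2)"
      by (simp add: power_mult_distrib sum_product)
    also have "(\<Sum>i<n. (?a i)\<^sup>2) = (norm A)\<^sup>2"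
      unfolding sq norm_finmat_sq[OF n(1)] ..
    also have "(\<Sum>j<n. (?b j)\<^sup>2) = (norm B)\<^sup>2"
      unfolding sq norm_finmat_sq[OF n(2)] by (rule sum.swap)
    finally show "(norm (A * B))\<^sup>2 \<le> (norm A * norm B)\<^sup>2"
      by (simp add: power_mult_distrib)
  qed (simp add: norm_finmat_def)
qed

end

section \<open>Trace and the Hilbert-Schmidt pairing\<close>

definition tr :: "finmat \<Rightarrow> complex" where
  "tr A = (\<Sum>i | entry A i i \<noteq> 0. entry A i i)"

lemma tr_eq: "supp_in n A \<Longrightarrow> tr A = (\<Sum>i<n. entry A i i)"
  unfolding tr_def by (rule sum.mono_neutral_left) (auto dest: supp_inD)

lemma tr_add: "tr (A + B) = tr A + tr B"
proof -
  obtain n where n: "supp_in n A" "supp_in n B" by (rule supp_in_common2)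
  show ?thesis
    by (simp add: tr_eq[OF n(1)] tr_eq[OF n(2)] tr_eq[OF supp_in_add[OF n]] sum.distrib)
qed

lemma tr_scaleR: "tr (r *\<^sub>R A) = r *\<^sub>R tr A"
proof -
  obtain n where n: "supp_in n A" using supp_in_ex by blast
  show ?thesis by (simp add: tr_eq[OF n] tr_eq[OF supp_in_scaleR[OF n]] scaleR_sum_right)
qed

lemma tr_times: "supp_in n A \<Longrightarrow> supp_in n B \<Longrightarrow> tr (A * B) = (\<Sum>i<n. \<Sum>j<n. entry A i j * entry B j i)"
  by (simp add: tr_eq[OF supp_in_times] entry_times)

lemma tr_commute: "tr (A * B) = tr (B * A)"
proof -
  obtain n where n: "supp_in n A" "supp_in n B" by (rule supp_in_common2)
  show ?thesis
    unfolding tr_times[OF n] tr_times[OF n(2,1)]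
    by (subst sum.swap) (simp add: mult.commute)
qed

text \<open>Cauchy-Schwarz for the pairing of A with the transpose of B; transposition only permutes
  the entries and so preserves the norm.\<close>

lemma norm_tr_times_le: "cmod (tr (A * B)) \<le> norm A * norm B"
proof -
  obtain n where n: "supp_in n A" "supp_in n B" by (rule supp_in_common2)
  have "cmod (tr (A * B)) \<le> (\<Sum>i<n. \<Sum>j<n. cmod (entry A i j) * cmod (entry B j i))"
    unfolding tr_times[OF n] by (intro order_trans[OF norm_sum] sum_mono) (simp add: norm_mult)
  also have "\<dots> = (\<Sum>p\<in>{..<n} \<times> {..<n}. \<bar>case p of (i, j) \<Rightarrow> cmod (entry A i j)\<bar> *
      \<bar>case p of (i, j) \<Rightarrow> cmod (entry B j i)\<bar>)"
    by (simp add: sum.cartesian_product case_prod_unfold)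
  also have "\<dots> \<le> L2_set (\<lambda>(i, j). cmod (entry A i j)) ({..<n} \<times> {..<n}) *
      L2_set (\<lambda>(i, j). cmod (entry B j i)) ({..<n} \<times> {..<n})"
    by (rule L2_set_mult_ineq)
  also have "L2_set (\<lambda>(i, j). cmod (entry B j i)) ({..<n} \<times> {..<n}) =
      L2_set (\<lambda>(i, j). cmod (entry B i j)) ({..<n} \<times> {..<n})"
    unfolding L2_set_def
    by (intro arg_cong[where f = sqrt] sum.reindex_bij_witness[of _ prod.swap prod.swap]) auto
  finally show ?thesis unfolding norm_finmat[OF n(1)] norm_finmat[OF n(2)] .
qed

lemma bounded_linear_entry: "bounded_linear (\<lambda>A. entry A i j)"
proof
  fix A B :: finmat and r :: real
  show "entry (A + B) i j = entry A i j + entry B i j" "entry (r *\<^sub>R A) i j = r *\<^sub>R entry A i j"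
    by simp_all
  have "cmod (entry A i j) \<le> norm A * 1" for A
  proof (cases "entry A i j = 0")
    case True
    then show ?thesis by simp
  next
    case False
    obtain n where n: "supp_in n A" using supp_in_ex by blast
    have "(case (i, j) of (i, j) \<Rightarrow> cmod (entry A i j)) \<le> norm A"
      unfolding norm_finmat[OF n] by (rule member_le_L2_set) (use supp_inD[OF n False] in auto)
    then show ?thesis by simp
  qed
  then show "\<exists>K. \<forall>A. cmod (entry A i j) \<le> norm A * K" by blast
qed

section \<open>Embedding of square matrices\<close>

definition emb :: "cmat \<Rightarrow> finmat" where
  "emb A = Abs_finmat (\<lambda>i j. if i < dim_row A \<and> j < dim_col A then A $$ (i, j) else 0)"

lemma entry_emb: "entry (emb A) i j = (if i < dim_row A \<and> j < dim_col A then A $$ (i, j) else 0)"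
  unfolding emb_def by (subst Abs_finmat_inverse) (auto intro!: exI[of _ "max (dim_row A) (dim_col A)"])

lemma supp_in_emb: "A \<in> carrier_mat n n \<Longrightarrow> supp_in n (emb A)"
  by (auto simp: supp_in_def entry_emb)

lemma emb_mult:
  assumes "A \<in> carrier_mat n n" "B \<in> carrier_mat n n"
  shows "emb (A * B) = emb A * emb B"
  by (rule finmat_eqI)
    (use assms in \<open>auto simp: entry_times[OF supp_in_emb[OF assms(1)]] entry_emb scalar_prod_def
      atLeast0LessThan intro!: sum.neutral sum.cong\<close>)

lemma emb_one_mult: "supp_in n A \<Longrightarrow> emb (1\<^sub>m n) * A = A"
proof (rule finmat_eqI)
  fix i j
  assume A: "supp_in n A"
  have "entry (emb (1\<^sub>m n) * A) i j = (\<Sum>k<n. if k = i then entry A k j else 0)"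
    unfolding entry_times[OF supp_in_emb[OF one_carrier_mat]]
    by (rule sum.cong) (auto simp: entry_emb)
  then show "entry (emb (1\<^sub>m n) * A) i j = entry A i j"
    using A by (auto simp: supp_in_def)
qed

lemma emb_mult_one: "supp_in n A \<Longrightarrow> A * emb (1\<^sub>m n) = A"
proof (rule finmat_eqI)
  fix i j
  assume A: "supp_in n A"
  have "entry (A * emb (1\<^sub>m n)) i j = (\<Sum>k<n. if k = j then entry A i k else 0)"
    unfolding entry_times[OF A]
    by (rule sum.cong) (auto simp: entry_emb)
  then show "entry (A * emb (1\<^sub>m n)) i j = entry A i j"
    using A by (auto simp: supp_in_def)
qed

lemma emb_diff: "A \<in> carrier_mat n n \<Longrightarrow> B \<in> carrier_mat n n \<Longrightarrow> emb (A - B) = emb A - emb B"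
  by (rule finmat_eqI) (auto simp: entry_emb)

lemma emb_smult: "emb (complex_of_real r \<cdot>\<^sub>m A) = r *\<^sub>R emb A"
  by (rule finmat_eqI) (auto simp: entry_emb scaleR_conv_of_real)

section \<open>Spectral theorem and reduced resolvent\<close>

lemma mat_adjoint_carrier [simp]: "A \<in> carrier_mat m n \<Longrightarrow> mat_adjoint A \<in> carrier_mat n m"
  unfolding mat_adjoint_def mat_of_rows_def carrier_mat_def by simp

lemma dim_mat_adjoint [simp]:
  "dim_row (mat_adjoint A) = dim_col A" "dim_col (mat_adjoint A) = dim_row A"
  unfolding mat_adjoint_def mat_of_rows_def by simp_all

lemma index_mat_adjoint [simp]:
  fixes A :: cmat
  shows "i < dim_col A \<Longrightarrow> j < dim_row A \<Longrightarrow> mat_adjoint A $$ (i, j) = cnj (A $$ (j, i))"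
  unfolding mat_adjoint_def mat_of_rows_def by simp

lemma mat_adjoint_mult:
  fixes A B :: cmat
  assumes "A \<in> carrier_mat m n" "B \<in> carrier_mat n k"
  shows "mat_adjoint (A * B) = mat_adjoint B * mat_adjoint A"
  by (rule eq_matI) (use assms in \<open>auto simp: scalar_prod_def mult.commute\<close>)

lemma mat_adjoint_adjoint [simp]: "mat_adjoint (mat_adjoint A) = (A :: cmat)"
  by (rule eq_matI) auto

lemma cscalar_prod_vnorm: "v \<bullet>c v = complex_of_real ((vnorm v)\<^sup>2)"
proof -
  have "(vnorm v)\<^sup>2 = (\<Sum>k<dim_vec v. (cmod (v $ k))\<^sup>2)"
    by (simp add: vnorm_def sum_nonneg)
  then show ?thesis
    by (simp add: scalar_prod_def atLeast0LessThan complex_norm_square flip: of_real_power)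
qed

text \<open>Gram-Schmidt, applied to a basis with head v, leaves the head unchanged. Normalising the
  orthogonal vectors gives the columns of W, so the first one is a multiple of v.\<close>

lemma unitary_completion:
  assumes v: "v \<in> carrier_vec n" "v \<noteq> 0\<^sub>v n"
  obtains W :: cmat and r :: complex where "W \<in> carrier_mat n n" "mat_adjoint W * W = 1\<^sub>m n"
    "col W 0 = r \<cdot>\<^sub>v v"
proof -
  interpret cof_vec_space n "TYPE(complex)" .
  define b where "b = basis_completion v"
  define ws where "ws = gram_schmidt n b"
  have n: "n \<noteq> 0" using v by auto
  from basis_completion[OF v, folded b_def]
  have dist_b: "distinct b" and indep: "\<not> lin_dep (set b)" and b: "set b \<subseteq> carrier_vec n"
    and hdb: "hd b = v" and len_b: "length b = n" by auto
  from hdb len_b n obtain vs where bv: "b = v # vs" by (cases b) auto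
  from gram_schmidt_result[OF b dist_b indep refl, folded ws_def]
  have ws: "set ws \<subseteq> carrier_vec n" "corthogonal ws" "length ws = n" by (auto simp: len_b)
  from gram_schmidt_hd[OF v(1), of vs, folded bv] have hdws: "hd ws = v" unfolding ws_def .
  define us where "us = map (\<lambda>w. complex_of_real (1 / vnorm w) \<cdot>\<^sub>v w) ws"
  have us: "set us \<subseteq> carrier_vec n" "length us = n" using ws by (auto simp: us_def)
  let ?W = "mat_of_cols n us"
  have W: "?W \<in> carrier_mat n n" using us by auto
  have "mat_adjoint ?W * ?W = 1\<^sub>m n"
  proof (rule eq_matI)
    fix i j assume "i < dim_row (1\<^sub>m n :: cmat)" "j < dim_col (1\<^sub>m n :: cmat)"
    then have ij: "i < n" "j < n" by auto
    have ci: "ws ! i \<in> carrier_vec n" "ws ! j \<in> carrier_vec n"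
      using ij ws by (auto dest: nth_mem)
    have "(mat_adjoint ?W * ?W) $$ (i, j) = (\<Sum>k<n. cnj (us ! i $ k) * us ! j $ k)"
      using ij us W by (simp add: scalar_prod_def atLeast0LessThan mat_of_cols_index)
    also have "\<dots> = (\<Sum>k<n. complex_of_real (1 / (vnorm (ws ! i) * vnorm (ws ! j))) *
        (ws ! j $ k * cnj (ws ! i $ k)))"
      using ij ws ci by (intro sum.cong) (auto simp: us_def)
    also have "\<dots> = complex_of_real (1 / (vnorm (ws ! i) * vnorm (ws ! j))) * (ws ! j \<bullet>c ws ! i)"
      using ci by (simp add: scalar_prod_def atLeast0LessThan sum_distrib_left)
    also have "\<dots> = (if i = j then 1 else 0)"
    proof (cases "i = j")
      case True
      have "ws ! i \<bullet>c ws ! i \<noteq> 0" using corthogonalD[OF ws(2)] ij ws(3) by auto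
      then have "vnorm (ws ! i) \<noteq> 0" by (auto simp: cscalar_prod_vnorm)
      then show ?thesis using True by (simp add: cscalar_prod_vnorm power2_eq_square)
    next
      case False
      then show ?thesis using corthogonalD[OF ws(2), of j i] ij ws(3) by auto
    qed
    finally show "(mat_adjoint ?W * ?W) $$ (i, j) = 1\<^sub>m n $$ (i, j)" using ij by simp
  qed (use W in auto)
  moreover have "col ?W 0 = complex_of_real (1 / vnorm v) \<cdot>\<^sub>v v"
  proof -
    have "ws ! 0 = v" using hdws ws(3) n by (cases ws) auto
    then have "us ! 0 = complex_of_real (1 / vnorm v) \<cdot>\<^sub>v v" using ws(3) n by (simp add: us_def)
    then show ?thesis using us n v by (subst col_mat_of_cols) auto
  qed
  ultimately show ?thesis using that W by blast
qed

definition diag_of :: "complex list \<Rightarrow> cmat" where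
  "diag_of es = Matrix.mat (length es) (length es) (\<lambda>(i, j). if i = j then es ! i else 0)"

lemma mat_adjoint_four_block:
  fixes A B :: cmat
  assumes "A \<in> carrier_mat k k" "B \<in> carrier_mat m m"
  shows "mat_adjoint (four_block_mat A (0\<^sub>m k m) (0\<^sub>m m k) B) =
    four_block_mat (mat_adjoint A) (0\<^sub>m k m) (0\<^sub>m m k) (mat_adjoint B)"
  by (rule eq_matI) (use assms in auto)

lemma mat_adjoint_one [simp]: "mat_adjoint (1\<^sub>m n) = (1\<^sub>m n :: cmat)"
  by (rule eq_matI) auto

lemma mult_block_diag:
  fixes A B :: cmat
  assumes "A \<in> carrier_mat k k" "A' \<in> carrier_mat k k" "B \<in> carrier_mat m m" "B' \<in> carrier_mat m m"
  shows "four_block_mat A (0\<^sub>m k m) (0\<^sub>m m k) B * four_block_mat A' (0\<^sub>m k m) (0\<^sub>m m k) B' =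
    four_block_mat (A * A') (0\<^sub>m k m) (0\<^sub>m m k) (B * B')"
proof -
  have "A * A' \<in> carrier_mat k k" "B * B' \<in> carrier_mat m m" using assms by auto
  then show ?thesis
    by (subst mult_four_block_mat[OF assms(1) zero_carrier_mat zero_carrier_mat assms(3)
          assms(2) zero_carrier_mat zero_carrier_mat assms(4)])
      (use assms in simp)
qed

text \<open>Deflation: in an orthonormal basis that starts with an eigenvector for the head of
  \<open>es\<close>, the matrix splits into a 1x1 block and a smaller Hermitian one. Since the head
  is split off first, the diagonal appears in the order of \<open>es\<close>, whatever that order
  is.\<close>

lemma hermitian_diagonalization:
  fixes A :: cmat
  assumes "A \<in> carrier_mat n n" "mat_adjoint A = A" "char_poly A = (\<Prod>e\<leftarrow>es. [:- e, 1:])"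
  shows "\<exists>U\<in>carrier_mat n n. mat_adjoint U * U = 1\<^sub>m n \<and> mat_adjoint U * A * U = diag_of es"
  using assms
proof (induction es arbitrary: n A)
  case Nil
  with degree_monic_char_poly[of A n] have "n = 0" by simp
  with Nil show ?case by (intro bexI[of _ "1\<^sub>m 0"]) (auto simp: diag_of_def intro!: eq_matI)
next
  case (Cons e es n A)
  note A = Cons.prems(1) and herm = Cons.prems(2)
  have cp: "char_poly A = [:- e, 1:] * (\<Prod>e\<leftarrow>es. [:- e, 1:])" using Cons.prems by simp
  define m where "m = n - 1"
  have mon: "monic (\<Prod>e\<leftarrow>es. [:- e, 1:])" by (rule monic_prod_list) auto
  have "degree (char_poly A) = Suc (degree (\<Prod>e\<leftarrow>es. [:- e, 1:]))"
    unfolding cp by (subst degree_mult_eq) (use mon in auto)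
  then have "n \<noteq> 0" using degree_monic_char_poly[OF A] by auto
  then have n: "n = Suc m" by (simp add: m_def)
  have "eigenvalue A e" unfolding eigenvalue_root_char_poly[OF A] cp by simp
  then obtain v where v: "v \<in> carrier_vec n" "v \<noteq> 0\<^sub>v n" "A *\<^sub>v v = e \<cdot>\<^sub>v v"
    using A by (auto simp: eigenvalue_def eigenvector_def)
  obtain W r where W: "W \<in> carrier_mat n n" "mat_adjoint W * W = 1\<^sub>m n" "col W 0 = r \<cdot>\<^sub>v v"
    by (rule unitary_completion[OF v(1,2)])
  let ?W' = "mat_adjoint W"
  have W': "?W' \<in> carrier_mat n n" using W by simp
  have WW': "W * ?W' = 1\<^sub>m n" by (rule mat_mult_left_right_inverse[OF W' W(1,2)])
  define B where "B = ?W' * A * W"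
  have B: "B \<in> carrier_mat n n" unfolding B_def by (intro mult_carrier_mat[of _ n n] W W' A)
  have hermB: "mat_adjoint B = B"
  proof -
    have "mat_adjoint B = ?W' * mat_adjoint (?W' * A)"
      unfolding B_def using W W' A by (subst mat_adjoint_mult[of _ n n]) auto
    also have "mat_adjoint (?W' * A) = A * W"
      using W W' A herm by (subst mat_adjoint_mult[of _ n n]) auto
    finally show ?thesis unfolding B_def assoc_mult_mat[OF W' A W(1)] .
  qed
  have simBA: "similar_mat B A"
    unfolding similar_mat_def
    by (intro exI[of _ ?W'] exI[of _ W] similar_mat_witI[OF W(2) WW' B_def B A W' W(1)])
  have col0: "B $$ (i, 0) = (if i = 0 then e else 0)" if i: "i < n" for i
  proof -
    have "col B 0 = ?W' *\<^sub>v (A *\<^sub>v col W 0)"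
      unfolding B_def assoc_mult_mat[OF W' A W(1)]
      using n by (simp add: col_mult2[OF W' mult_carrier_mat[OF A W(1)]] col_mult2[OF A W(1)])
    also have "A *\<^sub>v col W 0 = e \<cdot>\<^sub>v col W 0"
      using A v by (simp add: W(3) mult_mat_vec smult_smult_assoc mult.commute)
    also have "?W' *\<^sub>v (e \<cdot>\<^sub>v col W 0) = e \<cdot>\<^sub>v (?W' *\<^sub>v col W 0)"
      by (rule mult_mat_vec[OF W']) (use W(3) v(1) in simp)
    also have "?W' *\<^sub>v col W 0 = col (?W' * W) 0" using n by (simp add: col_mult2[OF W' W(1)])
    also have "\<dots> = unit_vec n 0" using n by (simp add: W(2))
    finally have "col B 0 $ i = (e \<cdot>\<^sub>v unit_vec n 0) $ i" by simp
    then show ?thesis using i B n by (simp split: if_splits)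
  qed
  \<comment> \<open>Hermiticity carries the zeros of the first column over to the first row.\<close>
  have row0: "B $$ (0, j) = 0" if j: "0 < j" "j < n" for j
  proof -
    have "B $$ (0, j) = mat_adjoint B $$ (0, j)" by (simp add: hermB)
    also have "\<dots> = cnj (B $$ (j, 0))" using B j n by (subst index_mat_adjoint) auto
    finally show ?thesis using col0 j by simp
  qed
  define C where "C = Matrix.mat m m (\<lambda>(i, j). B $$ (Suc i, Suc j))"
  define D where "D = Matrix.mat 1 1 (\<lambda>_. e)"
  have C: "C \<in> carrier_mat m m" and D: "D \<in> carrier_mat 1 1" by (auto simp: C_def D_def)
  have Bblock: "B = four_block_mat D (0\<^sub>m 1 m) (0\<^sub>m m 1) C"
    by (rule eq_matI) (use B n row0 col0 in \<open>auto simp: C_def D_def\<close>)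
  have hermC: "mat_adjoint C = C"
  proof (rule eq_matI)
    fix i j assume "i < dim_row C" "j < dim_col C"
    then have ij: "i < m" "j < m" using C by auto
    have "B $$ (Suc i, Suc j) = mat_adjoint B $$ (Suc i, Suc j)" by (simp add: hermB)
    also have "\<dots> = cnj (B $$ (Suc j, Suc i))" using B ij n by (subst index_mat_adjoint) auto
    finally show "mat_adjoint C $$ (i, j) = C $$ (i, j)" using ij by (simp add: C_def)
  qed (use C in auto)
  \<comment> \<open>For a block-diagonal matrix the characteristic polynomials multiply; cancelling
    the linear factor of the 1x1 block leaves the hypothesis needed for the smaller block.\<close>
  have "[:- e, 1:] * (\<Prod>e\<leftarrow>es. [:- e, 1:]) = char_poly D * char_poly C"
    using char_poly_similar[OF simBA] cp
    unfolding Bblock char_poly_four_block_zeros_col[OF D zero_carrier_mat C] by (simp only:)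
  also have "char_poly D = [:- e, 1:]" by (simp add: D_def char_poly_defs det_def sign_def)
  finally have "char_poly C = (\<Prod>e\<leftarrow>es. [:- e, 1:])"
    by (metis mult_cancel_left pCons_eq_0_iff zero_neq_one)
  from Cons.IH[OF C hermC this] obtain V where V: "V \<in> carrier_mat m m" "mat_adjoint V * V = 1\<^sub>m m"
    "mat_adjoint V * C * V = diag_of es" by auto
  have len: "length es = m" using arg_cong[OF V(3), of dim_col] V(1) by (simp add: diag_of_def)
  let ?V = "four_block_mat (1\<^sub>m 1) (0\<^sub>m 1 m) (0\<^sub>m m 1) V"
  have V4: "?V \<in> carrier_mat n n" using V n by auto
  have adjV: "mat_adjoint ?V = four_block_mat (1\<^sub>m 1) (0\<^sub>m 1 m) (0\<^sub>m m 1) (mat_adjoint V)"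
    by (simp only: mat_adjoint_four_block[OF one_carrier_mat V(1)] mat_adjoint_one)
  have one4: "four_block_mat (1\<^sub>m 1) (0\<^sub>m 1 m) (0\<^sub>m m 1) (1\<^sub>m m) = (1\<^sub>m n :: cmat)"
    by (rule eq_matI) (use n in auto)
  have aV': "mat_adjoint V \<in> carrier_mat m m" using V(1) by simp
  have VV: "mat_adjoint ?V * ?V = 1\<^sub>m n"
    unfolding adjV mult_block_diag[OF one_carrier_mat one_carrier_mat aV' V(1)] V(2)
    by (simp only: left_mult_one_mat[OF one_carrier_mat] one4)
  have VBV: "mat_adjoint ?V * B * ?V = diag_of (e # es)"
  proof -
    have "mat_adjoint ?V * B * ?V =
        four_block_mat (1\<^sub>m 1 * D * 1\<^sub>m 1) (0\<^sub>m 1 m) (0\<^sub>m m 1) (mat_adjoint V * C * V)"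
      unfolding adjV Bblock mult_block_diag[OF one_carrier_mat D aV' C]
      by (rule mult_block_diag[OF mult_carrier_mat[OF one_carrier_mat D] one_carrier_mat
            mult_carrier_mat[OF aV' C] V(1)])
    also have "1\<^sub>m 1 * D * 1\<^sub>m 1 = D" using D by simp
    also have "four_block_mat D (0\<^sub>m 1 m) (0\<^sub>m m 1) (mat_adjoint V * C * V) = diag_of (e # es)"
      unfolding V(3) by (rule eq_matI) (use len in \<open>auto simp: diag_of_def D_def nth_Cons'\<close>)
    finally show ?thesis .
  qed
  show ?case
  proof (intro bexI conjI)
    show U: "W * ?V \<in> carrier_mat n n" by (intro mult_carrier_mat[of _ n n] W V4)
    have adjU: "mat_adjoint (W * ?V) = mat_adjoint ?V * ?W'"
      using W V4 by (intro mat_adjoint_mult) auto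
    have aV: "mat_adjoint ?V \<in> carrier_mat n n" using V4 by (rule mat_adjoint_carrier)
    have "mat_adjoint (W * ?V) * (W * ?V) = mat_adjoint ?V * (?W' * W) * ?V"
      unfolding adjU by (simp only: assoc_mult_mat[OF aV W' U] assoc_mult_mat[OF W' W(1) V4, symmetric]
          assoc_mult_mat[OF aV mult_carrier_mat[OF W' W(1)] V4])
    then show "mat_adjoint (W * ?V) * (W * ?V) = 1\<^sub>m n" by (simp only: W(2) right_mult_one_mat[OF aV] VV)
    have "mat_adjoint (W * ?V) * A * (W * ?V) = mat_adjoint ?V * B * ?V"
    proof -
      have "mat_adjoint (W * ?V) * A * (W * ?V) = mat_adjoint ?V * (?W' * A) * (W * ?V)"
        unfolding adjU by (simp only: assoc_mult_mat[OF aV W' A])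
      also have "\<dots> = mat_adjoint ?V * (?W' * A * (W * ?V))"
        by (simp only: assoc_mult_mat[OF aV mult_carrier_mat[OF W' A] U])
      also have "?W' * A * (W * ?V) = B * ?V"
        unfolding B_def by (simp only: assoc_mult_mat[OF mult_carrier_mat[OF W' A] W(1) V4])
      also have "mat_adjoint ?V * (B * ?V) = mat_adjoint ?V * B * ?V"
        by (simp only: assoc_mult_mat[OF aV B V4])
      finally show ?thesis .
    qed
    then show "mat_adjoint (W * ?V) * A * (W * ?V) = diag_of (e # es)" by (simp only: VBV)
  qed
qed

section \<open>Rank-one operators\<close>

lemma vnorm_sq: "v \<in> carrier_vec n \<Longrightarrow> (vnorm v)\<^sup>2 = (\<Sum>k<n. (cmod (v $ k))\<^sup>2)"
  by (simp add: vnorm_def sum_nonneg)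

lemma ketbra_carrier [simp]: "u \<in> carrier_vec n \<Longrightarrow> v \<in> carrier_vec n \<Longrightarrow> ketbra u v \<in> carrier_mat n n"
  by (auto simp: ketbra_def)

lemma entry_ketbra:
  "u \<in> carrier_vec n \<Longrightarrow> v \<in> carrier_vec n \<Longrightarrow>
    entry (emb (ketbra u v)) i j = (if i < n \<and> j < n then u $ i * cnj (v $ j) else 0)"
  by (auto simp: entry_emb ketbra_def)

lemma tr_ketbra:
  assumes "v \<in> carrier_vec n"
  shows "tr (emb (ketbra v v)) = complex_of_real ((vnorm v)\<^sup>2)"
  using assms
  by (simp add: tr_eq[OF supp_in_emb[OF ketbra_carrier]] entry_ketbra vnorm_sq complex_norm_square
      flip: of_real_power)

lemma norm_ketbra:
  assumes v: "v \<in> carrier_vec n"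
  shows "norm (emb (ketbra v v)) = (vnorm v)\<^sup>2"
proof (rule power2_eq_imp_eq)
  have "(norm (emb (ketbra v v)))\<^sup>2 = (\<Sum>i<n. \<Sum>j<n. (cmod (v $ i))\<^sup>2 * (cmod (v $ j))\<^sup>2)"
    using v by (simp add: norm_finmat_sq[OF supp_in_emb[OF ketbra_carrier[OF v v]]] entry_ketbra
        norm_mult power_mult_distrib)
  also have "\<dots> = ((vnorm v)\<^sup>2)\<^sup>2"
    unfolding vnorm_sq[OF v] by (simp add: power2_eq_square sum_product)
  finally show "(norm (emb (ketbra v v)))\<^sup>2 = ((vnorm v)\<^sup>2)\<^sup>2" .
qed auto

lemma emb_mult_ketbra:
  assumes A: "A \<in> carrier_mat n n" and v: "v \<in> carrier_vec n" and w: "w \<in> carrier_vec n"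
  shows "emb A * emb (ketbra v w) = emb (ketbra (A *\<^sub>v v) w)"
proof (rule finmat_eqI)
  fix i j
  have Av: "A *\<^sub>v v \<in> carrier_vec n" using A v by simp
  have "entry (emb A * emb (ketbra v w)) i j =
      (\<Sum>k<n. entry (emb A) i k * (if k < n \<and> j < n then v $ k * cnj (w $ j) else 0))"
    by (simp add: entry_times[OF supp_in_emb[OF A]] entry_ketbra[OF v w])
  also have "\<dots> = (if i < n \<and> j < n then (A *\<^sub>v v) $ i * cnj (w $ j) else 0)"
    using A v by (auto simp: entry_emb scalar_prod_def atLeast0LessThan sum_distrib_right mult.assoc
        intro!: sum.cong)
  finally show "entry (emb A * emb (ketbra v w)) i j = entry (emb (ketbra (A *\<^sub>v v) w)) i j"
    by (simp add: entry_ketbra[OF Av w])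
qed

text \<open>Hermiticity is what lets a factor on the right act on the vector inside the bra.\<close>

lemma emb_ketbra_mult:
  assumes A: "A \<in> carrier_mat n n" "mat_adjoint A = A" and v: "v \<in> carrier_vec n" and w: "w \<in> carrier_vec n"
  shows "emb (ketbra v w) * emb A = emb (ketbra v (A *\<^sub>v w))"
proof (rule finmat_eqI)
  fix i j
  have Aw: "A *\<^sub>v w \<in> carrier_vec n" using A w by simp
  have cnjA: "cnj (A $$ (j, k)) = A $$ (k, j)" if "k < n" "j < n" for k j
    using that A(1) index_mat_adjoint[of k A j] by (simp add: A(2))
  have "entry (emb (ketbra v w) * emb A) i j =
      (\<Sum>k<n. (if i < n \<and> k < n then v $ i * cnj (w $ k) else 0) * entry (emb A) k j)"
    by (simp add: entry_times[OF supp_in_emb[OF ketbra_carrier[OF v w]]] entry_ketbra[OF v w])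
  also have "\<dots> = (if i < n \<and> j < n then v $ i * cnj ((A *\<^sub>v w) $ j) else 0)"
    using A(1) w by (auto simp: entry_emb scalar_prod_def atLeast0LessThan sum_distrib_left mult_ac cnjA
        intro!: sum.cong)
  finally show "entry (emb (ketbra v w) * emb A) i j = entry (emb (ketbra v (A *\<^sub>v w))) i j"
    by (simp add: entry_ketbra[OF v Aw])
qed

section \<open>The sorted real spectrum\<close>

lemma proots_prod_list_linear: "proots (\<Prod>a\<leftarrow>as. [:- a, 1:]) = mset (as :: 'a :: idom list)"
proof (induction as)
  case (Cons a as)
  have "(\<Prod>a\<leftarrow>as. [:- a, 1:]) \<noteq> 0" by (auto simp: prod_list_zero_iff)
  then show ?case using Cons by (simp add: proots_mult del: mult_pCons_left)
qed simp

lemma prod_list_map_mset_cong: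
  fixes f :: "'a \<Rightarrow> 'b :: comm_monoid_mult"
  assumes "mset xs = mset ys"
  shows "prod_list (map f xs) = prod_list (map f ys)"
  using arg_cong[OF assms, of "\<lambda>M. prod_mset (image_mset f M)"]
  unfolding mset_map[symmetric] prod_mset_prod_list .

text \<open>A first diagonalization, with the roots in some order, is again Hermitian, so its
  diagonal is real and taking real parts loses nothing. The sorted list is then a permutation of the
  roots and factorises the same polynomial, which permits a second diagonalization in increasing
  order.\<close>

lemma hermitian_eigenvalue_list:
  assumes A: "A \<in> carrier_mat n n" "mat_adjoint A = A"
  shows "length (eigenvalue_list A) = n" "sorted (eigenvalue_list A)"
    "\<exists>U\<in>carrier_mat n n. mat_adjoint U * U = 1\<^sub>m n \<and>
      mat_adjoint U * A * U = diag_of (map complex_of_real (eigenvalue_list A))"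
proof -
  obtain as where as: "char_poly A = (\<Prod>a\<leftarrow>as. [:- a, 1:])" "length as = n"
    using char_poly_factorized[OF A(1)] by blast
  obtain U where U: "U \<in> carrier_mat n n" "mat_adjoint U * A * U = diag_of as"
    using hermitian_diagonalization[OF A as(1)] by blast
  have aU: "mat_adjoint U \<in> carrier_mat n n" using U(1) by simp
  have "mat_adjoint (diag_of as) = diag_of as"
    unfolding U(2)[symmetric] mat_adjoint_mult[OF mult_carrier_mat[OF aU A(1)] U(1)]
      mat_adjoint_mult[OF aU A(1)] A(2) mat_adjoint_adjoint
    by (rule assoc_mult_mat[OF aU A(1) U(1), symmetric])
  then have real: "cnj (as ! i) = as ! i" if "i < n" for i
    using that as(2) index_mat_adjoint[of i "diag_of as" i] by (simp add: diag_of_def)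
  have re: "complex_of_real (Re a) = a" if "a \<in> set as" for a
    using that real as(2) by (metis Reals_cnj_iff in_set_conv_nth of_real_Re)
  have ms: "mset (eigenvalue_list A) = image_mset Re (mset as)"
    by (simp add: eigenvalue_list_def as(1) proots_prod_list_linear)
  then show "length (eigenvalue_list A) = n" by (metis as(2) size_image_mset size_mset)
  show "sorted (eigenvalue_list A)" by (simp add: eigenvalue_list_def)
  let ?es = "map complex_of_real (eigenvalue_list A)"
  have "mset ?es = image_mset (\<lambda>a. complex_of_real (Re a)) (mset as)"
    by (simp add: ms image_mset.compositionality comp_def)
  also have "\<dots> = image_mset (\<lambda>a. a) (mset as)"
    by (rule image_mset_cong) (simp add: re)
  finally have "mset ?es = mset as" by simp
  then have "(\<Prod>a\<leftarrow>as. [:- a, 1:]) = (\<Prod>a\<leftarrow>?es. [:- a, 1:])"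
    by (intro prod_list_map_mset_cong) simp
  then show "\<exists>U\<in>carrier_mat n n. mat_adjoint U * U = 1\<^sub>m n \<and> mat_adjoint U * A * U = diag_of ?es"
    using hermitian_diagonalization[OF A] as(1) by simp
qed

section \<open>Diagonal and unitary elements\<close>

definition diagonal :: "nat \<Rightarrow> (nat \<Rightarrow> real) \<Rightarrow> finmat" where
  "diagonal n f = emb (Matrix.mat n n (\<lambda>(i, j). if i = j then complex_of_real (f i) else 0))"

lemma entry_diagonal: "entry (diagonal n f) i j = (if i = j \<and> i < n then complex_of_real (f i) else 0)"
  by (simp add: diagonal_def entry_emb)

lemma supp_in_diagonal: "supp_in n (diagonal n f)"
  by (simp add: supp_in_def entry_diagonal)

lemma entry_diagonal_mult: "entry (diagonal n f * X) i j = (if i < n then f i * entry X i j else 0)"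
proof -
  have "entry (diagonal n f * X) i j = (\<Sum>k<n. if k = i then f i * entry X i j else 0)"
    unfolding entry_times[OF supp_in_diagonal] by (rule sum.cong) (auto simp: entry_diagonal)
  then show ?thesis by simp
qed

lemma entry_mult_diagonal:
  assumes "supp_in n X"
  shows "entry (X * diagonal n f) i j = (if j < n then entry X i j * f j else 0)"
proof -
  have "entry (X * diagonal n f) i j = (\<Sum>k<n. if k = j then entry X i j * f j else 0)"
    unfolding entry_times[OF assms] by (rule sum.cong) (auto simp: entry_diagonal)
  then show ?thesis by simp
qed

lemma diagonal_mult: "diagonal n f * diagonal n g = diagonal n (\<lambda>i. f i * g i)"
  by (rule finmat_eqI) (simp add: entry_diagonal_mult, simp add: entry_diagonal)

lemma norm_diagonal_le:
  assumes "\<And>i. i < n \<Longrightarrow> \<bar>f i\<bar> \<le> B" "0 \<le> B"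
  shows "norm (diagonal n f) \<le> sqrt n * B"
proof (rule power2_le_imp_le)
  have "(norm (diagonal n f))\<^sup>2 = (\<Sum>i<n. \<Sum>j<n. if j = i then (f i)\<^sup>2 else 0)"
    unfolding norm_finmat_sq[OF supp_in_diagonal]
    by (intro sum.cong) (auto simp: entry_diagonal)
  also have "\<dots> = (\<Sum>i<n. (f i)\<^sup>2)" by simp
  also have "\<dots> \<le> (\<Sum>i<n. B\<^sup>2)"
    by (intro sum_mono) (use assms in \<open>auto simp: abs_le_square_iff[symmetric]\<close>)
  finally show "(norm (diagonal n f))\<^sup>2 \<le> (sqrt n * B)\<^sup>2" by (simp add: power_mult_distrib)
qed (use assms in simp)

text \<open>The columns of U are unit vectors, and the squared Frobenius norm adds up n of
  them.\<close>

lemma norm_unitary: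
  assumes U: "U \<in> carrier_mat n n" "mat_adjoint U * U = 1\<^sub>m n"
  shows "norm (emb U) = sqrt n" "norm (emb (mat_adjoint U)) = sqrt n"
proof -
  have aU: "mat_adjoint U \<in> carrier_mat n n" using U(1) by simp
  have 1: "(\<Sum>k<n. (cmod (entry (emb U) k i))\<^sup>2) = 1" if i: "i < n" for i
  proof -
    have "(mat_adjoint U * U) $$ (i, i) = (\<Sum>k<n. U $$ (k, i) * cnj (U $$ (k, i)))"
      using i U(1) by (simp add: scalar_prod_def atLeast0LessThan mult.commute)
    also have "\<dots> = (\<Sum>k<n. complex_of_real ((cmod (entry (emb U) k i))\<^sup>2))"
      by (rule sum.cong) (use i U(1) in \<open>auto simp: complex_norm_square entry_emb simp flip: of_real_power\<close>)
    also have "(mat_adjoint U * U) $$ (i, i) = complex_of_real 1" using i by (simp add: U(2))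
    finally show ?thesis by (simp only: of_real_sum[symmetric] of_real_eq_iff)
  qed
  have entry': "entry (emb (mat_adjoint U)) i k = cnj (entry (emb U) k i)" for i k
    using U(1) by (auto simp: entry_emb)
  have "(norm (emb (mat_adjoint U)))\<^sup>2 = (\<Sum>i<n. \<Sum>k<n. (cmod (entry (emb U) k i))\<^sup>2)"
    by (simp add: norm_finmat_sq[OF supp_in_emb[OF aU]] entry')
  also have "\<dots> = real n" by (simp add: 1)
  finally have "(norm (emb (mat_adjoint U)))\<^sup>2 = (sqrt n)\<^sup>2" by simp
  then show "norm (emb (mat_adjoint U)) = sqrt n" by (rule power2_eq_imp_eq) auto
  have "(norm (emb U))\<^sup>2 = (\<Sum>i<n. \<Sum>k<n. (cmod (entry (emb U) k i))\<^sup>2)"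
    unfolding norm_finmat_sq[OF supp_in_emb[OF U(1)]] by (rule sum.swap)
  also have "\<dots> = real n" by (simp add: 1)
  finally have "(norm (emb U))\<^sup>2 = (sqrt n)\<^sup>2" by simp
  then show "norm (emb U) = sqrt n" by (rule power2_eq_imp_eq) auto
qed

section \<open>Variational principle and reduced resolvent\<close>

locale hermitian =
  fixes A :: cmat and n :: nat
  assumes A: "A \<in> carrier_mat n n" and herm: "mat_adjoint A = A" and n: "n \<ge> 2"
begin

abbreviation "ev i \<equiv> eigenvalue_list A ! i"
abbreviation "u \<equiv> emb (1\<^sub>m n)"

lemma ev_mono: "i \<le> j \<Longrightarrow> j < n \<Longrightarrow> ev i \<le> ev j"
  using hermitian_eigenvalue_list[OF A herm] by (simp add: sorted_nth_mono)

lemma diagonalization: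
  obtains U U' where "supp_in n U" "supp_in n U'" "U * U' = u" "U' * U = u"
    "emb A = U * diagonal n ev * U'" "\<And>i j. entry U' i j = cnj (entry U j i)"
    "norm U = sqrt n" "norm U' = sqrt n"
proof -
  obtain V where V: "V \<in> carrier_mat n n" "mat_adjoint V * V = 1\<^sub>m n"
    "mat_adjoint V * A * V = diag_of (map complex_of_real (eigenvalue_list A))"
    using hermitian_eigenvalue_list(3)[OF A herm] by blast
  let ?V' = "mat_adjoint V"
  have V': "?V' \<in> carrier_mat n n" using V(1) by simp
  have VV': "V * ?V' = 1\<^sub>m n" by (rule mat_mult_left_right_inverse[OF V' V(1,2)])
  let ?D = "diag_of (map complex_of_real (eigenvalue_list A))"
  have len: "length (eigenvalue_list A) = n" by (rule hermitian_eigenvalue_list(1)[OF A herm])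
  have D: "?D \<in> carrier_mat n n" using len by (simp add: diag_of_def)
  have D_eq: "emb ?D = diagonal n ev"
    by (rule finmat_eqI) (auto simp: entry_diagonal entry_emb diag_of_def len)
  have U: "supp_in n (emb V)" "supp_in n (emb ?V')" using V V' by (auto intro: supp_in_emb)
  have UU': "emb V * emb ?V' = u" "emb ?V' * emb V = u"
    by (simp_all only: emb_mult[OF V(1) V', symmetric] VV' emb_mult[OF V' V(1), symmetric] V(2))
  have "emb ?V' * emb A * emb V = diagonal n ev"
    unfolding D_eq[symmetric] V(3)[symmetric]
    by (simp only: emb_mult[OF V' A] emb_mult[OF mult_carrier_mat[OF V' A] V(1)])
  from this[symmetric]
  have "emb V * diagonal n ev * emb ?V' = (emb V * emb ?V') * emb A * (emb V * emb ?V')"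
    by (simp only: mult.assoc)
  also have "\<dots> = emb A"
    by (simp only: UU' emb_one_mult[OF supp_in_emb[OF A]] emb_mult_one[OF supp_in_emb[OF A]])
  finally have "emb A = emb V * diagonal n ev * emb ?V'" ..
  moreover have "entry (emb ?V') i j = cnj (entry (emb V) j i)" for i j
    using V(1) by (auto simp: entry_emb)
  ultimately show ?thesis using that[OF U UU'] norm_unitary[OF V(1,2)] by blast
qed

text \<open>In an eigenbasis the diagonal of the state consists of nonnegative weights with sum 1.
  The expectation is therefore an average of eigenvalues, none of which lies below
  \<open>ev 0\<close>.\<close>

lemma ground_energy_le:
  assumes x: "x \<in> carrier_vec n" "vnorm x = 1"
  shows "ground_energy A \<le> Re (tr (emb (ketbra x x) * emb A))"
proof -
  obtain U U' where U: "supp_in n U" "supp_in n U'" "U * U' = u"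
    "emb A = U * diagonal n ev * U'" "\<And>i j. entry U' i j = cnj (entry U j i)"
    by (rule diagonalization) blast
  let ?X = "emb (ketbra x x)"
  have sX: "supp_in n ?X" using x by (intro supp_in_emb) simp
  define Y where "Y = U' * ?X * U"
  have sY: "supp_in n Y" unfolding Y_def by (intro supp_in_times U sX)
  have Y: "entry Y i i = complex_of_real ((cmod (\<Sum>k<n. entry U' i k * x $ k))\<^sup>2)" for i
  proof -
    have "entry Y i i = (\<Sum>l<n. (\<Sum>k<n. entry U' i k * (x $ k * cnj (x $ l))) * entry U l i)"
      unfolding Y_def entry_times[OF supp_in_times[OF U(2) sX]] entry_times[OF U(2)]
      by (intro sum.cong refl) (use x(1) in \<open>simp add: entry_ketbra\<close>)
    also have "\<dots> = (\<Sum>k<n. entry U' i k * x $ k) * cnj (\<Sum>l<n. entry U' i l * x $ l)"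
      by (simp add: U(5) sum_distrib_left sum_distrib_right mult_ac)
    finally show ?thesis by (simp only: complex_norm_square)
  qed
  have trY: "tr Y = 1"
  proof -
    have "tr Y = tr (?X * (U * U'))" unfolding Y_def by (simp only: mult.assoc tr_commute[of U'])
    also have "\<dots> = tr ?X" by (simp only: U(3) emb_mult_one[OF sX])
    finally show ?thesis using tr_ketbra[OF x(1)] by (simp add: x(2))
  qed
  then have sum1: "(\<Sum>i<n. Re (entry Y i i)) = 1" by (simp add: tr_eq[OF sY] flip: Re_sum)
  have "tr (?X * emb A) = tr (Y * diagonal n ev)"
    unfolding U(4) Y_def by (simp only: mult.assoc tr_commute[of U'])
  also have "\<dots> = (\<Sum>i<n. entry Y i i * ev i)"
    by (simp add: tr_eq[OF supp_in_times[OF sY supp_in_diagonal]] entry_mult_diagonal[OF sY])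
  finally have "Re (tr (?X * emb A)) = (\<Sum>i<n. Re (entry Y i i) * ev i)" by simp
  moreover have "(\<Sum>i<n. Re (entry Y i i) * ev 0) \<le> (\<Sum>i<n. Re (entry Y i i) * ev i)"
    by (intro sum_mono mult_left_mono ev_mono) (auto simp: Y)
  moreover have "(\<Sum>i<n. Re (entry Y i i) * ev 0) = ev 0"
    by (simp add: sum1 flip: sum_distrib_right)
  ultimately show ?thesis by (simp add: ground_energy_def)
qed

lemma ground_state_projection:
  assumes "ground_state A x"
  shows "x \<in> carrier_vec n" "vnorm x = 1"
    "emb A * emb (ketbra x x) = ground_energy A *\<^sub>R emb (ketbra x x)"
    "emb (ketbra x x) * emb A = ground_energy A *\<^sub>R emb (ketbra x x)"
proof -
  show x: "x \<in> carrier_vec n" "vnorm x = 1"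
    using assms A by (auto simp: ground_state_def eigenvector_def)
  have ev: "A *\<^sub>v x = complex_of_real (ground_energy A) \<cdot>\<^sub>v x"
    using assms by (auto simp: ground_state_def eigenvector_def)
  show "emb A * emb (ketbra x x) = ground_energy A *\<^sub>R emb (ketbra x x)"
    unfolding emb_mult_ketbra[OF A x(1) x(1)] ev
    by (rule finmat_eqI) (use x(1) in \<open>simp add: entry_ketbra[of _ n] scaleR_conv_of_real\<close>)
  show "emb (ketbra x x) * emb A = ground_energy A *\<^sub>R emb (ketbra x x)"
    unfolding emb_ketbra_mult[OF A herm x(1) x(1)] ev
    by (rule finmat_eqI) (use x(1) in \<open>simp add: entry_ketbra[of _ n] scaleR_conv_of_real\<close>)
qed

text \<open>S is diagonal in an eigenbasis, with the inverse distances to the ground energy as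
  entries. The main work is to show that the projection onto the given vector x is the first
  diagonal unit in the eigenbasis chosen by the diagonalization.\<close>

lemma reduced_resolvent:
  assumes gap: "spectral_gap A > 0" and x: "ground_state A x"
  defines "P \<equiv> emb (ketbra x x)"
  obtains S where "supp_in n S" "S * emb A = u - P + ground_energy A *\<^sub>R S"
    "emb A * S = u - P + ground_energy A *\<^sub>R S" "S * P = 0" "P * S = 0"
    "norm S \<le> n * sqrt n / spectral_gap A"
proof -
  note xs = ground_state_projection[OF x, folded P_def]
  obtain U U' where U: "supp_in n U" "supp_in n U'" "U * U' = u" "U' * U = u"
    "emb A = U * diagonal n ev * U'" "norm U = sqrt n" "norm U' = sqrt n"
    by (rule diagonalization) blast
  have sP: "supp_in n P" unfolding P_def using xs(1) by (intro supp_in_emb) simp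
  have u_left: "u * X = X" and u_right: "X * u = X" if "supp_in n X" for X
    using that by (simp_all add: emb_one_mult emb_mult_one)
  have e0: "ground_energy A = ev 0" by (simp add: ground_energy_def)
  have gap_eq: "spectral_gap A = ev 1 - ev 0" by (simp add: spectral_gap_def)
  have evi: "spectral_gap A \<le> ev i - ev 0" if "i < n" "i \<noteq> 0" for i
    unfolding gap_eq using ev_mono[of 1 i] that by simp
  let ?D = "diagonal n ev"
  \<comment> \<open>Y is P in the eigenbasis; the aim is \<open>Y_eq\<close>.\<close>
  define Y where "Y = U' * P * U"
  have sY: "supp_in n Y" unfolding Y_def by (intro supp_in_times U sP)
  have "?D * Y = U' * (U * ?D * U') * P * U"
    unfolding Y_def using U(1,2) supp_in_diagonal[of n ev]
    by (simp add: mult.assoc) (simp add: U(4) u_left supp_in_times sP flip: mult.assoc)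
  also have "\<dots> = ev 0 *\<^sub>R Y" unfolding Y_def U(5)[symmetric] by (simp add: mult.assoc xs(3)[unfolded e0])
  finally have DY: "?D * Y = ev 0 *\<^sub>R Y" .
  have "Y * ?D = U' * (P * (U * ?D * U')) * U"
    unfolding Y_def using U(1,2) supp_in_diagonal[of n ev]
    by (simp add: mult.assoc U(4) u_right)
  also have "\<dots> = ev 0 *\<^sub>R Y" unfolding Y_def U(5)[symmetric] xs(4) e0 by (simp add: mult.assoc)
  finally have YD: "Y * ?D = ev 0 *\<^sub>R Y" .
  \<comment> \<open>Multiplying Y by the diagonal matrix from either side amounts to multiplying by
    \<open>ev 0\<close>. An entry can survive only where both eigenvalues equal \<open>ev 0\<close>,
    and the positive gap leaves the index 0 alone; the trace then fixes that entry.\<close>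
  have Y0: "entry Y i j = 0" if "i \<noteq> 0 \<or> j \<noteq> 0" for i j
  proof (cases "i < n \<and> j < n")
    case True
    have "ev i * entry Y i j = ev 0 * entry Y i j"
      using arg_cong[OF DY, of "\<lambda>X. entry X i j"] True
      by (simp add: entry_diagonal_mult scaleR_conv_of_real)
    moreover have "entry Y i j * ev j = ev 0 * entry Y i j"
      using arg_cong[OF YD, of "\<lambda>X. entry X i j"] True
      by (simp add: entry_mult_diagonal[OF sY] scaleR_conv_of_real)
    ultimately have "entry Y i j = 0 \<or> (ev i = ev 0 \<and> ev j = ev 0)"
      by (metis mult.commute mult_right_cancel of_real_eq_iff)
    then show ?thesis using evi[of i] evi[of j] gap that True by auto
  next
    case False
    then show ?thesis using supp_inD[OF sY] by blast
  qed
  have "tr Y = 1"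
  proof -
    have "tr Y = tr (P * (U * U'))" unfolding Y_def by (simp only: mult.assoc tr_commute[of U'])
    also have "\<dots> = tr P" by (simp only: U(3) u_right[OF sP])
    finally show ?thesis using tr_ketbra[OF xs(1)] by (simp add: xs(2) P_def)
  qed
  moreover have "tr Y = entry Y 0 0"
  proof -
    have "tr Y = (\<Sum>i<n. if i = 0 then entry Y 0 0 else 0)"
      unfolding tr_eq[OF sY] by (rule sum.cong) (auto simp: Y0)
    then show ?thesis using n by simp
  qed
  ultimately have Y_eq: "Y = diagonal n (\<lambda>i. if i = 0 then 1 else 0)"
    using n by (intro finmat_eqI) (auto simp: entry_diagonal Y0)
  have "U * Y * U' = (U * U') * P * (U * U')" unfolding Y_def by (simp only: mult.assoc)
  then have P_eq: "P = U * diagonal n (\<lambda>i. if i = 0 then 1 else 0) * U'"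
    by (simp add: U(3) u_left[OF sP] u_right[OF sP] Y_eq)
  \<comment> \<open>The value 0 at index 0 makes S vanish on the ground line, so S is the
    pseudoinverse of A minus its ground energy.\<close>
  define r where "r i = (if i = 0 then 0 else 1 / (ev i - ev 0))" for i
  define S where "S = U * diagonal n r * U'"
  have UDU: "(U * diagonal n f * U') * (U * diagonal n g * U') = U * diagonal n (\<lambda>i. f i * g i) * U'" for f g
  proof -
    have "(U * diagonal n f * U') * (U * diagonal n g * U') =
        U * diagonal n f * (U' * U) * (diagonal n g * U')" by (simp only: mult.assoc)
    also have "\<dots> = U * (diagonal n f * diagonal n g) * U'"
      unfolding U(4) by (simp only: mult.assoc u_left[OF supp_in_times[OF supp_in_diagonal U(2)]])
    finally show ?thesis by (simp only: diagonal_mult)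
  qed
  have u_eq: "u = U * diagonal n (\<lambda>i. 1) * U'"
  proof -
    have "diagonal n (\<lambda>i. 1) = u" by (rule finmat_eqI) (simp add: entry_diagonal entry_emb)
    then show ?thesis by (simp add: u_right[OF U(1)] U(3))
  qed
  have lin: "U * diagonal n f * U' - U * diagonal n g * U' + c *\<^sub>R (U * diagonal n h * U') =
      U * diagonal n (\<lambda>i. f i - g i + c * h i) * U'" for f g h c
  proof -
    have "diagonal n (\<lambda>i. f i - g i + c * h i) = diagonal n f - diagonal n g + c *\<^sub>R diagonal n h"
      by (rule finmat_eqI) (simp add: entry_diagonal scaleR_conv_of_real)
    then show ?thesis
      by (simp only: distrib_left distrib_right left_diff_distrib right_diff_distrib mult_scaleR_left mult_scaleR_right)
  qed
  have diag_cong: "diagonal n f = diagonal n g" if "\<And>i. i < n \<Longrightarrow> f i = g i" for f g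
    by (rule finmat_eqI) (simp add: entry_diagonal that)
  have ne: "ev i - ev 0 \<noteq> 0" if "i < n" "i \<noteq> 0" for i using evi[OF that] gap by simp
  show ?thesis
  proof (rule that)
    show "supp_in n S" unfolding S_def by (intro supp_in_times U supp_in_diagonal)
    show "S * emb A = u - P + ground_energy A *\<^sub>R S"
      unfolding S_def u_eq P_eq U(5) UDU lin e0
      by (intro arg_cong[where f = "\<lambda>D. U * D * U'"] diag_cong) (auto simp: r_def field_simps dest: ne)
    show "emb A * S = u - P + ground_energy A *\<^sub>R S"
      unfolding S_def u_eq P_eq U(5) UDU lin e0
      by (intro arg_cong[where f = "\<lambda>D. U * D * U'"] diag_cong) (auto simp: r_def field_simps dest: ne)
    have zero: "diagonal n f = 0" if "\<And>i. f i = 0" for f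
      by (rule finmat_eqI) (simp add: entry_diagonal that)
    show "S * P = 0" unfolding S_def P_eq UDU by (subst zero) (auto simp: r_def)
    show "P * S = 0" unfolding S_def P_eq UDU by (subst zero) (auto simp: r_def)
    \<comment> \<open>The factor \<open>n * sqrt n\<close> consists of three factors
      \<open>sqrt n\<close>, one each from U, from the diagonal matrix and from U'.\<close>
    have "norm (diagonal n r) \<le> sqrt n * (1 / spectral_gap A)"
      using gap evi by (intro norm_diagonal_le) (auto simp: r_def intro!: divide_left_mono mult_pos_pos, (smt (verit) evi gap)+)
    then have "norm U * norm (diagonal n r) * norm U' \<le> sqrt n * (sqrt n * (1 / spectral_gap A)) * sqrt n"
      unfolding U(6,7) by (intro mult_right_mono mult_left_mono) auto
    moreover have "norm S \<le> norm U * norm (diagonal n r) * norm U'"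
      unfolding S_def by (intro order_trans[OF norm_mult_ineq] mult_right_mono norm_mult_ineq) auto
    ultimately show "norm S \<le> n * sqrt n / spectral_gap A" by (simp add: field_simps)
  qed
qed

end

section \<open>The adiabatic identity\<close>

text \<open>The identities between two times produce difference quotients, so derivatives, one-sided
  ones included, are obtained as limits of quotients.\<close>

lemma has_vector_derivative_within_iff:
  fixes f :: "real \<Rightarrow> 'a::real_normed_vector"
  shows "(f has_vector_derivative D) (at t within T) \<longleftrightarrow>
    ((\<lambda>s. (f s - f t) /\<^sub>R (s - t)) \<longlongrightarrow> D) (at t within T)"
proof -
  have "(f has_vector_derivative D) (at t within T) \<longleftrightarrow>
      ((\<lambda>s. norm (f s - f t - (s - t) *\<^sub>R D) / norm (s - t)) \<longlongrightarrow> 0) (at t within T)"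
    unfolding has_vector_derivative_def has_derivative_iff_norm
    by (simp add: bounded_linear_scaleR_left)
  also have "\<dots> \<longleftrightarrow> ((\<lambda>s. norm ((f s - f t) /\<^sub>R (s - t) - D)) \<longlongrightarrow> 0) (at t within T)"
  proof (rule filterlim_cong[OF refl refl])
    show "\<forall>\<^sub>F s in at t within T. norm (f s - f t - (s - t) *\<^sub>R D) / norm (s - t) =
        norm ((f s - f t) /\<^sub>R (s - t) - D)"
      unfolding eventually_at_filter
    proof (rule always_eventually, intro allI impI)
      fix s assume "s \<noteq> t"
      then have "(f s - f t) /\<^sub>R (s - t) - D = (f s - f t - (s - t) *\<^sub>R D) /\<^sub>R (s - t)"
        by (simp add: scaleR_diff_right)
      then show "norm (f s - f t - (s - t) *\<^sub>R D) / norm (s - t) = norm ((f s - f t) /\<^sub>R (s - t) - D)"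
        by (simp add: divide_inverse mult.commute)
    qed
  qed
  also have "\<dots> \<longleftrightarrow> ((\<lambda>s. (f s - f t) /\<^sub>R (s - t)) \<longlongrightarrow> D) (at t within T)"
    unfolding tendsto_norm_zero_iff by (rule LIM_zero_iff)
  finally show ?thesis .
qed

text \<open>In the application \<open>u\<close> is the identity on the state space (a finite block of the infinite
  matrices), \<open>J\<close> is \<open>\<i> u\<close>, \<open>\<tau>\<close> the real part of the trace, \<open>P\<close> the ground projection, \<open>S\<close> the
  reduced resolvent and \<open>\<rho>\<close> the density matrix of the evolved state.\<close>

locale adiabatic =
  fixes \<tau> :: "'a::real_normed_algebra \<Rightarrow> real"
    and u J :: 'a and T :: "real set"
    and H H1 H2 P S \<rho> :: "real \<Rightarrow> 'a" and E s :: "real \<Rightarrow> real"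
  assumes bounded_linear_trace: "bounded_linear \<tau>"
    and trace_commute: "u * X = X \<Longrightarrow> X * u = X \<Longrightarrow> \<tau> (X * Y) = \<tau> (Y * X)"
    and trace_le: "u * X = X \<Longrightarrow> \<bar>\<tau> (X * Y)\<bar> \<le> norm X * norm Y"
    and JJ: "J * J = - u"
    and J_commute: "t \<in> T \<Longrightarrow> J * H t = H t * J" "t \<in> T \<Longrightarrow> J * \<rho> t = \<rho> t * J"
    and unit: "t \<in> T \<Longrightarrow> u * H t = H t" "t \<in> T \<Longrightarrow> H t * u = H t"
      "t \<in> T \<Longrightarrow> u * P t = P t" "t \<in> T \<Longrightarrow> P t * u = P t"
      "t \<in> T \<Longrightarrow> u * S t = S t" "t \<in> T \<Longrightarrow> S t * u = S t" "t \<in> T \<Longrightarrow> u * \<rho> t = \<rho> t"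
    and HP: "t \<in> T \<Longrightarrow> H t * P t = E t *\<^sub>R P t" and PH: "t \<in> T \<Longrightarrow> P t * H t = E t *\<^sub>R P t"
    and SH: "t \<in> T \<Longrightarrow> S t * H t = u - P t + E t *\<^sub>R S t"
    and HS: "t \<in> T \<Longrightarrow> H t * S t = u - P t + E t *\<^sub>R S t"
    and SP: "t \<in> T \<Longrightarrow> S t * P t = 0" and PS: "t \<in> T \<Longrightarrow> P t * S t = 0"
    and trace_P: "t \<in> T \<Longrightarrow> \<tau> (P t) = 1" and norm_P: "t \<in> T \<Longrightarrow> norm (P t) \<le> 1"
    and E_le: "t \<in> T \<Longrightarrow> t' \<in> T \<Longrightarrow> E t \<le> \<tau> (P t' * H t)"
    and norm_\<rho>: "t \<in> T \<Longrightarrow> norm (\<rho> t) \<le> 1"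
    and norm_S: "t \<in> T \<Longrightarrow> norm (S t) \<le> s t" and s_cont: "continuous_on T s"
    and H_deriv: "t \<in> T \<Longrightarrow> (H has_vector_derivative H1 t) (at t within T)"
    and H1_deriv: "t \<in> T \<Longrightarrow> (H1 has_vector_derivative H2 t) (at t within T)"
    and \<rho>_deriv: "t \<in> T \<Longrightarrow>
      (\<rho> has_vector_derivative - (J * (H t * \<rho> t - \<rho> t * H t))) (at t within T)"
begin

section \<open>Differentiability of energy, projection and resolvent\<close>

interpretation \<tau>: bounded_linear \<tau> by (fact bounded_linear_trace)

abbreviation "E1 t \<equiv> \<tau> (P t * H1 t)"

text \<open>The ground projection at time t serves as a trial state for the Hamiltonian at time
  t'.\<close>

lemma E_diff_le:
  assumes "t \<in> T" "t' \<in> T"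
  shows "E t' - E t \<le> \<tau> (P t * (H t' - H t))"
proof -
  have "\<tau> (P t * H t) = E t" using assms by (simp add: PH \<tau>.scaleR trace_P)
  then show ?thesis using E_le[OF assms(2,1)] by (simp add: algebra_simps \<tau>.diff)
qed

lemma abs_trace_P_le: "t \<in> T \<Longrightarrow> \<bar>\<tau> (P t * X)\<bar> \<le> norm X"
  using trace_le[of "P t" X] unit(3)[of t] norm_P[of t] mult_right_mono[of "norm (P t)" 1 "norm X"] by simp

lemma abs_E_diff_le:
  assumes "t \<in> T" "t' \<in> T"
  shows "\<bar>E t' - E t\<bar> \<le> norm (H t' - H t)"
proof -
  have "E t' - E t \<le> norm (H t' - H t)"
    using E_diff_le[OF assms] abs_trace_P_le[OF assms(1), of "H t' - H t"] by simp
  moreover have "E t - E t' \<le> norm (H t - H t')"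
    using E_diff_le[OF assms(2,1)] abs_trace_P_le[OF assms(2), of "H t - H t'"] by simp
  ultimately show ?thesis by (simp add: norm_minus_commute)
qed

text \<open>The increment of H - E u, the operator which P annihilates and which S inverts on the
  complement of the ground line.\<close>

definition \<Delta>G :: "real \<Rightarrow> real \<Rightarrow> 'a" where
  "\<Delta>G t t' = (H t' - H t) - (E t' - E t) *\<^sub>R u"

text \<open>The analogue of the second resolvent identity: on each side of
  \<open>\<Delta>G t t'\<close> one of the two operators H - E u is absorbed by P, giving 0, or by
  S, giving u - P. It is exact and presupposes no regularity of P or S.\<close>

lemma P_diff:
  assumes "t \<in> T" "t' \<in> T"
  shows "P t' - P t = - (P t' * \<Delta>G t t' * S t) - S t' * \<Delta>G t t' * P t"
proof -
  have "P t' * \<Delta>G t t' * S t = P t' * H t' * S t - P t' * (H t * S t) - (E t' - E t) *\<^sub>R (P t' * u * S t)"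
    by (simp add: \<Delta>G_def algebra_simps)
  also have "\<dots> = P t' * P t - P t'"
    using assms by (simp add: PH HS unit algebra_simps)
  finally have 1: "P t' * \<Delta>G t t' * S t = P t' * P t - P t'" .
  have "S t' * \<Delta>G t t' * P t = S t' * H t' * P t - S t' * (H t * P t) - (E t' - E t) *\<^sub>R (S t' * u * P t)"
    by (simp add: \<Delta>G_def algebra_simps)
  also have "\<dots> = P t - P t' * P t"
    using assms by (simp add: SH HP unit algebra_simps)
  finally show ?thesis using 1 by simp
qed

text \<open>Sandwiching the increment between two reduced resolvents gives \<open>S t - S t'\<close>
  and two cross terms, \<open>S t' * P t\<close> and \<open>P t' * S t\<close>, because u - P
  replaces a true inverse. The first two summands on the right are exactly these cross
  terms.\<close>

lemma S_diff:
  assumes "t \<in> T" "t' \<in> T"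
  shows "S t' - S t = S t' * S t' * \<Delta>G t t' * P t + P t' * \<Delta>G t t' * S t * S t - S t' * \<Delta>G t t' * S t"
proof -
  have "S t' * \<Delta>G t t' * S t = S t' * H t' * S t - S t' * (H t * S t) - (E t' - E t) *\<^sub>R (S t' * u * S t)"
    by (simp add: \<Delta>G_def algebra_simps)
  also have "\<dots> = S t - P t' * S t - S t' + S t' * P t"
    using assms by (simp add: SH HS unit algebra_simps)
  finally have 1: "S t' * \<Delta>G t t' * S t = S t - P t' * S t - S t' + S t' * P t" .
  have "S t' * S t' * \<Delta>G t t' * P t = S t' * (S t' * H t') * P t - S t' * S t' * (H t * P t) -
      (E t' - E t) *\<^sub>R (S t' * (S t' * u) * P t)"
    by (simp add: \<Delta>G_def algebra_simps)
  also have "\<dots> = S t' * P t"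
    using assms by (simp add: SH SP HP unit algebra_simps)
  finally have 2: "S t' * S t' * \<Delta>G t t' * P t = S t' * P t" .
  have "P t' * \<Delta>G t t' * S t * S t = P t' * H t' * S t * S t - P t' * (H t * S t) * S t -
      (E t' - E t) *\<^sub>R (P t' * u * S t * S t)"
    by (simp add: \<Delta>G_def algebra_simps)
  also have "\<dots> = - (P t' * S t)"
    using assms by (simp add: PH HS PS unit algebra_simps)
  finally show ?thesis using 1 2 by simp
qed

lemma H_tendsto: "t \<in> T \<Longrightarrow> (H \<longlongrightarrow> H t) (at t within T)"
  using has_vector_derivative_continuous[OF H_deriv] by (simp add: continuous_within)

lemma \<Delta>G_tendsto: assumes "t \<in> T" shows "(\<Delta>G t \<longlongrightarrow> 0) (at t within T)"
proof -
  have H: "((\<lambda>t'. H t' - H t) \<longlongrightarrow> 0) (at t within T)"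
    using H_tendsto[OF assms] by (simp add: LIM_zero)
  have "((\<lambda>t'. E t' - E t) \<longlongrightarrow> 0) (at t within T)"
    by (rule tendsto_0_le[OF H, of _ 1])
      (use abs_E_diff_le[OF assms] in \<open>auto simp: eventually_at_filter\<close>)
  then have "((\<lambda>t'. (H t' - H t) - (E t' - E t) *\<^sub>R u) \<longlongrightarrow> 0 - 0 *\<^sub>R u) (at t within T)"
    by (intro tendsto_intros H)
  then show ?thesis by (simp add: \<Delta>G_def[abs_def])
qed

text \<open>Continuity of S is not known yet; the continuous bound s supplies the local boundedness
  with which \<open>P_diff\<close> and \<open>S_diff\<close> yield continuity.\<close>

lemma eventually_S_le:
  assumes "t \<in> T" shows "\<forall>\<^sub>F t' in at t within T. norm (S t') \<le> s t + 1"
proof -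
  have "(s \<longlongrightarrow> s t) (at t within T)" using s_cont assms by (simp add: continuous_on_def)
  then have "\<forall>\<^sub>F t' in at t within T. s t' < s t + 1" by (rule order_tendstoD) simp
  moreover have "\<forall>\<^sub>F t' in at t within T. t' \<in> T" by (simp add: eventually_at_filter)
  ultimately show ?thesis
    by eventually_elim (use norm_S in force)
qed

lemma P_tendsto: assumes "t \<in> T" shows "(P \<longlongrightarrow> P t) (at t within T)"
proof -
  have "((\<lambda>t'. P t' - P t) \<longlongrightarrow> 0) (at t within T)"
  proof (rule tendsto_0_le[OF \<Delta>G_tendsto[OF assms], of _ "s t + (s t + 1)"])
    have "\<forall>\<^sub>F t' in at t within T. t' \<in> T" by (simp add: eventually_at_filter)
    then show "\<forall>\<^sub>F t' in at t within T. norm (P t' - P t) \<le> norm (\<Delta>G t t') * (s t + (s t + 1))"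
      using eventually_S_le[OF assms]
    proof eventually_elim
      fix t' assume t': "t' \<in> T" "norm (S t') \<le> s t + 1"
      have "norm (P t' * \<Delta>G t t' * S t) \<le> 1 * norm (\<Delta>G t t') * s t"
        using norm_P[OF t'(1)] norm_S[OF assms]
        by (intro order_trans[OF norm_mult_ineq] mult_mono) auto
      moreover have "norm (S t' * \<Delta>G t t' * P t) \<le> (s t + 1) * norm (\<Delta>G t t') * 1"
        using norm_P[OF assms] t' order_trans[OF norm_ge_zero t'(2)]
        by (intro order_trans[OF norm_mult_ineq] mult_mono) auto
      ultimately show "norm (P t' - P t) \<le> norm (\<Delta>G t t') * (s t + (s t + 1))"
        unfolding P_diff[OF assms t'(1)]
        using norm_triangle_ineq4[of "- (P t' * \<Delta>G t t' * S t)" "S t' * \<Delta>G t t' * P t"]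
        by (simp add: algebra_simps)
    qed
  qed
  then show ?thesis by (rule LIM_zero_cancel)
qed

lemma S_tendsto: assumes "t \<in> T" shows "(S \<longlongrightarrow> S t) (at t within T)"
proof -
  define m where "m = s t + 1"
  have "((\<lambda>t'. S t' - S t) \<longlongrightarrow> 0) (at t within T)"
  proof (rule tendsto_0_le[OF \<Delta>G_tendsto[OF assms], of _ "3 * m\<^sup>2"])
    have "\<forall>\<^sub>F t' in at t within T. t' \<in> T" by (simp add: eventually_at_filter)
    then show "\<forall>\<^sub>F t' in at t within T. norm (S t' - S t) \<le> norm (\<Delta>G t t') * (3 * m\<^sup>2)"
      using eventually_S_le[OF assms]
    proof eventually_elim
      fix t' assume t': "t' \<in> T" "norm (S t') \<le> s t + 1"
      have m: "norm (S t') \<le> m" "norm (S t) \<le> m" "0 \<le> m"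
        using t' norm_S[OF assms] norm_ge_zero[of "S t'"] unfolding m_def by linarith+
      have "norm (S t' * S t' * \<Delta>G t t' * P t) \<le> m * m * norm (\<Delta>G t t') * 1"
        using norm_P[OF assms] m by (intro order_trans[OF norm_mult_ineq] mult_mono) auto
      moreover have "norm (P t' * \<Delta>G t t' * S t * S t) \<le> 1 * norm (\<Delta>G t t') * m * m"
        using norm_P[OF t'(1)] m by (intro order_trans[OF norm_mult_ineq] mult_mono) auto
      moreover have "norm (S t' * \<Delta>G t t' * S t) \<le> m * norm (\<Delta>G t t') * m"
        using m by (intro order_trans[OF norm_mult_ineq] mult_mono) auto
      ultimately show "norm (S t' - S t) \<le> norm (\<Delta>G t t') * (3 * m\<^sup>2)"
        unfolding S_diff[OF assms t'(1)]
        using norm_triangle_ineq4[of "S t' * S t' * \<Delta>G t t' * P t + P t' * \<Delta>G t t' * S t * S t"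
            "S t' * \<Delta>G t t' * S t"]
          norm_triangle_ineq[of "S t' * S t' * \<Delta>G t t' * P t" "P t' * \<Delta>G t t' * S t * S t"]
        by (simp add: algebra_simps power2_eq_square)
    qed
  qed
  then show ?thesis by (rule LIM_zero_cancel)
qed

text \<open>The Hellmann-Feynman formula. The variational principle in both directions places
  \<open>E t' - E t\<close> between \<open>\<tau> (P t' * (H t' - H t))\<close> and
  \<open>\<tau> (P t * (H t' - H t))\<close>. The two bounds differ by a term with
  \<open>P t' - P t\<close>, whose quotient tends to 0 by continuity of P alone.\<close>

lemma E_deriv:
  assumes "t \<in> T" shows "(E has_vector_derivative E1 t) (at t within T)"
proof -
  let ?q = "\<lambda>t'. (H t' - H t) /\<^sub>R (t' - t)"
  have q: "(?q \<longlongrightarrow> H1 t) (at t within T)"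
    using H_deriv[OF assms] by (simp add: has_vector_derivative_within_iff)
  have "((\<lambda>t'. \<tau> ((P t' - P t) * ?q t')) \<longlongrightarrow> \<tau> ((P t - P t) * H1 t)) (at t within T)"
    by (intro \<tau>.tendsto tendsto_intros P_tendsto q assms)
  then have 0: "((\<lambda>t'. \<tau> ((P t' - P t) * ?q t')) \<longlongrightarrow> 0) (at t within T)"
    by (simp add: \<tau>.zero)
  have "((\<lambda>t'. (E t' - E t) /\<^sub>R (t' - t) - \<tau> (P t * ?q t')) \<longlongrightarrow> 0) (at t within T)"
  proof (rule tendsto_0_le[OF 0, of _ 1])
    have "\<forall>\<^sub>F t' in at t within T. t' \<in> T \<and> t' \<noteq> t" by (simp add: eventually_at_filter)
    then show "\<forall>\<^sub>F t' in at t within T. norm ((E t' - E t) /\<^sub>R (t' - t) - \<tau> (P t * ?q t'))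
        \<le> norm (\<tau> ((P t' - P t) * ?q t')) * 1"
    proof eventually_elim
      fix t' assume t': "t' \<in> T \<and> t' \<noteq> t"
      have "\<bar>(E t' - E t) - \<tau> (P t * (H t' - H t))\<bar> \<le> \<bar>\<tau> ((P t' - P t) * (H t' - H t))\<bar>"
      proof -
        have "\<tau> (P t' * (H t' - H t)) \<le> E t' - E t"
          using E_diff_le[OF conjunct1[OF t'] assms] by (simp add: right_diff_distrib \<tau>.diff)
        moreover have "E t' - E t \<le> \<tau> (P t * (H t' - H t))"
          using E_diff_le[OF assms conjunct1[OF t']] .
        ultimately show ?thesis by (simp add: left_diff_distrib \<tau>.diff)
      qed
      then have "\<bar>inverse (t' - t)\<bar> * \<bar>(E t' - E t) - \<tau> (P t * (H t' - H t))\<bar>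
          \<le> \<bar>inverse (t' - t)\<bar> * \<bar>\<tau> ((P t' - P t) * (H t' - H t))\<bar>"
        by (rule mult_left_mono) simp
      then show "norm ((E t' - E t) /\<^sub>R (t' - t) - \<tau> (P t * ?q t'))
          \<le> norm (\<tau> ((P t' - P t) * ?q t')) * 1"
        by (simp add: \<tau>.scaleR abs_mult[symmetric] right_diff_distrib del: abs_inverse)
    qed
  qed
  moreover have "((\<lambda>t'. \<tau> (P t * ?q t')) \<longlongrightarrow> E1 t) (at t within T)"
    by (intro \<tau>.tendsto tendsto_intros q)
  ultimately have "((\<lambda>t'. ((E t' - E t) /\<^sub>R (t' - t) - \<tau> (P t * ?q t')) + \<tau> (P t * ?q t')) \<longlongrightarrow> 0 + E1 t)
      (at t within T)" by (rule tendsto_add)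
  then show ?thesis by (simp add: has_vector_derivative_within_iff)
qed

lemma \<Delta>G_quotient:
  assumes "t \<in> T"
  shows "((\<lambda>t'. \<Delta>G t t' /\<^sub>R (t' - t)) \<longlongrightarrow> H1 t - E1 t *\<^sub>R u) (at t within T)"
proof -
  have "((\<lambda>t'. (H t' - H t) /\<^sub>R (t' - t) - ((E t' - E t) /\<^sub>R (t' - t)) *\<^sub>R u) \<longlongrightarrow> H1 t - E1 t *\<^sub>R u)
      (at t within T)"
    using H_deriv[OF assms] E_deriv[OF assms]
    by (intro tendsto_intros) (simp_all add: has_vector_derivative_within_iff)
  then show ?thesis by (simp add: \<Delta>G_def scaleR_diff_right)
qed

definition P1 :: "real \<Rightarrow> 'a" where
  "P1 t = - (P t * H1 t * S t) - S t * H1 t * P t"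

lemma P_deriv:
  assumes "t \<in> T" shows "(P has_vector_derivative P1 t) (at t within T)"
proof -
  have *: "((\<lambda>t'. - (P t' * (\<Delta>G t t' /\<^sub>R (t' - t)) * S t) - S t' * (\<Delta>G t t' /\<^sub>R (t' - t)) * P t)
      \<longlongrightarrow> - (P t * (H1 t - E1 t *\<^sub>R u) * S t) - S t * (H1 t - E1 t *\<^sub>R u) * P t) (at t within T)"
    by (intro tendsto_intros P_tendsto S_tendsto \<Delta>G_quotient assms)
  \<comment> \<open>The energy derivative drops out, since \<open>P t * u * S t\<close> and
    \<open>S t * u * P t\<close> vanish.\<close>
  have "- (P t * (H1 t - E1 t *\<^sub>R u) * S t) - S t * (H1 t - E1 t *\<^sub>R u) * P t = P1 t"
    using assms by (simp add: P1_def algebra_simps) (simp add: unit PS SP flip: mult.assoc)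
  moreover have "(P t' - P t) /\<^sub>R (t' - t) =
      - (P t' * (\<Delta>G t t' /\<^sub>R (t' - t)) * S t) - S t' * (\<Delta>G t t' /\<^sub>R (t' - t)) * P t"
    if "t' \<in> T" for t'
    by (simp add: P_diff[OF assms that] scaleR_diff_right)
  ultimately show ?thesis
    unfolding has_vector_derivative_within_iff
    by (intro Lim_transform_eventually[OF *[unfolded \<open>_ = P1 t\<close>]])
      (simp add: eventually_at_filter)
qed

definition S1 :: "real \<Rightarrow> 'a" where
  "S1 t = S t * S t * H1 t * P t + P t * H1 t * S t * S t - S t * (H1 t - E1 t *\<^sub>R u) * S t"

lemma S_deriv:
  assumes "t \<in> T" shows "(S has_vector_derivative S1 t) (at t within T)"
proof -
  let ?q = "\<lambda>t'. \<Delta>G t t' /\<^sub>R (t' - t)" and ?g = "H1 t - E1 t *\<^sub>R u"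
  have *: "((\<lambda>t'. S t' * S t' * ?q t' * P t + P t' * ?q t' * S t * S t - S t' * ?q t' * S t)
      \<longlongrightarrow> S t * S t * ?g * P t + P t * ?g * S t * S t - S t * ?g * S t) (at t within T)"
    by (intro tendsto_intros P_tendsto S_tendsto \<Delta>G_quotient assms)
  \<comment> \<open>The energy derivative survives only between two resolvents, in the last term of
    \<open>S1\<close>.\<close>
  have "S t * S t * u * P t = 0" "P t * u * S t * S t = 0"
    using assms by (simp_all add: unit SP PS mult.assoc)
  then have "S t * S t * ?g * P t + P t * ?g * S t * S t - S t * ?g * S t = S1 t"
    by (simp add: S1_def algebra_simps)
  moreover have "(S t' - S t) /\<^sub>R (t' - t) =
      S t' * S t' * ?q t' * P t + P t' * ?q t' * S t * S t - S t' * ?q t' * S t"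
    if "t' \<in> T" for t'
    by (simp add: S_diff[OF assms that] scaleR_diff_right scaleR_add_right)
  ultimately show ?thesis
    unfolding has_vector_derivative_within_iff
    by (intro Lim_transform_eventually[OF *[unfolded \<open>_ = S1 t\<close>]])
      (simp add: eventually_at_filter)
qed

section \<open>Norm estimates and the corrected overlap\<close>

lemma norm_mult_mono:
  fixes X Y :: 'a
  shows "norm X \<le> x \<Longrightarrow> norm Y \<le> y \<Longrightarrow> norm (X * Y) \<le> x * y"
  by (rule order_trans[OF norm_mult_ineq mult_mono]) (auto intro: order_trans[OF norm_ge_zero])

lemma norm_P1_le: "t \<in> T \<Longrightarrow> norm (P1 t) \<le> 2 * (s t * norm (H1 t))"
proof -
  assume t: "t \<in> T"
  have "norm (P t * H1 t * S t) \<le> 1 * norm (H1 t) * s t"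
    "norm (S t * H1 t * P t) \<le> s t * norm (H1 t) * 1"
    by (intro norm_mult_mono norm_P[OF t] norm_S[OF t] order_refl)+
  then show ?thesis
    unfolding P1_def using norm_triangle_ineq4[of "- (P t * H1 t * S t)" "S t * H1 t * P t"]
    by (simp add: mult.commute)
qed

lemma norm_S1_le: "t \<in> T \<Longrightarrow> norm (S1 t) \<le> 4 * ((s t)\<^sup>2 * norm (H1 t))"
proof -
  assume t: "t \<in> T"
  have "norm (S t * S t * H1 t * P t) \<le> s t * s t * norm (H1 t) * 1"
    "norm (P t * H1 t * S t * S t) \<le> 1 * norm (H1 t) * s t * s t"
    "norm (S t * H1 t * S t) \<le> s t * norm (H1 t) * s t"
    by (intro norm_mult_mono norm_P[OF t] norm_S[OF t] order_refl)+
  moreover have "norm (E1 t *\<^sub>R (S t * S t)) \<le> norm (H1 t) * (s t * s t)"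
    unfolding norm_scaleR using t
    by (intro mult_mono abs_trace_P_le norm_mult_mono norm_S) auto
  moreover have "S1 t = S t * S t * H1 t * P t + P t * H1 t * S t * S t - S t * H1 t * S t + E1 t *\<^sub>R (S t * S t)"
    using t by (simp add: S1_def algebra_simps unit)
  moreover have "norm (A + B - C + D) \<le> norm A + norm B + norm C + norm D" for A B C D :: 'a
    using norm_triangle_ineq[of "A + B - C" D] norm_triangle_ineq4[of "A + B" C] norm_triangle_ineq[of A B]
    by linarith
  ultimately show ?thesis
    by (smt (verit) mult.commute mult.left_commute mult_1 power2_eq_square)
qed

definition Z :: "real \<Rightarrow> 'a" where
  "Z t = S t * S t * H1 t * P t - P t * H1 t * S t * S t"

definition Z1 :: "real \<Rightarrow> 'a" where
  "Z1 t = (S1 t * S t * H1 t * P t + S t * S1 t * H1 t * P t + S t * S t * H2 t * P t + S t * S t * H1 t * P1 t)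
     - (P1 t * H1 t * S t * S t + P t * H2 t * S t * S t + P t * H1 t * S1 t * S t + P t * H1 t * S t * S1 t)"

lemma Z_deriv: "t \<in> T \<Longrightarrow> (Z has_vector_derivative Z1 t) (at t within T)"
  unfolding Z_def Z1_def
  by (rule has_vector_derivative_eq_rhs, (rule derivative_intros S_deriv P_deriv H1_deriv; assumption?)+)
    (simp add: algebra_simps)

lemma norm_Z_le: "t \<in> T \<Longrightarrow> norm (Z t) \<le> 2 * ((s t)\<^sup>2 * norm (H1 t))"
proof -
  assume t: "t \<in> T"
  have "norm (S t * S t * H1 t * P t) \<le> s t * s t * norm (H1 t) * 1"
    "norm (P t * H1 t * S t * S t) \<le> 1 * norm (H1 t) * s t * s t"
    by (intro norm_mult_mono norm_P[OF t] norm_S[OF t] order_refl)+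
  then show ?thesis
    unfolding Z_def using norm_triangle_ineq4[of "S t * S t * H1 t * P t" "P t * H1 t * S t * S t"]
    by (simp add: power2_eq_square mult_ac)
qed

text \<open>Of the eight terms of the product rule, four contain \<open>S1\<close> with its factor
  4, two contain \<open>P1\<close> with its factor 2, and two contain \<open>H2\<close>: hence 16 +
  4 = 20 and 2.\<close>

lemma norm_Z1_le:
  "t \<in> T \<Longrightarrow> norm (Z1 t) \<le> 20 * ((s t)^3 * (norm (H1 t))\<^sup>2) + 2 * ((s t)\<^sup>2 * norm (H2 t))"
proof -
  assume t: "t \<in> T"
  let ?x = "s t" and ?h = "norm (H1 t)" and ?k = "norm (H2 t)"
  let ?p = "2 * (s t * norm (H1 t))" and ?q = "4 * ((s t)\<^sup>2 * norm (H1 t))"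
  have "norm (S1 t * S t * H1 t * P t) \<le> ?q * ?x * ?h * 1"
    "norm (S t * S1 t * H1 t * P t) \<le> ?x * ?q * ?h * 1"
    "norm (S t * S t * H2 t * P t) \<le> ?x * ?x * ?k * 1"
    "norm (S t * S t * H1 t * P1 t) \<le> ?x * ?x * ?h * ?p"
    "norm (P1 t * H1 t * S t * S t) \<le> ?p * ?h * ?x * ?x"
    "norm (P t * H2 t * S t * S t) \<le> 1 * ?k * ?x * ?x"
    "norm (P t * H1 t * S1 t * S t) \<le> 1 * ?h * ?q * ?x"
    "norm (P t * H1 t * S t * S1 t) \<le> 1 * ?h * ?x * ?q"
    by (intro norm_mult_mono norm_P[OF t] norm_S[OF t] norm_S1_le[OF t] norm_P1_le[OF t] order_refl)+
  note b = this
  have tri: "norm (A + B + C + D) \<le> norm A + norm B + norm C + norm D" for A B C D :: 'a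
    using norm_triangle_ineq[of "A + B + C" D] norm_triangle_ineq[of "A + B" C] norm_triangle_ineq[of A B]
    by linarith
  have "norm (Z1 t) \<le> (?q * ?x * ?h * 1 + ?x * ?q * ?h * 1 + ?x * ?x * ?k * 1 + ?x * ?x * ?h * ?p)
      + (?p * ?h * ?x * ?x + 1 * ?k * ?x * ?x + 1 * ?h * ?q * ?x + 1 * ?h * ?x * ?q)"
    unfolding Z1_def using b
    by (intro order_trans[OF norm_triangle_ineq4] add_mono order_trans[OF tri])
  also have "\<dots> = 20 * (?x^3 * ?h\<^sup>2) + 2 * (?x\<^sup>2 * ?k)"
    by (simp add: power2_eq_square power3_eq_cube algebra_simps)
  finally show ?thesis .
qed

text \<open>One of the two resolvents in each term of Z is consumed by H, up to a multiple of E;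
  these multiples of E occur in both products and cancel.\<close>

lemma commutator_Z:
  assumes "t \<in> T" shows "H t * Z t - Z t * H t = - P1 t"
proof -
  have 1: "(H t * S t) * S t = S t + E t *\<^sub>R (S t * S t)"
    "S t * (S t * H t) = S t + E t *\<^sub>R (S t * S t)"
    using assms by (simp_all add: HS SH PS SP unit algebra_simps)
  have "H t * Z t = (H t * S t) * S t * H1 t * P t - (H t * P t) * H1 t * S t * S t"
    by (simp add: Z_def algebra_simps)
  also have "\<dots> = (S t + E t *\<^sub>R (S t * S t)) * H1 t * P t - (E t *\<^sub>R P t) * H1 t * S t * S t"
    using assms by (simp only: 1 HP)
  finally have 2: "H t * Z t = \<dots>" .
  have "Z t * H t = S t * S t * H1 t * (P t * H t) - P t * H1 t * (S t * (S t * H t))"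
    by (simp add: Z_def algebra_simps)
  also have "\<dots> = S t * S t * H1 t * (E t *\<^sub>R P t) - P t * H1 t * (S t + E t *\<^sub>R (S t * S t))"
    using assms by (simp only: 1 PH)
  finally show ?thesis by (simp add: 2 P1_def algebra_simps)
qed

definition F :: "real \<Rightarrow> real" where
  "F t = \<tau> (\<rho> t * P t) - \<tau> (\<rho> t * (J * Z t))"

lemma F_deriv:
  assumes "t \<in> T"
  shows "(F has_real_derivative - \<tau> (\<rho> t * (J * Z1 t))) (at t within T)"
proof -
  let ?r = "- (J * (H t * \<rho> t - \<rho> t * H t))"
  have "(F has_vector_derivative \<tau> (\<rho> t * P1 t + ?r * P t) -
      \<tau> (\<rho> t * (J * Z1 t) + ?r * (J * Z t))) (at t within T)"
    unfolding F_def using P_deriv[OF assms] Z_deriv[OF assms] \<rho>_deriv[OF assms]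
    by (intro has_vector_derivative_diff \<tau>.has_vector_derivative has_vector_derivative_mult
        has_vector_derivative_mult_right)
  \<comment> \<open>P commutes with H, so the trace of the commutator of H and \<rho> against P
    vanishes by cyclicity.\<close>
  moreover have "\<tau> (?r * P t) = 0"
  proof -
    have "\<tau> (J * H t * \<rho> t * P t) = \<tau> (H t * (J * \<rho> t * P t))"
      using assms by (simp add: J_commute mult.assoc)
    also have "\<dots> = \<tau> (J * \<rho> t * (P t * H t))"
      by (subst trace_commute) (use assms in \<open>simp_all add: mult.assoc unit\<close>)
    also have "\<dots> = \<tau> (J * \<rho> t * (H t * P t))" using assms by (simp add: PH HP)
    finally show ?thesis by (simp add: algebra_simps \<tau>.neg \<tau>.diff)
  qed
  \<comment> \<open>The two imaginary units cancel through \<open>J * J = - u\<close>, and cyclicity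
    moves the commutator with H from \<rho> onto Z, where \<open>commutator_Z\<close> applies. The
    result removes the term with \<open>P1\<close>, so only \<open>Z1\<close> is left in the
    derivative of F.\<close>
  moreover have "\<tau> (?r * (J * Z t)) = \<tau> (\<rho> t * P1 t)"
  proof -
    have uZ: "u * Z t = Z t" using assms by (simp add: Z_def algebra_simps unit flip: mult.assoc)
    have "J * H t * \<rho> t * J * Z t = H t * \<rho> t * (J * J) * Z t"
      using assms by (metis J_commute mult.assoc)
    then have 1: "J * H t * \<rho> t * J * Z t = - (H t * \<rho> t * Z t)" by (simp add: JJ mult.assoc uZ)
    have "J * \<rho> t * H t * J * Z t = \<rho> t * H t * (J * J) * Z t"
      using assms by (metis J_commute mult.assoc)
    then have 2: "J * \<rho> t * H t * J * Z t = - (\<rho> t * H t * Z t)" by (simp add: JJ mult.assoc uZ)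
    have "?r * (J * Z t) = - (J * H t * \<rho> t * J * Z t) + J * \<rho> t * H t * J * Z t"
      by (simp add: algebra_simps)
    then have "?r * (J * Z t) = H t * (\<rho> t * Z t) - \<rho> t * (H t * Z t)"
      unfolding 1 2 by (simp add: mult.assoc)
    then have "\<tau> (?r * (J * Z t)) = \<tau> (\<rho> t * Z t * H t) - \<tau> (\<rho> t * (H t * Z t))"
      using assms by (simp add: \<tau>.diff trace_commute[of "H t"] unit)
    also have "\<dots> = - \<tau> (\<rho> t * (H t * Z t - Z t * H t))"
      by (simp add: right_diff_distrib \<tau>.diff mult.assoc)
    finally show ?thesis using assms by (simp add: commutator_Z \<tau>.neg)
  qed
  ultimately show ?thesis
    by (simp only: has_real_derivative_iff_has_vector_derivative \<tau>.add) simp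
qed

lemma abs_trace_\<rho>_le: "t \<in> T \<Longrightarrow> \<bar>\<tau> (\<rho> t * (J * X))\<bar> \<le> norm J * norm X"
  using mult_mono[OF norm_\<rho> norm_mult_ineq[of J X]] unit(7)
  by (intro order_trans[OF trace_le]) simp_all

lemma F_deriv_le: "t \<in> T \<Longrightarrow> \<bar>- \<tau> (\<rho> t * (J * Z1 t))\<bar> \<le>
    norm J * (20 * ((s t)^3 * (norm (H1 t))\<^sup>2) + 2 * ((s t)\<^sup>2 * norm (H2 t)))"
  using order_trans[OF abs_trace_\<rho>_le mult_left_mono[OF norm_Z1_le norm_ge_zero]] by simp

lemma F_close: "t \<in> T \<Longrightarrow> \<bar>F t - \<tau> (\<rho> t * P t)\<bar> \<le> norm J * (2 * ((s t)\<^sup>2 * norm (H1 t)))"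
  using order_trans[OF abs_trace_\<rho>_le mult_left_mono[OF norm_Z_le norm_ge_zero]] by (simp add: F_def)

end

section \<open>The transverse-field Ising Hamiltonian\<close>

lemma mat_adjoint_eqI:
  fixes A :: cmat
  assumes "A \<in> carrier_mat n n" "\<And>i j. i < n \<Longrightarrow> j < n \<Longrightarrow> cnj (A $$ (j, i)) = A $$ (i, j)"
  shows "mat_adjoint A = A"
  by (rule eq_matI) (use assms in auto)

lemma mat_adjoint_eqD:
  fixes A :: cmat
  assumes "A \<in> carrier_mat n n" "mat_adjoint A = A" "i < n" "j < n"
  shows "cnj (A $$ (j, i)) = A $$ (i, j)"
  using index_mat_adjoint[of i A j] assms by auto

lemma mod_less_of_less_mult: "i < m * n \<Longrightarrow> i mod n < (n::nat)"
  by (cases n) auto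

lemma div_less_of_less_mult: "i < m * n \<Longrightarrow> i div n < (m::nat)"
  by (simp add: less_mult_imp_div_less)

lemma kron_carrier: "A \<in> carrier_mat m m \<Longrightarrow> B \<in> carrier_mat n n \<Longrightarrow> kron A B \<in> carrier_mat (m * n) (m * n)"
  by (simp add: kron_def)

lemma index_kron:
  assumes "A \<in> carrier_mat m m" "B \<in> carrier_mat n n" "i < m * n" "j < m * n"
  shows "kron A B $$ (i, j) = A $$ (i div n, j div n) * B $$ (i mod n, j mod n)"
  using assms by (simp add: kron_def)

lemma kron_hermitian:
  assumes "A \<in> carrier_mat m m" "B \<in> carrier_mat n n" "mat_adjoint A = A" "mat_adjoint B = B"
  shows "mat_adjoint (kron A B) = kron A B"
  by (rule mat_adjoint_eqI[OF kron_carrier[OF assms(1,2)]])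
    (simp add: index_kron[OF assms(1,2)] mat_adjoint_eqD[OF assms(1,3)] mat_adjoint_eqD[OF assms(2,4)]
      div_less_of_less_mult mod_less_of_less_mult)

text \<open>An index of the product is a pair of quotient and remainder; distinct indices differ in
  one of them, and there the corresponding factor is 0.\<close>

lemma kron_diagonal:
  assumes "A \<in> carrier_mat m m" "B \<in> carrier_mat n n" "diagonal_mat A" "diagonal_mat B"
  shows "diagonal_mat (kron A B)"
  unfolding diagonal_mat_def
proof (intro allI impI)
  fix i j assume "i < dim_row (kron A B)" "j < dim_col (kron A B)" and ne: "i \<noteq> j"
  then have ij: "i < m * n" "j < m * n" using kron_carrier[OF assms(1,2)] by auto
  have "i div n \<noteq> j div n \<or> i mod n \<noteq> j mod n" using ne by (metis div_mult_mod_eq)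
  then show "kron A B $$ (i, j) = 0"
    using assms ij by (auto simp: index_kron[OF assms(1,2)] diagonal_mat_def div_less_of_less_mult
        mod_less_of_less_mult)
qed

lemma foldr_kron:
  assumes "\<And>x. x \<in> set xs \<Longrightarrow> f x \<in> carrier_mat 2 2 \<and> mat_adjoint (f x) = f x"
  shows "foldr kron (map f xs) (1\<^sub>m 1) \<in> carrier_mat (2 ^ length xs) (2 ^ length xs) \<and>
    mat_adjoint (foldr kron (map f xs) (1\<^sub>m 1)) = foldr kron (map f xs) (1\<^sub>m 1) \<and>
    ((\<forall>x\<in>set xs. diagonal_mat (f x)) \<longrightarrow> diagonal_mat (foldr kron (map f xs) (1\<^sub>m 1)))"
  using assms
proof (induction xs)
  case Nil
  show ?case by (simp add: diagonal_mat_def)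
next
  case (Cons x xs)
  then show ?case by (auto intro!: kron_hermitian kron_diagonal simp: kron_carrier)
qed

lemma pauli:
  "pauli_x \<in> carrier_mat 2 2" "mat_adjoint pauli_x = pauli_x"
  "pauli_z \<in> carrier_mat 2 2" "mat_adjoint pauli_z = pauli_z" "diagonal_mat pauli_z"
proof -
  show x: "pauli_x \<in> carrier_mat 2 2" and z: "pauli_z \<in> carrier_mat 2 2"
    by (auto simp: pauli_x_def pauli_z_def mat_of_rows_list_def)
  show "mat_adjoint pauli_x = pauli_x" "mat_adjoint pauli_z = pauli_z"
    by (rule mat_adjoint_eqI[OF x], auto simp: pauli_x_def mat_of_rows_list_def less_2_cases_iff)
      (rule mat_adjoint_eqI[OF z], auto simp: pauli_z_def mat_of_rows_list_def less_2_cases_iff)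
  show "diagonal_mat pauli_z"
    by (auto simp: diagonal_mat_def pauli_z_def mat_of_rows_list_def less_Suc_eq numeral_2_eq_2)
qed

lemma one_diagonal: "diagonal_mat (1\<^sub>m n :: cmat)"
  by (simp add: diagonal_mat_def)

lemma sigma_x: "sigma_x N i \<in> carrier_mat (2 ^ N) (2 ^ N)" "mat_adjoint (sigma_x N i) = sigma_x N i"
  using foldr_kron[of "[0..<N]" "\<lambda>j. if j = i then pauli_x else 1\<^sub>m 2"]
  by (simp_all add: sigma_x_def site_op_def pauli)

lemma sigma_z: "sigma_z N i \<in> carrier_mat (2 ^ N) (2 ^ N)" "mat_adjoint (sigma_z N i) = sigma_z N i"
  "diagonal_mat (sigma_z N i)"
  using foldr_kron[of "[0..<N]" "\<lambda>j. if j = i then pauli_z else 1\<^sub>m 2"]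
  by (simp_all add: sigma_z_def site_op_def pauli one_diagonal)

lemma diagonal_mult_entry:
  fixes A B :: cmat
  assumes "A \<in> carrier_mat n n" "B \<in> carrier_mat n n" "diagonal_mat A" "i < n" "j < n"
  shows "(A * B) $$ (i, j) = A $$ (i, i) * B $$ (i, j)"
proof -
  have "(A * B) $$ (i, j) = (\<Sum>k<n. A $$ (i, k) * B $$ (k, j))"
    using assms by (simp add: scalar_prod_def atLeast0LessThan)
  also have "\<dots> = (\<Sum>k<n. if k = i then A $$ (i, i) * B $$ (i, j) else 0)"
    using assms by (intro sum.cong) (auto simp: diagonal_mat_def)
  finally show ?thesis using assms by simp
qed

text \<open>A product of Hermitian matrices need not be Hermitian. Diagonality is carried through
  the induction because it reduces the entries to products of real diagonal entries.\<close>

lemma foldr_sigma_z: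
  "foldr (\<lambda>i M. sigma_z N i * M) xs (1\<^sub>m (2 ^ N)) \<in> carrier_mat (2 ^ N) (2 ^ N) \<and>
   mat_adjoint (foldr (\<lambda>i M. sigma_z N i * M) xs (1\<^sub>m (2 ^ N))) =
     foldr (\<lambda>i M. sigma_z N i * M) xs (1\<^sub>m (2 ^ N)) \<and>
   diagonal_mat (foldr (\<lambda>i M. sigma_z N i * M) xs (1\<^sub>m (2 ^ N)))"
proof (induction xs)
  case Nil
  show ?case by (simp add: one_diagonal)
next
  case (Cons x xs)
  let ?B = "foldr (\<lambda>i M. sigma_z N i * M) xs (1\<^sub>m (2 ^ N))" and ?A = "sigma_z N x"
  have B: "?B \<in> carrier_mat (2 ^ N) (2 ^ N)" "mat_adjoint ?B = ?B" "diagonal_mat ?B" using Cons by auto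
  note A = sigma_z[of N x]
  have AB: "?A * ?B \<in> carrier_mat (2 ^ N) (2 ^ N)" using A(1) B(1) by (rule mult_carrier_mat)
  have D: "diagonal_mat (?A * ?B)"
    unfolding diagonal_mat_def
    using AB diagonal_mult_entry[OF A(1) B(1) A(3)] B(1,3) by (auto simp: diagonal_mat_def)
  have "mat_adjoint (?A * ?B) = ?A * ?B"
  proof (rule mat_adjoint_eqI[OF AB])
    fix i j :: nat assume ij: "i < 2 ^ N" "j < 2 ^ N"
    show "cnj ((?A * ?B) $$ (j, i)) = (?A * ?B) $$ (i, j)"
    proof (cases "i = j")
      case True
      then show ?thesis
        using ij mat_adjoint_eqD[OF A(1,2), of i i] mat_adjoint_eqD[OF B(1,2), of i i]
        by (simp add: diagonal_mult_entry[OF A(1) B(1) A(3)])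
    next
      case False
      moreover have "(?A * ?B) $$ (k, l) = 0" if "k < 2 ^ N" "l < 2 ^ N" "k \<noteq> l" for k l
        using D that unfolding diagonal_mat_def carrier_matD[OF AB] by blast
      ultimately show ?thesis using ij by simp
    qed
  qed
  then show ?case using AB D by simp
qed

lemma mat_sum_hermitian:
  assumes "\<And>i. i \<in> I \<Longrightarrow> f i \<in> carrier_mat n n" "\<And>i. i \<in> I \<Longrightarrow> mat_adjoint (f i) = f i"
  shows "mat_adjoint (mat_sum n f I) = mat_sum n f I"
  by (rule mat_adjoint_eqI[of _ n]) (auto simp: mat_sum_def mat_adjoint_eqD[OF assms(1) assms(2)] intro!: sum.cong)

lemma mat_sum_carrier: "mat_sum n f I \<in> carrier_mat n n"
  by (simp add: mat_sum_def)

lemma smult_hermitian: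
  assumes "A \<in> carrier_mat n n" "mat_adjoint A = A"
  shows "mat_adjoint (complex_of_real r \<cdot>\<^sub>m A) = complex_of_real r \<cdot>\<^sub>m A"
  by (rule mat_adjoint_eqI[of _ n]) (use assms mat_adjoint_eqD[OF assms] in auto)

lemma ising_carrier: "ising_hamiltonian N J \<in> carrier_mat (2 ^ N) (2 ^ N)"
  by (simp add: ising_hamiltonian_def mat_sum_carrier)

lemma ising_hermitian: "mat_adjoint (ising_hamiltonian N J) = ising_hamiltonian N J"
proof -
  let ?f = "\<lambda>S. complex_of_real (J S) \<cdot>\<^sub>m
        foldr (\<lambda>i M. sigma_z N i * M) (sorted_list_of_set S) (1\<^sub>m (2 ^ N))"
  let ?I = "{S. S \<subseteq> {..<N} \<and> S \<noteq> {}}"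
  have "mat_adjoint (mat_sum (2 ^ N) ?f ?I) = mat_sum (2 ^ N) ?f ?I"
    using foldr_sigma_z[of N] by (intro mat_sum_hermitian smult_hermitian[of _ "2 ^ N"]) auto
  then show ?thesis
    unfolding ising_hamiltonian_def
    by (intro mat_adjoint_eqI[of _ "2 ^ N"])
      (auto simp: mat_sum_carrier carrier_matD[OF mat_sum_carrier] mat_adjoint_eqD[OF mat_sum_carrier])
qed

abbreviation transverse_field :: "nat \<Rightarrow> cmat" where
  "transverse_field N \<equiv> mat_sum (2 ^ N) (sigma_x N) {..<N}"

lemma transverse_ising_carrier: "transverse_ising N J \<Gamma> \<in> carrier_mat (2 ^ N) (2 ^ N)"
  unfolding transverse_ising_def
  by (intro minus_carrier_mat smult_carrier_mat mat_sum_carrier)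

lemma transverse_ising_hermitian: "mat_adjoint (transverse_ising N J \<Gamma>) = transverse_ising N J \<Gamma>"
proof -
  let ?V = "complex_of_real \<Gamma> \<cdot>\<^sub>m transverse_field N"
  have V: "?V \<in> carrier_mat (2 ^ N) (2 ^ N)" by (intro smult_carrier_mat mat_sum_carrier)
  have "mat_adjoint ?V = ?V"
    using sigma_x by (intro smult_hermitian[OF mat_sum_carrier] mat_sum_hermitian) auto
  then show ?thesis
    using mat_adjoint_eqD[OF V] mat_adjoint_eqD[OF ising_carrier ising_hermitian]
    unfolding transverse_ising_def
    by (intro mat_adjoint_eqI[OF minus_carrier_mat[OF V]])
      (simp add: carrier_matD[OF V] carrier_matD[OF ising_carrier] carrier_matD[OF mat_sum_carrier])
qed

text \<open>Time enters only as a scalar in front of a fixed matrix, so both derivatives of the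
  Hamiltonian are multiples of that matrix.\<close>

lemma emb_transverse_ising:
  "emb (transverse_ising N J \<Gamma>) = emb (ising_hamiltonian N J) - \<Gamma> *\<^sub>R emb (transverse_field N)"
  unfolding transverse_ising_def
  by (simp add: emb_diff[OF ising_carrier smult_carrier_mat[OF mat_sum_carrier]] emb_smult)

section \<open>Distance of rank-one projections\<close>

lemma cmod_sq_sum_le:
  "(cmod (\<Sum>k<n. cnj (f k) * g k))\<^sup>2 \<le> (\<Sum>k<n. (cmod (f k))\<^sup>2) * (\<Sum>k<n. (cmod (g k))\<^sup>2)"
proof -
  have "cmod (\<Sum>k<n. cnj (f k) * g k) \<le> (\<Sum>k<n. \<bar>cmod (f k)\<bar> * \<bar>cmod (g k)\<bar>)"
    by (intro order_trans[OF norm_sum] sum_mono) (simp add: norm_mult)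
  also have "\<dots> \<le> L2_set (\<lambda>k. cmod (f k)) {..<n} * L2_set (\<lambda>k. cmod (g k)) {..<n}"
    by (rule L2_set_mult_ineq)
  finally have "(cmod (\<Sum>k<n. cnj (f k) * g k))\<^sup>2 \<le>
      (L2_set (\<lambda>k. cmod (f k)) {..<n} * L2_set (\<lambda>k. cmod (g k)) {..<n})\<^sup>2"
    by (rule power_mono) simp
  then show ?thesis by (simp add: L2_set_def power_mult_distrib sum_nonneg)
qed

lemma sum_cmod_sq_diff:
  "complex_of_real (\<Sum>k<n. (cmod (f k - c * g k))\<^sup>2) =
    (\<Sum>k<n. cnj (f k) * f k) - c * (\<Sum>k<n. cnj (f k) * g k) - cnj c * (\<Sum>k<n. cnj (g k) * f k)
    + c * cnj c * (\<Sum>k<n. cnj (g k) * g k)"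
  unfolding of_real_sum complex_norm_square
  by (simp add: sum_distrib_left sum.distrib sum_subtractf algebra_simps)

text \<open>Here x \<psi> - y \<phi> is the difference of the two projections applied to v. The
  bound is Cauchy-Schwarz for the components of \<psi> and v orthogonal to \<phi>: they have squared
  lengths 1 - |z|^2 and |v|^2 - |y|^2 and inner product x - cnj z y.\<close>

lemma projection_difference:
  fixes \<psi> \<phi> v :: "nat \<Rightarrow> complex"
  assumes \<psi>: "(\<Sum>k<n. cnj (\<psi> k) * \<psi> k) = 1" and \<phi>: "(\<Sum>k<n. cnj (\<phi> k) * \<phi> k) = 1"
  defines "x \<equiv> \<Sum>k<n. cnj (\<psi> k) * v k" and "y \<equiv> \<Sum>k<n. cnj (\<phi> k) * v k"
    and "z \<equiv> \<Sum>k<n. cnj (\<phi> k) * \<psi> k"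
  shows "(\<Sum>k<n. (cmod (x * \<psi> k - y * \<phi> k))\<^sup>2) = (cmod (x - cnj z * y))\<^sup>2 + (1 - (cmod z)\<^sup>2) * (cmod y)\<^sup>2"
    and "(\<Sum>k<n. (cmod (x * \<psi> k - y * \<phi> k))\<^sup>2) \<le> (1 - (cmod z)\<^sup>2) * (\<Sum>k<n. (cmod (v k))\<^sup>2)"
    and "(cmod z)\<^sup>2 \<le> 1"
proof -
  have cz: "(\<Sum>k<n. cnj (\<psi> k) * \<phi> k) = cnj z" by (simp add: z_def mult.commute)
  have cy: "(\<Sum>k<n. cnj (v k) * \<phi> k) = cnj y" by (simp add: y_def mult.commute)
  have "complex_of_real (\<Sum>k<n. (cmod (x * \<psi> k - y * \<phi> k))\<^sup>2) =
      complex_of_real ((cmod (x - cnj z * y))\<^sup>2 + (1 - (cmod z)\<^sup>2) * (cmod y)\<^sup>2)"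
  proof -
    have e: "(\<Sum>k<n. cnj (x * \<psi> k) * (x * \<psi> k)) = cnj x * x"
      "(\<Sum>k<n. cnj (x * \<psi> k) * \<phi> k) = cnj x * cnj z"
      "(\<Sum>k<n. cnj (\<phi> k) * (x * \<psi> k)) = x * z"
      using \<psi> cz by (simp_all add: z_def mult_ac flip: sum_distrib_left)
    show ?thesis
      unfolding sum_cmod_sq_diff e \<phi>
      by (simp only: of_real_add of_real_mult of_real_diff of_real_1 complex_norm_square) (simp add: algebra_simps)
  qed
  then show eq: "(\<Sum>k<n. (cmod (x * \<psi> k - y * \<phi> k))\<^sup>2) =
      (cmod (x - cnj z * y))\<^sup>2 + (1 - (cmod z)\<^sup>2) * (cmod y)\<^sup>2"
    by (simp only: of_real_eq_iff)
  have w: "(\<Sum>k<n. (cmod (\<psi> k - z * \<phi> k))\<^sup>2) = 1 - (cmod z)\<^sup>2"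
  proof -
    have "complex_of_real (\<Sum>k<n. (cmod (\<psi> k - z * \<phi> k))\<^sup>2) = complex_of_real (1 - (cmod z)\<^sup>2)"
      unfolding sum_cmod_sq_diff \<psi> \<phi> cz z_def[symmetric]
      by (simp only: of_real_diff of_real_1 complex_norm_square) (simp add: algebra_simps)
    then show ?thesis by (simp only: of_real_eq_iff)
  qed
  then show "(cmod z)\<^sup>2 \<le> 1" using sum_nonneg[of "{..<n}" "\<lambda>k. (cmod (\<psi> k - z * \<phi> k))\<^sup>2"] by simp
  have r: "(\<Sum>k<n. (cmod (v k - y * \<phi> k))\<^sup>2) = (\<Sum>k<n. (cmod (v k))\<^sup>2) - (cmod y)\<^sup>2"
  proof -
    have "complex_of_real (\<Sum>k<n. (cmod (v k - y * \<phi> k))\<^sup>2) =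
        complex_of_real ((\<Sum>k<n. (cmod (v k))\<^sup>2) - (cmod y)\<^sup>2)"
      unfolding sum_cmod_sq_diff \<phi> cy y_def[symmetric]
      by (simp only: of_real_diff of_real_sum complex_norm_square) (simp add: algebra_simps)
    then show ?thesis by (simp only: of_real_eq_iff)
  qed
  have p: "(\<Sum>k<n. cnj (\<psi> k - z * \<phi> k) * (v k - y * \<phi> k)) = x - cnj z * y"
  proof -
    have "(\<Sum>k<n. cnj (\<psi> k - z * \<phi> k) * (v k - y * \<phi> k)) =
        (\<Sum>k<n. cnj (\<psi> k) * v k) - y * (\<Sum>k<n. cnj (\<psi> k) * \<phi> k) - cnj z * (\<Sum>k<n. cnj (\<phi> k) * v k)
        + cnj z * y * (\<Sum>k<n. cnj (\<phi> k) * \<phi> k)"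
      by (simp add: sum_distrib_left sum.distrib sum_subtractf algebra_simps)
    then show ?thesis unfolding \<phi> cz x_def[symmetric] y_def[symmetric] by simp
  qed
  have "(cmod (x - cnj z * y))\<^sup>2 \<le> (1 - (cmod z)\<^sup>2) * ((\<Sum>k<n. (cmod (v k))\<^sup>2) - (cmod y)\<^sup>2)"
    using cmod_sq_sum_le[where n = n and f = "\<lambda>k. \<psi> k - z * \<phi> k" and g = "\<lambda>k. v k - y * \<phi> k"] unfolding p w r .
  then show "(\<Sum>k<n. (cmod (x * \<psi> k - y * \<phi> k))\<^sup>2) \<le> (1 - (cmod z)\<^sup>2) * (\<Sum>k<n. (cmod (v k))\<^sup>2)"
    unfolding eq by (simp add: algebra_simps)
qed

lemma op_norm_ketbra_diff:
  assumes \<psi>: "\<psi> \<in> carrier_vec n" "vnorm \<psi> = 1" and \<phi>: "\<phi> \<in> carrier_vec n" "vnorm \<phi> = 1"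
  shows "op_norm (ketbra \<psi> \<psi> - ketbra \<phi> \<phi>) =
    sqrt (1 - Re (tr (emb (ketbra \<psi> \<psi>) * emb (ketbra \<phi> \<phi>))))"
proof -
  let ?M = "ketbra \<psi> \<psi> - ketbra \<phi> \<phi>"
  define z where "z = (\<Sum>k<n. cnj (\<phi> $ k) * \<psi> $ k)"
  have unit: "(\<Sum>k<n. cnj (w $ k) * w $ k) = 1" if "w \<in> carrier_vec n" "vnorm w = 1" for w :: cvec
  proof -
    have "(\<Sum>k<n. cnj (w $ k) * w $ k) = complex_of_real ((vnorm w)\<^sup>2)"
      unfolding vnorm_sq[OF that(1)] of_real_sum complex_norm_square by (simp add: mult.commute)
    then show ?thesis by (simp add: that(2))
  qed
  note u = unit[OF \<psi>] unit[OF \<phi>]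
  have "tr (emb (ketbra \<psi> \<psi>) * emb (ketbra \<phi> \<phi>)) =
      (\<Sum>i<n. \<Sum>j<n. (\<psi> $ i * cnj (\<psi> $ j)) * (\<phi> $ j * cnj (\<phi> $ i)))"
    by (simp add: tr_times[OF supp_in_emb[OF ketbra_carrier[OF \<psi>(1) \<psi>(1)]]
          supp_in_emb[OF ketbra_carrier[OF \<phi>(1) \<phi>(1)]]] entry_ketbra[OF \<psi>(1) \<psi>(1)] entry_ketbra[OF \<phi>(1) \<phi>(1)])
  also have "\<dots> = z * cnj z"
    unfolding z_def cnj_sum sum_product by (intro sum.cong refl) (simp add: mult_ac)
  finally have tr: "Re (tr (emb (ketbra \<psi> \<psi>) * emb (ketbra \<phi> \<phi>))) = (cmod z)\<^sup>2"
    by (simp only: complex_norm_square[symmetric] Re_complex_of_real)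
  have Mv: "(vnorm (?M *\<^sub>v v))\<^sup>2 = (\<Sum>k<n. (cmod ((\<Sum>l<n. cnj (\<psi> $ l) * v $ l) * \<psi> $ k -
      (\<Sum>l<n. cnj (\<phi> $ l) * v $ l) * \<phi> $ k))\<^sup>2)" if v: "v \<in> carrier_vec n" for v
  proof -
    have "?M *\<^sub>v v \<in> carrier_vec n"
      using v by (intro mult_mat_vec_carrier[of _ _ n] minus_carrier_mat ketbra_carrier \<psi> \<phi>)
    then have "(vnorm (?M *\<^sub>v v))\<^sup>2 = (\<Sum>k<n. (cmod ((?M *\<^sub>v v) $ k))\<^sup>2)" by (rule vnorm_sq)
    moreover have "(?M *\<^sub>v v) $ k = (\<Sum>l<n. cnj (\<psi> $ l) * v $ l) * \<psi> $ k -
      (\<Sum>l<n. cnj (\<phi> $ l) * v $ l) * \<phi> $ k" if "k < n" for k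
    proof -
      have "(?M *\<^sub>v v) $ k = (\<Sum>l<n. (\<psi> $ k * cnj (\<psi> $ l) - \<phi> $ k * cnj (\<phi> $ l)) * v $ l)"
        using that v \<psi>(1) \<phi>(1) by (simp add: ketbra_def scalar_prod_def atLeast0LessThan)
      then show ?thesis by (simp add: sum_distrib_left sum_distrib_right sum_subtractf algebra_simps)
    qed
    ultimately show ?thesis by simp
  qed
  have z1: "(cmod z)\<^sup>2 \<le> 1"
    unfolding z_def using projection_difference(3)[OF u] .
  have dim: "dim_col ?M = n" using \<phi>(1) by (simp add: ketbra_def)
  show ?thesis
    unfolding op_norm_def tr dim
  proof (rule cSup_eq_maximum)
    \<comment> \<open>The supremum is attained at v = \<psi>, where x = 1 and y = z, so the squared
      length is (1 - |z|^2)^2 + (1 - |z|^2) |z|^2 = 1 - |z|^2.\<close>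
    have "1 - cnj z * z = complex_of_real (1 - (cmod z)\<^sup>2)"
      by (simp only: of_real_diff of_real_1 complex_norm_square mult.commute)
    then have "(cmod (1 - cnj z * z))\<^sup>2 = (1 - (cmod z)\<^sup>2)\<^sup>2" by (simp only: norm_of_real power2_abs)
    moreover have "(vnorm (?M *\<^sub>v \<psi>))\<^sup>2 = (cmod (1 - cnj z * z))\<^sup>2 + (1 - (cmod z)\<^sup>2) * (cmod z)\<^sup>2"
      unfolding Mv[OF \<psi>(1)] projection_difference(1)[OF u] unfolding z_def u(1) ..
    ultimately have "(vnorm (?M *\<^sub>v \<psi>))\<^sup>2 = 1 - (cmod z)\<^sup>2"
      by (simp add: power2_eq_square algebra_simps)
    then have "vnorm (?M *\<^sub>v \<psi>) = sqrt (1 - (cmod z)\<^sup>2)"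
      by (metis real_sqrt_abs abs_of_nonneg vnorm_def real_sqrt_ge_zero sum_nonneg zero_le_power2)
    then show "sqrt (1 - (cmod z)\<^sup>2) \<in> {vnorm (?M *\<^sub>v v) |v. v \<in> carrier_vec n \<and> vnorm v \<le> 1}"
      using \<psi> by (auto intro!: exI[of _ \<psi>])
  next
    fix r assume "r \<in> {vnorm (?M *\<^sub>v v) |v. v \<in> carrier_vec n \<and> vnorm v \<le> 1}"
    then obtain v where v: "r = vnorm (?M *\<^sub>v v)" "v \<in> carrier_vec n" "vnorm v \<le> 1" by blast
    have "r\<^sup>2 \<le> (1 - (cmod z)\<^sup>2) * (vnorm v)\<^sup>2"
      unfolding v(1) Mv[OF v(2)] vnorm_sq[OF v(2)] z_def by (rule projection_difference(2)[OF u])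
    also have "\<dots> \<le> (1 - (cmod z)\<^sup>2) * 1"
    proof (rule mult_left_mono)
      have "0 \<le> vnorm v" by (simp add: vnorm_def sum_nonneg)
      then show "(vnorm v)\<^sup>2 \<le> 1" using v(3) by (simp add: power_le_one)
    qed (use z1 in simp)
    finally show "r \<le> sqrt (1 - (cmod z)\<^sup>2)" by (simp add: real_le_rsqrt)
  qed
qed

section \<open>Estimates for the annealing schedule\<close>

text \<open>W is the antiderivative of the bound on |F'| that vanishes at infinity, hence W \<le> 0.
  Both W + F and W - F are nondecreasing, so an increment of F is at most that of W, which is at
  most - W s.\<close>

lemma decay_bound:
  fixes F F' :: "real \<Rightarrow> real"
  assumes \<delta>: "\<delta> > 0" and c: "c > 0" and \<eta>: "\<eta> > 0"
    and F: "\<And>t. t \<ge> 0 \<Longrightarrow> (F has_real_derivative F' t) (at t within {0..})"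
    and F': "\<And>t. t \<ge> 0 \<Longrightarrow> \<bar>F' t\<bar> \<le> C * \<delta> * (\<delta> * t + c) powr (- 1 - \<eta>)"
    and st: "0 \<le> s" "s \<le> t" and C: "C \<ge> 0"
  shows "\<bar>F t - F s\<bar> \<le> C / \<eta> * (\<delta> * s + c) powr - \<eta>"
proof -
  define W where "W t = - (C / \<eta> * (\<delta> * t + c) powr - \<eta>)" for t
  have pos: "\<delta> * x + c > 0" if "x \<ge> 0" for x using that \<delta> c by (simp add: add_nonneg_pos)
  have W: "(W has_real_derivative C * \<delta> * (\<delta> * x + c) powr (- 1 - \<eta>)) (at x within {0..})" if "x \<ge> 0" for x
  proof -
    have "((\<lambda>t. - (C / \<eta> * (\<delta> * t + c) powr - \<eta>)) has_real_derivative
        - (C / \<eta> * (- \<eta> * (\<delta> * x + c) powr (- \<eta> - 1) * \<delta>))) (at x within {0..})"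
      using pos[OF that] by (auto intro!: derivative_eq_intros)
    then show ?thesis
      unfolding W_def by (rule DERIV_cong) (use \<eta> in \<open>simp add: minus_diff_commute\<close>)
  qed
  \<comment> \<open>The derivative within \<open>{0..}\<close> is two-sided at interior points; at
    the left end continuity suffices.\<close>
  have mono: "G s \<le> G t" if G: "\<And>x. x \<ge> 0 \<Longrightarrow> (G has_real_derivative G' x) (at x within {0..})"
    "\<And>x. x \<ge> 0 \<Longrightarrow> 0 \<le> G' x" for G G' :: "real \<Rightarrow> real"
  proof (rule DERIV_nonneg_imp_increasing_open[OF st(2)])
    fix x assume x: "s < x" "x < t"
    have "at x within {0..} = at x within UNIV"
      by (rule at_within_nhd[of _ "{0<..}"]) (use x st in auto)
    then show "\<exists>y. (G has_real_derivative y) (at x) \<and> 0 \<le> y"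
      using G[of x] x st by auto
  next
    have "continuous_on {0..} G"
      using G(1) by (auto simp: continuous_on_eq_continuous_within intro!: DERIV_continuous)
    then show "continuous_on {s..t} G" by (rule continuous_on_subset) (use st in auto)
  qed
  have "W s - F s \<le> W t - F t"
    by (rule mono[OF DERIV_diff[OF W F]]) (use F' in \<open>force simp: abs_le_iff\<close>)+
  moreover have "W s + F s \<le> W t + F t"
    by (rule mono[OF DERIV_add[OF W F]]) (use F' in \<open>force simp: abs_le_iff\<close>)+
  moreover have "W t \<le> 0" using C \<eta> by (simp add: W_def)
  ultimately have "\<bar>F t - F s\<bar> \<le> - W s" by linarith
  then show ?thesis by (simp add: W_def)
qed

text \<open>The bound makes F Cauchy along the natural numbers. Sending the larger argument to
  infinity along them then gives |F t - x| \<le> b t for all real t \<ge> 0.\<close>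

lemma decay_convergent:
  fixes F :: "real \<Rightarrow> real"
  assumes bound: "\<And>s t. 0 \<le> s \<Longrightarrow> s \<le> t \<Longrightarrow> \<bar>F t - F s\<bar> \<le> b s" and b: "(b \<longlongrightarrow> 0) at_top"
  shows "\<exists>x. (F \<longlongrightarrow> x) at_top"
proof -
  have "Cauchy (\<lambda>n. F (real n))"
  proof (rule CauchyI')
    fix e :: real assume "0 < e"
    then have "\<forall>\<^sub>F s in at_top. b s < e" using b by (rule order_tendstoD(2)[rotated])
    then obtain m where m: "\<And>s. s \<ge> m \<Longrightarrow> b s < e" by (auto simp: eventually_at_top_linorder)
    obtain M :: nat where M: "m \<le> real M" using real_arch_simple by blast
    show "\<exists>M. \<forall>m\<ge>M. \<forall>n>m. dist (F (real m)) (F (real n)) < e"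
    proof (intro exI[of _ M] allI impI)
      fix i n assume "M \<le> i" "i < n"
      then have "\<bar>F (real n) - F (real i)\<bar> \<le> b (real i)" by (intro bound) auto
      also have "\<dots> < e" using M \<open>M \<le> i\<close> by (intro m) simp
      finally show "dist (F (real i)) (F (real n)) < e" by (simp add: dist_real_def abs_minus_commute)
    qed
  qed
  then obtain x where x: "(\<lambda>n. F (real n)) \<longlonglongrightarrow> x" by (auto simp: Cauchy_convergent_iff convergent_def)
  have "((\<lambda>t. F t - x) \<longlongrightarrow> 0) at_top"
  proof (rule tendsto_0_le[OF b, of _ 1])
    have "\<bar>F t - x\<bar> \<le> \<bar>b t\<bar>" if t: "0 \<le> t" for t
    proof -
      have "(\<lambda>n. \<bar>F (real n) - F t\<bar>) \<longlonglongrightarrow> \<bar>x - F t\<bar>" by (intro tendsto_intros x)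
      moreover have "\<forall>\<^sub>F n in sequentially. \<bar>F (real n) - F t\<bar> \<le> b t"
        using eventually_ge_at_top[of "nat \<lceil>t\<rceil>"]
        by eventually_elim (intro bound t, simp add: nat_ceiling_le_eq)
      ultimately have "\<bar>x - F t\<bar> \<le> b t" by (rule tendsto_upperbound) simp
      then show ?thesis by simp
    qed
    then show "\<forall>\<^sub>F t in at_top. norm (F t - x) \<le> norm (b t) * 1"
      by (intro eventually_mono[OF eventually_ge_at_top[of "0::real"]]) simp
  qed
  then show ?thesis using LIM_zero_cancel by blast
qed

locale annealing_schedule =
  fixes N :: nat and c l c' c'' L \<delta> :: real and g g' g'' :: "real \<Rightarrow> real"
  assumes N: "N \<ge> 1" and pos: "c > 0" "l > 0" "c' > 0" "c'' > 0" "\<delta> > 0"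
    and L: "L < 1 / (3 * real N - 2)"
    and g_deriv: "t \<ge> 0 \<Longrightarrow> (g has_real_derivative g' t) (at t within {0..})"
    and g'_deriv: "t \<ge> 0 \<Longrightarrow> (g' has_real_derivative g'' t) (at t within {0..})"
    and g: "t \<ge> 0 \<Longrightarrow> 0 < g t \<and> g t \<le> L"
    and g'_le: "t \<ge> 0 \<Longrightarrow> \<bar>g' t\<bar> \<le> \<delta> * c' / (\<delta> * t + c) powr (1 + l)"
    and g''_le: "t \<ge> 0 \<Longrightarrow> \<bar>g'' t\<bar> * \<bar>ln (\<delta> * t + c)\<bar>
          \<le> \<delta>\<^sup>2 * c'' * (\<delta> * t + c) powr (- 1 - (2 * real N - 1) / (3 * real N - 2))"
begin

abbreviation "tau t \<equiv> \<delta> * t + c"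

text \<open>q is the extra decay exponent of g''. \<open>\<eta>0\<close> is the slack in L(3N-2) < 1
  and \<eta> the resulting slack in L(2N-1) < q; being the smaller of the two, \<eta> serves as the
  common decay exponent. Y and B also account for the times with \<open>tau t < 1\<close>, which
  occur when c < 1.\<close>

definition "q = (2 * real N - 1) / (3 * real N - 2)"
definition "\<eta>0 = 1 - L * (3 * real N - 2)"
definition "\<eta> = \<eta>0 * q"
definition "Y = max 1 (c powr - L)"
definition "B = c' * (1 / l + \<bar>ln c\<bar> * c powr - l) + L"

definition "\<Gamma> t = tau t powr - g t"
text \<open>D is the derivative of g ln tau, that is, minus the logarithmic derivative of \<Gamma>.
  The factor \<Gamma> thereby split off from both derivatives lowers the inverse powers of \<Gamma>
  in the estimates.\<close>

definition "D t = g' t * ln (tau t) + g t * \<delta> / tau t"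
definition "D1 t = g'' t * ln (tau t) + 2 * g' t * \<delta> / tau t - g t * \<delta>\<^sup>2 / (tau t)\<^sup>2"
definition "\<Gamma>1 t = - (\<Gamma> t * D t)"
definition "\<Gamma>2 t = \<Gamma> t * ((D t)\<^sup>2 - D1 t)"
text \<open>None of the three constants involves \<delta>. Their powers of c are the price for
  adjusting exponents by \<open>powr_le\<close>.\<close>

definition "K1 = B * Y ^ (2 * N - 1) * c powr (- 1 + L * real (2 * N - 1) + \<eta>)"
definition "K2 = B\<^sup>2 * Y ^ (3 * N - 2) * c powr (\<eta> - \<eta>0)"
definition "K3 = Y ^ (2 * N - 1) * ((B\<^sup>2 + L) * c powr (- 2 + L * real (2 * N - 1) + 1 + \<eta>) + c''
  + 2 * c' * c powr (- 2 - l + L * real (2 * N - 1) + 1 + \<eta>))"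

section \<open>Exponents and size of the field\<close>

lemma tau_ge: "t \<ge> 0 \<Longrightarrow> c \<le> tau t" and tau_pos: "t \<ge> 0 \<Longrightarrow> 0 < tau t"
  using pos by (simp_all add: add_nonneg_pos)

lemma L_pos: "0 < L" using g[of 0] by simp

lemma q: "0 < q" "q \<le> 1" using N by (auto simp: q_def field_simps)

lemma \<eta>0: "0 < \<eta>0" "\<eta>0 < 1"
  using L L_pos N by (auto simp: \<eta>0_def field_simps)

lemma \<eta>: "0 < \<eta>" "\<eta> \<le> \<eta>0"
  using q \<eta>0 by (auto simp: \<eta>_def mult_le_cancel_left2)

lemma L_exponents: "L * real (2 * N - 1) = q - \<eta>" "L * real (3 * N - 2) = 1 - \<eta>0"
proof -
  have n: "real (2 * N - 1) = 2 * real N - 1" "real (3 * N - 2) = 3 * real N - 2"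
    using N by (auto simp: of_nat_diff)
  show "L * real (3 * N - 2) = 1 - \<eta>0" by (simp add: \<eta>0_def n)
  have "3 * real N - 2 \<noteq> 0" using N by simp
  then show "L * real (2 * N - 1) = q - \<eta>"
  proof -
    have "q - \<eta> = (1 - \<eta>0) * q" by (simp add: \<eta>_def algebra_simps)
    also have "\<dots> = L * (2 * real N - 1)" using \<open>3 * real N - 2 \<noteq> 0\<close> by (simp add: \<eta>0_def q_def)
    finally show ?thesis by (simp only: n)
  qed
qed

lemma const_nonneg: "0 < Y" "0 \<le> B" "0 \<le> K1" "0 \<le> K2" "0 \<le> K3"
  using pos L_pos by (auto simp: Y_def B_def K1_def K2_def K3_def intro!: add_nonneg_nonneg mult_nonneg_nonneg)

text \<open>Since c may be less than 1, raising an exponent is not free; but tau stays above c, so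
  the cost is a fixed power of c.\<close>

lemma powr_le:
  assumes "t \<ge> 0" "x \<le> y"
  shows "tau t powr x \<le> c powr (x - y) * tau t powr y"
proof -
  have "tau t powr (x - y) \<le> c powr (x - y)"
    using assms tau_ge pos by (intro powr_mono2') auto
  then have "tau t powr (x - y) * tau t powr y \<le> c powr (x - y) * tau t powr y"
    by (rule mult_right_mono) simp
  then show ?thesis by (simp add: powr_add[symmetric])
qed

lemma \<Gamma>_pos: "t \<ge> 0 \<Longrightarrow> 0 < \<Gamma> t"
  using tau_pos[of t] by (simp add: \<Gamma>_def)

text \<open>The gap bound is available only for fields in this range. As L < 1 / (3N-2) \<le> 1, the
  exponent g is at most 1, so for \<open>tau t < 1\<close> the field is at most 1 / tau and hence at
  most 1 / c.\<close>

lemma \<Gamma>_le: assumes "t \<ge> 0" shows "\<Gamma> t \<le> max 1 (1 / c)"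
proof (cases "1 \<le> tau t")
  case True
  then have "tau t powr - g t \<le> tau t powr 0"
    using g[OF assms] by (intro powr_mono) auto
  then show ?thesis using True by (simp add: \<Gamma>_def)
next
  case False
  have "1 / (3 * real N - 2) \<le> 1" using N by simp
  then have "g t \<le> 1" using g[OF assms] L by linarith
  then have "tau t powr - g t \<le> tau t powr - 1"
    using False tau_pos[OF assms] by (intro powr_mono') auto
  also have "\<dots> = 1 / tau t" using tau_pos[OF assms] by (simp add: powr_minus_divide)
  also have "\<dots> \<le> 1 / c" using tau_ge[OF assms] pos by (intro divide_left_mono) auto
  finally show ?thesis by (simp add: \<Gamma>_def)
qed

lemma inverse_\<Gamma>_le: assumes "t \<ge> 0" shows "1 / \<Gamma> t \<le> Y * tau t powr L"
proof -
  have eq: "1 / \<Gamma> t = tau t powr g t" by (simp add: \<Gamma>_def powr_minus_divide)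
  show ?thesis
  proof (cases "1 \<le> tau t")
    case True
    then have "tau t powr g t \<le> 1 * tau t powr L" using g[OF assms] by (simp add: powr_mono)
    also have "\<dots> \<le> Y * tau t powr L" by (intro mult_right_mono) (auto simp: Y_def)
    finally show ?thesis by (simp add: eq)
  next
    case False
    then have "tau t powr g t \<le> tau t powr 0"
      using g[OF assms] tau_pos[OF assms] by (intro powr_mono') auto
    also have "\<dots> \<le> c powr (0 - L) * tau t powr L"
      using L_pos by (intro powr_le assms) simp
    also have "\<dots> \<le> Y * tau t powr L" by (intro mult_right_mono) (auto simp: Y_def)
    finally show ?thesis by (simp add: eq)
  qed
qed

lemma inverse_\<Gamma>_power_le:
  assumes "t \<ge> 0" shows "(1 / \<Gamma> t) ^ k \<le> Y ^ k * tau t powr (L * real k)"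
proof -
  have "(1 / \<Gamma> t) ^ k \<le> (Y * tau t powr L) ^ k"
    using inverse_\<Gamma>_le[OF assms] \<Gamma>_pos[OF assms] by (intro power_mono) auto
  also have "\<dots> = Y ^ k * tau t powr (L * real k)"
    using tau_pos[OF assms] by (simp add: power_mult_distrib powr_powr powr_realpow[symmetric])
  finally show ?thesis .
qed

text \<open>The positive l in the bound on g' pays for the logarithm: \<open>tau t powr l\<close>
  dominates it for large tau, and the term with \<open>ln c\<close> covers tau < 1.\<close>

lemma log_factor_le:
  assumes "t \<ge> 0" shows "\<bar>ln (tau t)\<bar> \<le> (1 / l + \<bar>ln c\<bar> * c powr - l) * tau t powr l"
proof (cases "1 \<le> tau t")
  case True
  then have "\<bar>ln (tau t)\<bar> \<le> 1 / l * tau t powr l" using ln_powr_bound[OF True pos(2)] by simp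
  also have "\<dots> \<le> (1 / l + \<bar>ln c\<bar> * c powr - l) * tau t powr l" by (intro mult_right_mono) auto
  finally show ?thesis .
next
  case False
  have "ln c \<le> ln (tau t)" "ln (tau t) \<le> 0" using False tau_ge[OF assms] tau_pos[OF assms] pos(1) by auto
  then have "\<bar>ln (tau t)\<bar> \<le> \<bar>ln c\<bar> * 1" by simp
  also have "\<dots> \<le> \<bar>ln c\<bar> * (c powr (0 - l) * tau t powr l)"
    using powr_le[OF assms, of 0 l] pos tau_pos[OF assms] by (intro mult_left_mono) auto
  also have "\<dots> \<le> (1 / l + \<bar>ln c\<bar> * c powr - l) * tau t powr l"
    using pos by (simp add: distrib_right)
  finally show ?thesis .
qed

lemma D_le: assumes "t \<ge> 0" shows "\<bar>D t\<bar> \<le> B * \<delta> / tau t"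
proof -
  note p = tau_pos[OF assms]
  have "\<bar>g' t * ln (tau t)\<bar> \<le> (\<delta> * c' / tau t powr (1 + l)) * ((1 / l + \<bar>ln c\<bar> * c powr - l) * tau t powr l)"
    unfolding abs_mult using g'_le[OF assms] log_factor_le[OF assms] pos by (intro mult_mono) auto
  also have "\<dots> = c' * (1 / l + \<bar>ln c\<bar> * c powr - l) * \<delta> / tau t"
  proof -
    have "(\<delta> * c' / (x * z)) * (k * z) = c' * k * \<delta> / x" if "z > 0" for k x z :: real
      using that by (simp add: field_simps)
    from this[of "tau t powr l" "tau t"] show ?thesis using p by (simp add: powr_add)
  qed
  finally have 1: "\<bar>g' t * ln (tau t)\<bar> \<le> c' * (1 / l + \<bar>ln c\<bar> * c powr - l) * \<delta> / tau t" .
  have "\<bar>g t * \<delta> / tau t\<bar> \<le> L * \<delta> / tau t"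
    using g[OF assms] p pos by (simp add: abs_mult divide_right_mono mult_right_mono)
  with 1 have "\<bar>D t\<bar> \<le> c' * (1 / l + \<bar>ln c\<bar> * c powr - l) * \<delta> / tau t + L * \<delta> / tau t"
    unfolding D_def by linarith
  also have "\<dots> = B * \<delta> / tau t" by (simp add: B_def add_divide_distrib[symmetric] distrib_right)
  finally show ?thesis .
qed

lemma D1_le:
  assumes "t \<ge> 0"
  shows "\<bar>D1 t\<bar> \<le> \<delta>\<^sup>2 * (c'' * tau t powr (- 1 - q) + 2 * c' * tau t powr (- 2 - l) + L * tau t powr - 2)"
proof -
  note p = tau_pos[OF assms]
  have 1: "\<bar>g'' t * ln (tau t)\<bar> \<le> \<delta>\<^sup>2 * (c'' * tau t powr (- 1 - q))"
    using g''_le[OF assms] by (simp add: abs_mult q_def mult_ac)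
  have "\<bar>2 * g' t * \<delta> / tau t\<bar> = 2 * \<bar>g' t\<bar> * \<delta> / tau t" using p pos by (simp add: abs_mult)
  also have "\<dots> \<le> 2 * (\<delta> * c' / tau t powr (1 + l)) * \<delta> / tau t"
    using g'_le[OF assms] p pos by (intro divide_right_mono mult_right_mono mult_left_mono) auto
  also have "\<dots> = \<delta>\<^sup>2 * (2 * c' * tau t powr (- 2 - l))"
  proof -
    have "- 2 - l = - ((1 + l) + 1)" by simp
    then have "tau t powr (- 2 - l) = 1 / (tau t powr (1 + l) * tau t powr 1)"
      by (simp only: powr_minus_divide powr_add)
    then show ?thesis using p by (simp add: power2_eq_square)
  qed
  finally have 2: "\<bar>2 * g' t * \<delta> / tau t\<bar> \<le> \<delta>\<^sup>2 * (2 * c' * tau t powr (- 2 - l))" .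
  have t2: "tau t powr - 2 = 1 / (tau t)\<^sup>2" using p by (simp add: powr_minus_divide)
  have 3: "\<bar>g t * \<delta>\<^sup>2 / (tau t)\<^sup>2\<bar> \<le> \<delta>\<^sup>2 * (L * tau t powr - 2)"
    unfolding t2 using g[OF assms] by (simp add: abs_mult divide_right_mono mult_right_mono mult.commute)
  have "\<bar>x + y - z\<bar> \<le> \<bar>x\<bar> + \<bar>y\<bar> + \<bar>z\<bar>" for x y z :: real by linarith
  from order_trans[OF this add_mono[OF add_mono[OF 1 2] 3]]
  show ?thesis unfolding D1_def distrib_left .
qed

lemma D_sq_le: assumes "t \<ge> 0" shows "(D t)\<^sup>2 \<le> B\<^sup>2 * \<delta>\<^sup>2 * tau t powr - 2"
proof -
  have "(D t)\<^sup>2 \<le> (B * \<delta> / tau t)\<^sup>2" using D_le[OF assms] by (metis abs_ge_zero power2_abs power_mono)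
  then show ?thesis using tau_pos[OF assms] by (simp add: powr_minus_divide power_mult_distrib power_divide)
qed

section \<open>Derivatives of the field and their weighted bounds\<close>

lemma \<Gamma>_deriv: "t \<ge> 0 \<Longrightarrow> (\<Gamma> has_real_derivative \<Gamma>1 t) (at t within {0..})"
proof -
  assume t: "t \<ge> 0"
  have 1: "(tau has_derivative (*) \<delta>) (at t within {0..})"
    by (auto intro!: derivative_eq_intros)
  have 2: "((\<lambda>t. - g t) has_derivative (*) (- g' t)) (at t within {0..})"
    using DERIV_minus[OF g_deriv[OF t]] by (simp add: has_field_derivative_def)
  have "(\<Gamma> has_derivative (\<lambda>h. tau t powr - g t *
      (- g' t * h * ln (tau t) + \<delta> * h * - g t / tau t))) (at t within {0..})"
    unfolding \<Gamma>_def[abs_def] using has_derivative_powr[OF 1 2 tau_pos[OF t]] t by simp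
  then show ?thesis
    unfolding has_field_derivative_def \<Gamma>1_def
    by (rule has_derivative_eq_rhs) (auto simp: \<Gamma>_def D_def fun_eq_iff algebra_simps)
qed

lemma D_deriv: "t \<ge> 0 \<Longrightarrow> (D has_real_derivative D1 t) (at t within {0..})"
proof -
  assume t: "t \<ge> 0"
  have 1: "((\<lambda>t. ln (tau t)) has_real_derivative \<delta> / tau t) (at t within {0..})"
    using tau_pos[OF t] by (auto intro!: derivative_eq_intros)
  have 2: "((\<lambda>t. \<delta> / tau t) has_real_derivative - (\<delta>\<^sup>2 / (tau t)\<^sup>2)) (at t within {0..})"
    using tau_pos[OF t] by (auto intro!: derivative_eq_intros simp: power2_eq_square)
  have "((\<lambda>t. g' t * ln (tau t) + g t * (\<delta> / tau t)) has_real_derivative D1 t) (at t within {0..})"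
    by (rule DERIV_cong[OF DERIV_add[OF DERIV_mult[OF g'_deriv[OF t] 1] DERIV_mult[OF g_deriv[OF t] 2]]])
      (simp add: D1_def mult_ac)
  then show ?thesis by (simp add: D_def[abs_def])
qed

lemma \<Gamma>1_deriv: "t \<ge> 0 \<Longrightarrow> (\<Gamma>1 has_real_derivative \<Gamma>2 t) (at t within {0..})"
  unfolding \<Gamma>1_def[abs_def] \<Gamma>2_def
  by (rule DERIV_cong[OF DERIV_minus[OF DERIV_mult[OF \<Gamma>_deriv D_deriv]]])
    (auto simp: \<Gamma>1_def power2_eq_square algebra_simps)

lemma first_order_bound:
  assumes "t \<ge> 0"
  shows "(1 / \<Gamma> t) ^ (2 * N) * \<bar>\<Gamma>1 t\<bar> \<le> K1 * \<delta> * tau t powr - \<eta>"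
proof -
  let ?m = "2 * N - 1" and ?x = "1 / \<Gamma> t"
  note G = \<Gamma>_pos[OF assms] and p = tau_pos[OF assms]
  have "2 * N = Suc ?m" using N by simp
  then have "?x ^ (2 * N) = ?x * ?x ^ ?m"
    by (metis power_Suc)
  then have "?x ^ (2 * N) * \<bar>\<Gamma>1 t\<bar> = ?x ^ ?m * \<bar>D t\<bar>"
    using G by (simp add: \<Gamma>1_def abs_mult)
  also have "\<dots> \<le> (Y ^ ?m * tau t powr (L * real ?m)) * (B * \<delta> / tau t)"
    using inverse_\<Gamma>_power_le[OF assms] D_le[OF assms] const_nonneg by (intro mult_mono) auto
  also have "\<dots> = B * Y ^ ?m * \<delta> * tau t powr (- 1 + L * real ?m)"
  proof -
    have "tau t powr (- 1 + L * real ?m) = tau t powr (L * real ?m) / tau t"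
      using p by (simp only: powr_add powr_minus_divide powr_one_gt_zero_iff) simp
    then show ?thesis by (simp only: mult_ac times_divide_eq_right times_divide_eq_left)
  qed
  \<comment> \<open>As \<open>L * real ?m = q - \<eta>\<close> and q \<le> 1, the exponent may be
    raised to - \<eta>.\<close>
  also have "\<dots> \<le> B * Y ^ ?m * \<delta> * (c powr (- 1 + L * real ?m - (- \<eta>)) * tau t powr - \<eta>)"
    using const_nonneg pos q L_exponents by (intro mult_left_mono powr_le assms) auto
  also have "\<dots> = K1 * \<delta> * tau t powr - \<eta>" by (simp add: K1_def)
  finally show ?thesis .
qed

text \<open>The square of \<Gamma>1 cancels two of the 3N inverse powers. The remaining 3N-2 cost
  tau^(1 - \<eta>0) against tau^(-2), which is where the condition on L makes the bound
  integrable.\<close>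

lemma first_order_sq_bound:
  assumes "t \<ge> 0"
  shows "(1 / \<Gamma> t) ^ (3 * N) * (\<Gamma>1 t)\<^sup>2 \<le> K2 * \<delta>\<^sup>2 * tau t powr (- 1 - \<eta>)"
proof -
  let ?m = "3 * N - 2" and ?x = "1 / \<Gamma> t"
  note G = \<Gamma>_pos[OF assms] and p = tau_pos[OF assms]
  have "3 * N = Suc (Suc ?m)" using N by simp
  then have "?x ^ (3 * N) = ?x * (?x * ?x ^ ?m)"
    by (metis power_Suc)
  then have "?x ^ (3 * N) * (\<Gamma>1 t)\<^sup>2 = ?x ^ ?m * (D t)\<^sup>2"
    using G by (simp add: \<Gamma>1_def power2_eq_square)
  also have "\<dots> \<le> (Y ^ ?m * tau t powr (L * real ?m)) * (B\<^sup>2 * \<delta>\<^sup>2 * tau t powr - 2)"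
    using inverse_\<Gamma>_power_le[OF assms] D_sq_le[OF assms] const_nonneg by (intro mult_mono) auto
  also have "\<dots> = B\<^sup>2 * Y ^ ?m * \<delta>\<^sup>2 * tau t powr (- 1 - \<eta>0)"
    unfolding L_exponents by (simp add: mult_ac powr_add[symmetric])
  also have "\<dots> \<le> B\<^sup>2 * Y ^ ?m * \<delta>\<^sup>2 * (c powr (- 1 - \<eta>0 - (- 1 - \<eta>)) * tau t powr (- 1 - \<eta>))"
    using const_nonneg \<eta> by (intro mult_left_mono powr_le assms) auto
  also have "\<dots> = K2 * \<delta>\<^sup>2 * tau t powr (- 1 - \<eta>)" by (simp add: K2_def)
  finally show ?thesis .
qed

lemma second_order_bound:
  assumes "t \<ge> 0"
  shows "(1 / \<Gamma> t) ^ (2 * N) * \<bar>\<Gamma>2 t\<bar> \<le> K3 * \<delta>\<^sup>2 * tau t powr (- 1 - \<eta>)"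
proof -
  let ?m = "2 * N - 1" and ?x = "1 / \<Gamma> t"
  let ?T = "\<lambda>e. tau t powr e"
  note G = \<Gamma>_pos[OF assms] and p = tau_pos[OF assms]
  have "2 * N = Suc ?m" using N by simp
  then have "?x ^ (2 * N) = ?x * ?x ^ ?m"
    by (metis power_Suc)
  then have "?x ^ (2 * N) * \<bar>\<Gamma>2 t\<bar> = ?x ^ ?m * \<bar>(D t)\<^sup>2 - D1 t\<bar>"
    using G by (simp add: \<Gamma>2_def abs_mult)
  also have "\<dots> \<le> (Y ^ ?m * ?T (L * real ?m)) *
      (\<delta>\<^sup>2 * ((B\<^sup>2 + L) * ?T (- 2) + c'' * ?T (- 1 - q) + 2 * c' * ?T (- 2 - l)))"
  proof (rule mult_mono[OF inverse_\<Gamma>_power_le[OF assms]])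
    show "\<bar>(D t)\<^sup>2 - D1 t\<bar> \<le> \<delta>\<^sup>2 * ((B\<^sup>2 + L) * ?T (- 2) + c'' * ?T (- 1 - q) + 2 * c' * ?T (- 2 - l))"
    proof -
      have "\<bar>(D t)\<^sup>2 - D1 t\<bar> \<le> (D t)\<^sup>2 + \<bar>D1 t\<bar>" using zero_le_power2[of "D t"] by linarith
      also note add_mono[OF D_sq_le[OF assms] D1_le[OF assms]]
      finally show ?thesis by (simp only: algebra_simps)
    qed
  qed (use const_nonneg in auto)
  also have "\<dots> = Y ^ ?m * \<delta>\<^sup>2 * ((B\<^sup>2 + L) * ?T (- 2 + L * real ?m) + c'' * ?T (- 1 - \<eta>)
      + 2 * c' * ?T (- 2 - l + L * real ?m))"
  proof -
    \<comment> \<open>For the term with c'' the growth \<open>q - \<eta>\<close> of the inverse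
      field meets the decay - 1 - q of g'' and leaves exactly - 1 - \<eta>.\<close>
    have "?T (- 1 - \<eta>) = ?T (L * real ?m) * ?T (- 1 - q)"
    proof -
      have "L * real ?m + (- 1 - q) = - 1 - \<eta>" unfolding L_exponents by simp
      then show ?thesis by (simp only: powr_add[symmetric])
    qed
    moreover have "?T (- 2 + L * real ?m) = ?T (L * real ?m) * ?T (- 2)"
      "?T (- 2 - l + L * real ?m) = ?T (L * real ?m) * ?T (- 2 - l)"
      by (simp_all only: powr_add[symmetric] add.commute)
    ultimately show ?thesis by (simp add: algebra_simps)
  qed
  also have "\<dots> \<le> Y ^ ?m * \<delta>\<^sup>2 * ((B\<^sup>2 + L) * (c powr (- 2 + L * real ?m - (- 1 - \<eta>)) * ?T (- 1 - \<eta>))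
      + c'' * ?T (- 1 - \<eta>) + 2 * c' * (c powr (- 2 - l + L * real ?m - (- 1 - \<eta>)) * ?T (- 1 - \<eta>)))"
    using const_nonneg pos q L_exponents L_pos
    by (intro mult_left_mono add_mono powr_le assms order_refl) auto
  also have "\<dots> = K3 * \<delta>\<^sup>2 * ?T (- 1 - \<eta>)"
    by (simp add: K3_def algebra_simps)
  finally show ?thesis .
qed

end

section \<open>Adiabatic evolution\<close>

definition single :: "nat \<Rightarrow> nat \<Rightarrow> complex \<Rightarrow> finmat" where
  "single i j z = Abs_finmat (\<lambda>k l. if k = i \<and> l = j then z else 0)"

lemma entry_single: "entry (single i j z) k l = (if k = i \<and> l = j then z else 0)"
  unfolding single_def by (subst Abs_finmat_inverse) (auto intro!: exI[of _ "Suc (max i j)"])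

lemma bounded_linear_single: "bounded_linear (single i j)"
proof
  fix x y :: complex and r :: real
  show "single i j (x + y) = single i j x + single i j y" "single i j (r *\<^sub>R x) = r *\<^sub>R single i j x"
    by (auto intro!: finmat_eqI simp: entry_single)
  have "norm (single i j z) \<le> norm z * 1" for z
  proof (cases "z = 0")
    case True
    then have "{(k, l). entry (single i j z) k l \<noteq> 0} = {}" by (auto simp: entry_single)
    then show ?thesis by (simp add: norm_finmat_def)
  next
    case False
    then have "{(k, l). entry (single i j z) k l \<noteq> 0} = {(i, j)}" by (auto simp: entry_single)
    then show ?thesis by (simp add: norm_finmat_def L2_set_def entry_single)
  qed
  then show "\<exists>K. \<forall>z. norm (single i j z) \<le> norm z * K" by blast
qed

lemma entry_sum: "entry (\<Sum>x\<in>I. f x) i j = (\<Sum>x\<in>I. entry (f x) i j)"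
  using bounded_linear.linear[OF bounded_linear_entry] by (rule linear_sum)

lemma finmat_eq_sum_single:
  assumes "supp_in n A" shows "A = (\<Sum>i<n. \<Sum>j<n. single i j (entry A i j))"
proof (rule finmat_eqI)
  fix k l
  have "entry (\<Sum>i<n. \<Sum>j<n. single i j (entry A i j)) k l =
      (\<Sum>i<n. \<Sum>j<n. if j = l then (if i = k then entry A k l else 0) else 0)"
    unfolding entry_sum by (intro sum.cong) (auto simp: entry_single)
  also have "\<dots> = (if k < n \<and> l < n then entry A k l else 0)"
    by (cases "l < n") auto
  also have "\<dots> = entry A k l" using supp_inD[OF assms] by auto
  finally show "entry A k l = entry (\<Sum>i<n. \<Sum>j<n. single i j (entry A i j)) k l" ..
qed

text \<open>On a fixed block a matrix is a finite sum of matrix units weighted by its entries, and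
  each weighting is a bounded linear map.\<close>

lemma has_vector_derivative_finmat:
  assumes "\<And>s. s \<in> T \<Longrightarrow> supp_in n (X s)" "supp_in n D" "t \<in> T"
    and "\<And>i j. i < n \<Longrightarrow> j < n \<Longrightarrow> ((\<lambda>s. entry (X s) i j) has_vector_derivative entry D i j) (at t within T)"
  shows "(X has_vector_derivative D) (at t within T)"
proof -
  have "((\<lambda>s. \<Sum>i<n. \<Sum>j<n. single i j (entry (X s) i j)) has_vector_derivative
      (\<Sum>i<n. \<Sum>j<n. single i j (entry D i j))) (at t within T)"
    using assms(4)
    by (intro has_vector_derivative_sum bounded_linear.has_vector_derivative[OF bounded_linear_single]) auto
  then have "((\<lambda>s. \<Sum>i<n. \<Sum>j<n. single i j (entry (X s) i j)) has_vector_derivative D) (at t within T)"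
    by (simp only: finmat_eq_sum_single[OF assms(2), symmetric])
  then show ?thesis
    unfolding has_vector_derivative_def
    by (rule has_derivative_transform[OF assms(3), rotated])
      (rule finmat_eq_sum_single[OF assms(1)])
qed

text \<open>The ambient algebra is real, so multiplication by the imaginary unit is expressed by an
  element that commutes with everything in the block.\<close>

definition imag :: "nat \<Rightarrow> finmat" where
  "imag n = emb (\<i> \<cdot>\<^sub>m 1\<^sub>m n)"

lemma supp_in_imag: "supp_in n (imag n)"
  unfolding imag_def by (rule supp_in_emb) simp

lemma entry_imag: "entry (imag n) i j = (if i = j \<and> i < n then \<i> else 0)"
  by (auto simp: imag_def entry_emb)

lemma entry_imag_mult:
  assumes "supp_in n X"
  shows "entry (imag n * X) i j = \<i> * entry X i j" "entry (X * imag n) i j = \<i> * entry X i j"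
proof -
  have "entry (imag n * X) i j = (\<Sum>k<n. if k = i then \<i> * entry X i j else 0)"
    unfolding entry_times[OF supp_in_imag] by (rule sum.cong) (auto simp: entry_imag)
  then show "entry (imag n * X) i j = \<i> * entry X i j"
    using supp_inD[OF assms, of i j] by auto
  have "entry (X * imag n) i j = (\<Sum>k<n. if k = j then \<i> * entry X i j else 0)"
    unfolding entry_times[OF assms] by (rule sum.cong) (auto simp: entry_imag)
  then show "entry (X * imag n) i j = \<i> * entry X i j"
    using supp_inD[OF assms, of i j] by auto
qed

lemma imag_commute: "supp_in n X \<Longrightarrow> imag n * X = X * imag n"
  by (rule finmat_eqI) (simp add: entry_imag_mult)

lemma imag_sq: "imag n * imag n = - emb (1\<^sub>m n)"
  by (rule finmat_eqI) (simp add: entry_imag_mult[OF supp_in_imag] entry_imag entry_emb)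

text \<open>The product rule for the entries of the rank-one matrix; hermiticity turns the
  conjugated derivative into multiplication by H from the right, which produces the
  commutator.\<close>

lemma density_deriv:
  assumes ev: "schrodinger_evolution n H \<psi>" and t: "t \<ge> 0"
    and H: "H t \<in> carrier_mat n n" "mat_adjoint (H t) = H t"
  defines "\<rho> \<equiv> \<lambda>t. emb (ketbra (\<psi> t) (\<psi> t))"
  shows "(\<rho> has_vector_derivative - (imag n * (emb (H t) * \<rho> t - \<rho> t * emb (H t)))) (at t within {0..})"
proof -
  have \<psi>: "\<psi> s \<in> carrier_vec n" if "s \<ge> 0" for s
    using ev that by (auto simp: schrodinger_evolution_def)
  obtain D where D: "D \<in> carrier_vec n" "\<i> \<cdot>\<^sub>v D = H t *\<^sub>v \<psi> t"
    "\<And>k. k < n \<Longrightarrow> ((\<lambda>s. \<psi> s $ k) has_vector_derivative D $ k) (at t within {0..})"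
    using ev t by (auto simp: schrodinger_evolution_def)
  have Hk: "(H t *\<^sub>v \<psi> t) $ k = \<i> * D $ k" if "k < n" for k
    using that D(1) by (simp add: D(2)[symmetric])
  have H\<psi>: "H t *\<^sub>v \<psi> t \<in> carrier_vec n" using H(1) \<psi>[OF t] by simp
  let ?C = "emb (H t) * \<rho> t - \<rho> t * emb (H t)"
  have C: "?C = emb (ketbra (H t *\<^sub>v \<psi> t) (\<psi> t)) - emb (ketbra (\<psi> t) (H t *\<^sub>v \<psi> t))"
    unfolding \<rho>_def by (simp only: emb_mult_ketbra[OF H(1) \<psi>[OF t] \<psi>[OF t]] emb_ketbra_mult[OF H \<psi>[OF t] \<psi>[OF t]])
  have entryC: "entry ?C i j = (if i < n \<and> j < n then \<i> * D $ i * cnj (\<psi> t $ j) - \<psi> t $ i * cnj (\<i> * D $ j) else 0)" for i j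
    unfolding C by (simp add: entry_ketbra[OF H\<psi> \<psi>[OF t]] entry_ketbra[OF \<psi>[OF t] H\<psi>] Hk)
  have sC: "supp_in n ?C" by (simp only: supp_in_def entryC) auto
  show ?thesis
  proof (rule has_vector_derivative_finmat)
    show "supp_in n (\<rho> s)" if "s \<in> {0..}" for s
      unfolding \<rho>_def using that by (intro supp_in_emb ketbra_carrier \<psi>) auto
    show "supp_in n (- (imag n * ?C))"
      using supp_in_times[OF supp_in_imag sC] by (simp add: supp_in_def)
    show "t \<in> {0..}" using t by simp
    fix i j assume ij: "i < n" "j < n"
    have "((\<lambda>s. \<psi> s $ i * cnj (\<psi> s $ j)) has_vector_derivative
        \<psi> t $ i * cnj (D $ j) + D $ i * cnj (\<psi> t $ j)) (at t within {0..})"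
      by (intro has_vector_derivative_mult bounded_linear.has_vector_derivative[OF bounded_linear_cnj] D(3) ij)
    moreover have "\<psi> t $ i * cnj (D $ j) + D $ i * cnj (\<psi> t $ j) = entry (- (imag n * ?C)) i j"
      unfolding entry_uminus entry_imag_mult(1)[OF sC] entryC using ij by (simp add: algebra_simps)
    ultimately have "((\<lambda>s. \<psi> s $ i * cnj (\<psi> s $ j)) has_vector_derivative entry (- (imag n * ?C)) i j)
        (at t within {0..})" by simp
    then show "((\<lambda>s. entry (\<rho> s) i j) has_vector_derivative entry (- (imag n * ?C)) i j) (at t within {0..})"
      unfolding has_vector_derivative_def
      by (rule has_derivative_transform[rotated 2])
        (use t ij \<psi> in \<open>auto simp: \<rho>_def entry_ketbra[of _ n]\<close>)
  qed
qed

text \<open>The plain trace is unbounded for the Frobenius norm on matrices of all sizes; multiplying by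
  the block identity makes it bounded.\<close>

definition re_tr :: "nat \<Rightarrow> finmat \<Rightarrow> real" where
  "re_tr n X = Re (tr (emb (1\<^sub>m n) * X))"

lemma bounded_linear_re_tr: "bounded_linear (re_tr n)"
proof
  fix X Y :: finmat and r :: real
  show "re_tr n (X + Y) = re_tr n X + re_tr n Y" by (simp add: re_tr_def distrib_left tr_add)
  show "re_tr n (r *\<^sub>R X) = r *\<^sub>R re_tr n X" by (simp add: re_tr_def tr_scaleR)
  have "norm (re_tr n X) \<le> norm X * norm (emb (1\<^sub>m n))" for X
    using order_trans[OF abs_Re_le_cmod norm_tr_times_le[of "emb (1\<^sub>m n)" X]]
    by (simp add: re_tr_def mult.commute)
  then show "\<exists>K. \<forall>X. norm (re_tr n X) \<le> norm X * K" by blast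
qed

lemma re_tr_mult: "emb (1\<^sub>m n) * X = X \<Longrightarrow> re_tr n (X * Y) = Re (tr (X * Y))"
  by (simp add: re_tr_def flip: mult.assoc)

lemma re_tr_commute:
  assumes "emb (1\<^sub>m n) * X = X" "X * emb (1\<^sub>m n) = X"
  shows "re_tr n (X * Y) = re_tr n (Y * X)"
proof -
  have "tr (emb (1\<^sub>m n) * (Y * X)) = tr (Y * (X * emb (1\<^sub>m n)))"
    by (simp only: tr_commute[of "emb (1\<^sub>m n)"] mult.assoc)
  then show ?thesis using assms by (simp add: re_tr_mult) (simp add: re_tr_def tr_commute[of X])
qed

lemma re_tr_le: "emb (1\<^sub>m n) * X = X \<Longrightarrow> \<bar>re_tr n (X * Y)\<bar> \<le> norm X * norm Y"
  by (simp add: re_tr_mult order_trans[OF abs_Re_le_cmod norm_tr_times_le])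

lemma evolution_norm:
  assumes ev: "schrodinger_evolution n H \<psi>" and "vnorm (\<psi> 0) = 1" and t: "t \<ge> 0"
    and H: "\<And>t. t \<ge> 0 \<Longrightarrow> H t \<in> carrier_mat n n" "\<And>t. t \<ge> 0 \<Longrightarrow> mat_adjoint (H t) = H t"
  shows "vnorm (\<psi> t) = 1"
proof -
  let ?\<rho> = "\<lambda>t. emb (ketbra (\<psi> t) (\<psi> t))"
  have \<psi>: "\<psi> s \<in> carrier_vec n" if "s \<ge> 0" for s
    using ev that by (auto simp: schrodinger_evolution_def)
  have s\<rho>: "supp_in n (?\<rho> s)" if "s \<ge> 0" for s using that by (intro supp_in_emb ketbra_carrier \<psi>)
  have eq: "re_tr n (?\<rho> s) = (vnorm (\<psi> s))\<^sup>2" if "s \<ge> 0" for s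
    unfolding re_tr_def emb_one_mult[OF s\<rho>[OF that]] tr_ketbra[OF \<psi>[OF that]] by simp
  have "((\<lambda>t. re_tr n (?\<rho> t)) has_real_derivative 0) (at s within {0..})" if s: "s \<ge> 0" for s
  proof -
    let ?A = "emb (H s)"
    have sA: "supp_in n ?A" by (rule supp_in_emb[OF H(1)[OF s]])
    have "((\<lambda>t. re_tr n (?\<rho> t)) has_vector_derivative re_tr n (- (imag n * (?A * ?\<rho> s - ?\<rho> s * ?A)))) (at s within {0..})"
      by (intro bounded_linear.has_vector_derivative[OF bounded_linear_re_tr] density_deriv[OF ev s H(1)[OF s] H(2)[OF s]])
    moreover have "re_tr n (- (imag n * (?A * ?\<rho> s - ?\<rho> s * ?A))) = 0"
    proof -
      have "imag n * (?A * ?\<rho> s - ?\<rho> s * ?A) = ?A * (imag n * ?\<rho> s) - (imag n * ?\<rho> s) * ?A"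
        by (simp add: right_diff_distrib imag_commute[OF sA] flip: mult.assoc)
      moreover have "re_tr n (?A * (imag n * ?\<rho> s)) = re_tr n ((imag n * ?\<rho> s) * ?A)"
        by (intro re_tr_commute emb_one_mult emb_mult_one sA)
      ultimately show ?thesis
        using bounded_linear_re_tr[of n, THEN bounded_linear.linear] by (simp add: linear_diff linear_neg)
    qed
    ultimately show ?thesis by (simp add: has_real_derivative_iff_has_vector_derivative)
  qed
  \<comment> \<open>The trace of a commutator vanishes, so \<open>decay_bound\<close> applies with
    constant 0 and yields constancy; the values 1 are arbitrary positive parameters.\<close>
  then have "\<bar>re_tr n (?\<rho> t) - re_tr n (?\<rho> 0)\<bar> \<le> 0 / 1 * (1 * 0 + 1) powr - 1"
    by (intro decay_bound[where F' = "\<lambda>_. 0" and \<delta> = 1]) (use t in auto)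
  then have "(vnorm (\<psi> t))\<^sup>2 = 1" using eq t assms(2) by simp
  moreover have "0 \<le> vnorm (\<psi> t)" by (simp add: vnorm_def sum_nonneg)
  ultimately show ?thesis by (simp add: power2_eq_1_iff)
qed

section \<open>Excitation bound for a fixed number of spins\<close>

locale annealing = annealing_schedule +
  fixes a b C0 :: real and N0 :: nat and J :: "nat set \<Rightarrow> real" and \<psi> \<phi> :: "real \<Rightarrow> cvec"
  assumes a_pos: "a > 0" and gap: "gap_constants C0 c a b N0" and N0: "N0 \<le> N"
    and admissible: "admissible_ising C0 N J"
    and evolution: "schrodinger_evolution (2 ^ N) (annealing_hamiltonian N J \<delta> c g) \<psi>"
    and \<psi>0: "ground_state (annealing_hamiltonian N J \<delta> c g 0) (\<psi> 0)"
    and \<phi>: "t \<ge> 0 \<Longrightarrow> ground_state (annealing_hamiltonian N J \<delta> c g t) (\<phi> t)"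
begin

abbreviation "n \<equiv> (2::nat) ^ N"
abbreviation "Ham \<equiv> annealing_hamiltonian N J \<delta> c g"
abbreviation "P t \<equiv> emb (ketbra (\<phi> t) (\<phi> t))"
abbreviation "\<rho> t \<equiv> emb (ketbra (\<psi> t) (\<psi> t))"
abbreviation "u \<equiv> emb (1\<^sub>m n)"
abbreviation "V \<equiv> emb (transverse_field N)"

definition "overlap t = re_tr n (\<rho> t * P t)"
text \<open>These constants contain N, the schedule parameters, a and b, but neither \<delta> nor
  the couplings. This is what allows one \<kappa> for all Hamiltonians.\<close>

definition "s0 = n * sqrt n / (a * sqrt N * exp (- b * N))"
definition "C1 = norm (imag n) * (2 * (s0\<^sup>2 * norm V * K1))"
definition "C2 = norm (imag n) * (20 * (s0 ^ 3 * (norm V)\<^sup>2 * K2) + 2 * (s0\<^sup>2 * norm V * K3))"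
definition "C = c powr - \<eta> * (2 * C1 + C2 / \<eta>)"

lemma Ham_eq: "Ham t = transverse_ising N J (\<Gamma> t)"
  by (simp add: annealing_hamiltonian_def annealing_field_def \<Gamma>_def)

lemma Ham_hermitian: "hermitian (Ham t) n"
proof
  show "2 \<le> n" using N self_le_power[of 2 N] by simp
qed (simp_all add: Ham_eq transverse_ising_carrier transverse_ising_hermitian)

lemma gap_le: "t \<ge> 0 \<Longrightarrow> a * sqrt N * exp (- b * N) * \<Gamma> t ^ N \<le> spectral_gap (Ham t)"
  using gap N0 N admissible \<Gamma>_pos \<Gamma>_le by (simp add: gap_constants_def Ham_eq)

lemma gap_pos: "t \<ge> 0 \<Longrightarrow> 0 < spectral_gap (Ham t)"
  using gap_le[of t] a_pos N \<Gamma>_pos[of t] by (intro less_le_trans[OF _ gap_le]) auto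

lemma resolvent_bound: assumes t: "t \<ge> 0" shows "n * sqrt n / spectral_gap (Ham t) \<le> s0 * (1 / \<Gamma> t) ^ N"
proof -
  have "n * sqrt n / spectral_gap (Ham t) \<le> n * sqrt n / (a * sqrt N * exp (- b * N) * \<Gamma> t ^ N)"
    using gap_pos[OF t] gap_le[OF t] a_pos N \<Gamma>_pos[OF t] by (intro divide_left_mono mult_pos_pos) auto
  also have "\<dots> = s0 * (1 / \<Gamma> t) ^ N" by (simp add: s0_def power_divide)
  finally show ?thesis .
qed

lemma reduced_resolvent_exists:
  assumes t: "t \<ge> 0"
  shows "\<exists>S. supp_in n S \<and>
    S * emb (Ham t) = u - P t + ground_energy (Ham t) *\<^sub>R S \<and>
    emb (Ham t) * S = u - P t + ground_energy (Ham t) *\<^sub>R S \<and> S * P t = 0 \<and> P t * S = 0 \<and>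
    norm S \<le> s0 * (1 / \<Gamma> t) ^ N"
proof -
  obtain S where "supp_in n S" "S * emb (Ham t) = u - P t + ground_energy (Ham t) *\<^sub>R S"
    "emb (Ham t) * S = u - P t + ground_energy (Ham t) *\<^sub>R S" "S * P t = 0" "P t * S = 0"
    "norm S \<le> n * sqrt n / spectral_gap (Ham t)"
    by (rule hermitian.reduced_resolvent[OF Ham_hermitian gap_pos[OF t] \<phi>[OF t]])
  then show ?thesis using resolvent_bound[OF t] by (blast intro: order_trans)
qed

lemma Ham_carrier: "Ham t \<in> carrier_mat n n" and Ham_adjoint: "mat_adjoint (Ham t) = Ham t"
  using Ham_hermitian by (auto simp: hermitian_def)

lemma \<phi>_unit: "t \<ge> 0 \<Longrightarrow> \<phi> t \<in> carrier_vec n" "t \<ge> 0 \<Longrightarrow> vnorm (\<phi> t) = 1"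
  using hermitian.ground_state_projection(1,2)[OF Ham_hermitian \<phi>] by auto

lemma \<psi>_unit: "t \<ge> 0 \<Longrightarrow> \<psi> t \<in> carrier_vec n" "t \<ge> 0 \<Longrightarrow> vnorm (\<psi> t) = 1"
proof -
  show "t \<ge> 0 \<Longrightarrow> \<psi> t \<in> carrier_vec n" using evolution by (auto simp: schrodinger_evolution_def)
  show "t \<ge> 0 \<Longrightarrow> vnorm (\<psi> t) = 1"
    using hermitian.ground_state_projection(2)[OF Ham_hermitian \<psi>0]
    by (rule evolution_norm[OF evolution _ _ Ham_carrier Ham_adjoint])
qed

lemma supp_P: "t \<ge> 0 \<Longrightarrow> supp_in n (P t)" and supp_\<rho>: "t \<ge> 0 \<Longrightarrow> supp_in n (\<rho> t)"
  by (intro supp_in_emb ketbra_carrier \<phi>_unit \<psi>_unit; assumption)+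

text \<open>\<open>\<psi> 0\<close> and \<open>\<phi> 0\<close> are separately given ground vectors
  and may differ by a phase. Applying the reduced resolvent to the eigenvalue equation of
  \<open>\<rho> 0\<close> gives \<open>P 0 * \<rho> 0 = \<rho> 0\<close>, so the projections
  agree.\<close>

lemma overlap_0: "overlap 0 = 1"
proof -
  let ?E = "ground_energy (Ham 0)"
  obtain S where S: "S * emb (Ham 0) = u - P 0 + ?E *\<^sub>R S"
    by (rule hermitian.reduced_resolvent[OF Ham_hermitian gap_pos[of 0] \<phi>[of 0]]) auto
  have H: "emb (Ham 0) * \<rho> 0 = ?E *\<^sub>R \<rho> 0"
    by (rule hermitian.ground_state_projection(3)[OF Ham_hermitian \<psi>0])
  have s: "supp_in n (\<rho> 0)" by (rule supp_\<rho>) simp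
  have "S * (emb (Ham 0) * \<rho> 0) = (u - P 0 + ?E *\<^sub>R S) * \<rho> 0"
    by (simp only: S mult.assoc[symmetric])
  then have "P 0 * \<rho> 0 = \<rho> 0"
    by (simp add: H algebra_simps emb_one_mult[OF s])
  then have "overlap 0 = re_tr n (\<rho> 0)"
    unfolding overlap_def by (subst re_tr_commute) (simp_all add: emb_one_mult[OF s] emb_mult_one[OF s])
  then show ?thesis
    by (simp add: re_tr_def emb_one_mult[OF s] tr_ketbra[OF \<psi>_unit(1)] \<psi>_unit(2))
qed

lemma excitation_eq: "t \<ge> 0 \<Longrightarrow> excitation \<psi> \<phi> t = sqrt (1 - overlap t)"
  unfolding excitation_def overlap_def
  by (simp add: op_norm_ketbra_diff[OF \<psi>_unit \<phi>_unit] re_tr_mult emb_one_mult supp_\<rho>)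

lemma bound_const_nonneg: "0 \<le> s0" "0 \<le> C1" "0 \<le> C2" "0 \<le> C"
  using const_nonneg a_pos \<eta> by (auto simp: s0_def C1_def C2_def C_def intro!: add_nonneg_nonneg mult_nonneg_nonneg)

lemma adiabatic_functional:
  "\<exists>F F'. \<forall>t\<ge>0. (F has_real_derivative F' t) (at t within {0..}) \<and>
    \<bar>F' t\<bar> \<le> (C2 * \<delta>) * \<delta> * tau t powr (- 1 - \<eta>) \<and>
    \<bar>F t - overlap t\<bar> \<le> C1 * \<delta> * tau t powr - \<eta>"
proof -
  \<comment> \<open>The resolvents are chosen independently at each time; their smooth dependence on
    t is a consequence of the algebraic relations, proved in the locale.\<close>
  define S where "S t = (SOME S. supp_in n S \<and>
    S * emb (Ham t) = u - P t + ground_energy (Ham t) *\<^sub>R S \<and>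
    emb (Ham t) * S = u - P t + ground_energy (Ham t) *\<^sub>R S \<and> S * P t = 0 \<and> P t * S = 0 \<and>
    norm S \<le> s0 * (1 / \<Gamma> t) ^ N)" for t
  have S: "supp_in n (S t) \<and>
    S t * emb (Ham t) = u - P t + ground_energy (Ham t) *\<^sub>R S t \<and>
    emb (Ham t) * S t = u - P t + ground_energy (Ham t) *\<^sub>R S t \<and> S t * P t = 0 \<and> P t * S t = 0 \<and>
    norm (S t) \<le> s0 * (1 / \<Gamma> t) ^ N" if "t \<ge> 0" for t
    unfolding S_def by (rule someI_ex[OF reduced_resolvent_exists[OF that]])
  let ?s = "\<lambda>t. s0 * (1 / \<Gamma> t) ^ N"
  let ?H1 = "\<lambda>t. - (\<Gamma>1 t *\<^sub>R V)" and ?H2 = "\<lambda>t. - (\<Gamma>2 t *\<^sub>R V)"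
  have supp_H: "supp_in n (emb (Ham t))" for t by (rule supp_in_emb[OF Ham_carrier])
  interpret adiabatic "re_tr n" u "imag n" "{0..}" "\<lambda>t. emb (Ham t)" ?H1 ?H2 P S \<rho> "\<lambda>t. ground_energy (Ham t)" ?s
  proof (rule adiabatic.intro)
    fix t :: real assume "t \<in> {0..}"
    then have t: "t \<ge> 0" by simp
    show "imag n * emb (Ham t) = emb (Ham t) * imag n" by (rule imag_commute[OF supp_H])
    show "imag n * \<rho> t = \<rho> t * imag n" by (rule imag_commute[OF supp_\<rho>[OF t]])
    show "u * emb (Ham t) = emb (Ham t)" "emb (Ham t) * u = emb (Ham t)"
      by (simp_all only: emb_one_mult[OF supp_H] emb_mult_one[OF supp_H])
    show "u * P t = P t" "P t * u = P t"
      by (simp_all only: emb_one_mult[OF supp_P[OF t]] emb_mult_one[OF supp_P[OF t]])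
    show "u * S t = S t" "S t * u = S t" using S[OF t] by (simp_all add: emb_one_mult emb_mult_one)
    show "u * \<rho> t = \<rho> t" by (rule emb_one_mult[OF supp_\<rho>[OF t]])
    show "emb (Ham t) * P t = ground_energy (Ham t) *\<^sub>R P t" "P t * emb (Ham t) = ground_energy (Ham t) *\<^sub>R P t"
      by (rule hermitian.ground_state_projection(3,4)[OF Ham_hermitian \<phi>[OF t]])+
    show "S t * emb (Ham t) = u - P t + ground_energy (Ham t) *\<^sub>R S t"
      "emb (Ham t) * S t = u - P t + ground_energy (Ham t) *\<^sub>R S t" "S t * P t = 0" "P t * S t = 0"
      "norm (S t) \<le> ?s t"
      using S[OF t] by blast+
    show "re_tr n (P t) = 1"
      by (simp add: re_tr_def emb_one_mult[OF supp_P[OF t]] tr_ketbra[OF \<phi>_unit(1)[OF t]] \<phi>_unit(2)[OF t])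
    show "norm (P t) \<le> 1" by (simp add: norm_ketbra[OF \<phi>_unit(1)[OF t]] \<phi>_unit(2)[OF t])
    show "norm (\<rho> t) \<le> 1" by (simp add: norm_ketbra[OF \<psi>_unit(1)[OF t]] \<psi>_unit(2)[OF t])
    show "ground_energy (Ham t) \<le> re_tr n (P t' * emb (Ham t))" if "t' \<in> {0..}" for t'
      using hermitian.ground_energy_le[OF Ham_hermitian \<phi>_unit, of t' t] that
      by (simp add: re_tr_mult emb_one_mult supp_P)
    have "((\<lambda>t. \<Gamma> t *\<^sub>R V) has_vector_derivative \<Gamma>1 t *\<^sub>R V) (at t within {0..})"
      using has_vector_derivative_scaleR[OF \<Gamma>_deriv[OF t] has_vector_derivative_const[of V]] by simp
    from has_vector_derivative_diff[OF has_vector_derivative_const[of "emb (ising_hamiltonian N J)"] this]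
    show "((\<lambda>t. emb (Ham t)) has_vector_derivative ?H1 t) (at t within {0..})"
      by (simp add: Ham_eq emb_transverse_ising)
    show "(?H1 has_vector_derivative ?H2 t) (at t within {0..})"
      using has_vector_derivative_minus[OF has_vector_derivative_scaleR[OF \<Gamma>1_deriv[OF t] has_vector_derivative_const[of V]]]
      by simp
    show "(\<rho> has_vector_derivative - (imag n * (emb (Ham t) * \<rho> t - \<rho> t * emb (Ham t)))) (at t within {0..})"
      by (rule density_deriv[OF evolution t Ham_carrier Ham_adjoint])
  next
    show "bounded_linear (re_tr n)" by (rule bounded_linear_re_tr)
    show "u * X = X \<Longrightarrow> X * u = X \<Longrightarrow> re_tr n (X * Y) = re_tr n (Y * X)" for X Y by (rule re_tr_commute)
    show "u * X = X \<Longrightarrow> \<bar>re_tr n (X * Y)\<bar> \<le> norm X * norm Y" for X Y by (rule re_tr_le)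
    show "imag n * imag n = - u" by (rule imag_sq)
    have "continuous_on {0..} \<Gamma>"
      using \<Gamma>_deriv by (auto simp: continuous_on_eq_continuous_within intro!: DERIV_continuous)
    then show "continuous_on {0..} ?s"
      using \<Gamma>_pos by (intro continuous_intros) (auto simp: less_imp_neq[symmetric])
  qed
  have n1: "norm (?H1 t) = \<bar>\<Gamma>1 t\<bar> * norm V" and n2: "norm (?H2 t) = \<bar>\<Gamma>2 t\<bar> * norm V" for t by simp_all
  have s2: "(?s t)\<^sup>2 = s0\<^sup>2 * (1 / \<Gamma> t) ^ (2 * N)" and s3: "(?s t) ^ 3 = s0 ^ 3 * (1 / \<Gamma> t) ^ (3 * N)" for t
    by (simp_all only: power_mult_distrib power_mult[symmetric] mult.commute)
  show ?thesis
  proof (intro exI allI impI conjI)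
    fix t :: real assume t: "t \<ge> 0"
    show "(F has_real_derivative - re_tr n (\<rho> t * (imag n * Z1 t))) (at t within {0..})"
      by (rule F_deriv) (use t in simp)
    have "\<bar>- re_tr n (\<rho> t * (imag n * Z1 t))\<bar> \<le>
        norm (imag n) * (20 * ((?s t) ^ 3 * (norm (?H1 t))\<^sup>2) + 2 * ((?s t)\<^sup>2 * norm (?H2 t)))"
      by (rule F_deriv_le) (use t in simp)
    also have "\<dots> = norm (imag n) * (20 * (s0 ^ 3 * (norm V)\<^sup>2 * ((1 / \<Gamma> t) ^ (3 * N) * (\<Gamma>1 t)\<^sup>2)) +
        2 * (s0\<^sup>2 * norm V * ((1 / \<Gamma> t) ^ (2 * N) * \<bar>\<Gamma>2 t\<bar>)))"
      unfolding n1 n2 s2 s3 unfolding power_mult_distrib[of "\<bar>\<Gamma>1 t\<bar>"] power2_abs by (simp only: mult_ac)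
    also have "\<dots> \<le> norm (imag n) * (20 * (s0 ^ 3 * (norm V)\<^sup>2 * (K2 * \<delta>\<^sup>2 * tau t powr (- 1 - \<eta>))) +
        2 * (s0\<^sup>2 * norm V * (K3 * \<delta>\<^sup>2 * tau t powr (- 1 - \<eta>))))"
      using bound_const_nonneg(1)
      by (intro mult_left_mono add_mono first_order_sq_bound[OF t] second_order_bound[OF t]) auto
    \<comment> \<open>Of the two factors \<delta>, one belongs to the derivative of a power of tau
      and disappears on integration; the other remains and makes the total change of order
      \<delta>.\<close>
    also have "\<dots> = (C2 * \<delta>) * \<delta> * tau t powr (- 1 - \<eta>)"
      by (simp add: C2_def algebra_simps power2_eq_square)
    finally show "\<bar>- re_tr n (\<rho> t * (imag n * Z1 t))\<bar> \<le> (C2 * \<delta>) * \<delta> * tau t powr (- 1 - \<eta>)" .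
    have "\<bar>F t - re_tr n (\<rho> t * P t)\<bar> \<le> norm (imag n) * (2 * ((?s t)\<^sup>2 * norm (?H1 t)))"
      by (rule F_close) (use t in simp)
    also have "\<dots> = norm (imag n) * (2 * (s0\<^sup>2 * norm V * ((1 / \<Gamma> t) ^ (2 * N) * \<bar>\<Gamma>1 t\<bar>)))"
      unfolding n1 s2 by (simp only: mult_ac)
    also have "\<dots> \<le> norm (imag n) * (2 * (s0\<^sup>2 * norm V * (K1 * \<delta> * tau t powr - \<eta>)))"
      by (intro mult_left_mono first_order_bound[OF t]) auto
    also have "\<dots> = C1 * \<delta> * tau t powr - \<eta>" by (simp add: C1_def)
    finally show "\<bar>F t - overlap t\<bar> \<le> C1 * \<delta> * tau t powr - \<eta>" by (simp add: overlap_def)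
  qed
qed

lemma tau_powr_tendsto: "((\<lambda>t. tau t powr - \<eta>) \<longlongrightarrow> 0) at_top"
proof (rule tendsto_neg_powr)
  have "filterlim (\<lambda>t. c + \<delta> * t) at_top at_top"
    by (intro filterlim_tendsto_add_at_top[OF tendsto_const] filterlim_ident
        filterlim_tendsto_pos_mult_at_top[OF tendsto_const pos(5)])
  then show "filterlim tau at_top at_top" by (simp add: add.commute)
qed (use \<eta> in simp)

lemma overlap_limit: "\<exists>x. (overlap \<longlongrightarrow> x) at_top \<and> 1 - x \<le> C * \<delta>"
proof -
  obtain F F' where F: "\<And>t. t \<ge> 0 \<Longrightarrow> (F has_real_derivative F' t) (at t within {0..})"
    "\<And>t. t \<ge> 0 \<Longrightarrow> \<bar>F' t\<bar> \<le> (C2 * \<delta>) * \<delta> * tau t powr (- 1 - \<eta>)"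
    "\<And>t. t \<ge> 0 \<Longrightarrow> \<bar>F t - overlap t\<bar> \<le> C1 * \<delta> * tau t powr - \<eta>"
    using adiabatic_functional by blast
  have diff: "\<bar>F t - F s\<bar> \<le> C2 * \<delta> / \<eta> * tau s powr - \<eta>" if "0 \<le> s" "s \<le> t" for s t
    using pos \<eta> bound_const_nonneg that by (intro decay_bound[OF pos(5,1) \<eta>(1) F(1,2)]) auto
  have "((\<lambda>s. C2 * \<delta> / \<eta> * tau s powr - \<eta>) \<longlongrightarrow> C2 * \<delta> / \<eta> * 0) at_top"
    by (intro tendsto_intros tau_powr_tendsto)
  then obtain x where x: "(F \<longlongrightarrow> x) at_top"
    using decay_convergent[of F, OF diff] by auto
  have "((\<lambda>t. F t - overlap t) \<longlongrightarrow> 0) at_top"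
  proof (rule tendsto_0_le[OF tau_powr_tendsto, of _ "C1 * \<delta>"])
    show "\<forall>\<^sub>F t in at_top. norm (F t - overlap t) \<le> norm (tau t powr - \<eta>) * (C1 * \<delta>)"
      by (intro eventually_mono[OF eventually_ge_at_top[of "0::real"]]) (use F(3) in \<open>simp add: mult.commute\<close>)
  qed
  from tendsto_diff[OF x this] have lim: "(overlap \<longlongrightarrow> x) at_top" by simp
  have "1 - overlap t \<le> C * \<delta>" if t: "t \<ge> 0" for t
  proof -
    have p: "tau t powr - \<eta> \<le> c powr - \<eta>"
      using tau_ge[OF t] pos \<eta> by (intro powr_mono2') auto
    \<comment> \<open>F differs from the overlap at both ends, which gives the \<open>2 * C1\<close>
      in C, and its own change in between contributes \<open>C2 / \<eta>\<close>.\<close>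
    have "1 - overlap t \<le> \<bar>F 0 - overlap 0\<bar> + \<bar>F t - F 0\<bar> + \<bar>F t - overlap t\<bar>"
      unfolding overlap_0 by linarith
    also have "\<dots> \<le> C1 * \<delta> * tau 0 powr - \<eta> + C2 * \<delta> / \<eta> * tau 0 powr - \<eta> + C1 * \<delta> * tau t powr - \<eta>"
      by (intro add_mono F(3) diff t) auto
    also have "\<dots> \<le> C1 * \<delta> * c powr - \<eta> + C2 * \<delta> / \<eta> * c powr - \<eta> + C1 * \<delta> * c powr - \<eta>"
      using p bound_const_nonneg pos \<eta> by (intro add_mono mult_left_mono) auto
    also have "\<dots> = C * \<delta>" by (simp add: C_def algebra_simps)
    finally show ?thesis .
  qed
  then have "1 - C * \<delta> \<le> overlap t" if "t \<ge> 0" for t using that by (simp add: algebra_simps)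
  then have "1 - C * \<delta> \<le> x"
    by (intro tendsto_lowerbound[OF lim] eventually_mono[OF eventually_ge_at_top[of "0::real"]]) auto
  then show ?thesis using lim by (auto simp: algebra_simps)
qed

lemma P_excited_bound:
  assumes "\<epsilon> > 0" "C * \<delta> \<le> \<epsilon>\<^sup>2"
  shows "(excitation \<psi> \<phi> \<longlongrightarrow> P_excited \<psi> \<phi>) at_top \<and> P_excited \<psi> \<phi> \<le> \<epsilon>"
proof -
  obtain x where x: "(overlap \<longlongrightarrow> x) at_top" "1 - x \<le> C * \<delta>" using overlap_limit by blast
  have "((\<lambda>t. sqrt (1 - overlap t)) \<longlongrightarrow> sqrt (1 - x)) at_top" by (intro tendsto_intros x)
  moreover have "\<forall>\<^sub>F t in at_top. sqrt (1 - overlap t) = excitation \<psi> \<phi> t"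
    by (intro eventually_mono[OF eventually_ge_at_top[of "0::real"]]) (simp add: excitation_eq)
  ultimately have lim: "(excitation \<psi> \<phi> \<longlongrightarrow> sqrt (1 - x)) at_top" by (rule Lim_transform_eventually)
  then have "P_excited \<psi> \<phi> = sqrt (1 - x)"
    unfolding P_excited_def by (intro tendsto_Lim) auto
  moreover have "sqrt (1 - x) \<le> \<epsilon>" using x(2) assms by (intro real_le_lsqrt) auto
  ultimately show ?thesis using lim by simp
qed

end

theorem theorem1:
  fixes \<epsilon> a b c l c' c'' L :: real
  assumes "\<epsilon> > 0" and "a > 0" and "b > 0" and "c > 0" and "l > 0"
    and "c' > 0" and "c'' > 0" and "L > 0"
  shows "\<exists>\<kappa>>0.
    \<forall>(C0::real) (N0::nat) (N::nat) (J :: nat set \<Rightarrow> real) (\<delta>::real)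
      (g :: real \<Rightarrow> real) (g' :: real \<Rightarrow> real) (g'' :: real \<Rightarrow> real)
      (\<psi> :: real \<Rightarrow> cvec) (\<phi> :: real \<Rightarrow> cvec).
      C0 > 0 \<longrightarrow> gap_constants C0 c a b N0 \<longrightarrow>
      N \<ge> 1 \<longrightarrow> N \<ge> N0 \<longrightarrow> L < 1 / (3 * real N - 2) \<longrightarrow>
      admissible_ising C0 N J \<longrightarrow>
      0 < \<delta> \<longrightarrow> \<delta> \<le> \<kappa> * real N powr (- 1 / 2) * exp (- 3 * b * real N) \<longrightarrow>
      (\<forall>t\<ge>0. (g has_real_derivative g' t) (at t within {0..})) \<longrightarrow>
      (\<forall>t\<ge>0. (g' has_real_derivative g'' t) (at t within {0..})) \<longrightarrow>
      (\<forall>t\<ge>0. 0 < g t \<and> g t \<le> L) \<longrightarrow>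
      (\<forall>t\<ge>0. \<bar>g' t\<bar> \<le> \<delta> * c' / (\<delta> * t + c) powr (1 + l)) \<longrightarrow>
      (\<forall>t\<ge>0. \<bar>g'' t\<bar> * \<bar>ln (\<delta> * t + c)\<bar>
          \<le> \<delta>\<^sup>2 * c'' * (\<delta> * t + c) powr (- 1 - (2 * real N - 1) / (3 * real N - 2))) \<longrightarrow>
      schrodinger_evolution (2 ^ N) (annealing_hamiltonian N J \<delta> c g) \<psi> \<longrightarrow>
      ground_state (annealing_hamiltonian N J \<delta> c g 0) (\<psi> 0) \<longrightarrow>
      (\<forall>t\<ge>0. ground_state (annealing_hamiltonian N J \<delta> c g t) (\<phi> t)) \<longrightarrow>
      (excitation \<psi> \<phi> \<longlongrightarrow> P_excited \<psi> \<phi>) at_top \<and> P_excited \<psi> \<phi> \<le> \<epsilon>"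
proof -
  define S where "S = {N. 1 \<le> N \<and> L < 1 / (3 * real N - 2)}"
  have fin: "finite S"
  proof (rule finite_subset)
    show "S \<subseteq> {..nat \<lceil>1 / L\<rceil>}"
    proof
      fix N assume "N \<in> S"
      then have N: "1 \<le> real N" "L < 1 / (3 * real N - 2)" by (auto simp: S_def)
      then have "3 * real N - 2 < 1 / L" using \<open>L > 0\<close> by (simp add: field_simps)
      \<comment> \<open>N \<ge> 1 gives N \<le> 3N-2, so L bounds the number of spins.\<close>
      with N have "real N \<le> 1 / L" by simp
      then show "N \<in> {..nat \<lceil>1 / L\<rceil>}" by (simp add: le_nat_iff le_ceiling_iff)
    qed
  qed simp
  \<comment> \<open>Outside the locale the sign of \<open>annealing.C\<close> is not known; the
    absolute value plus 1 keeps the denominator positive for every N.\<close>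
  define k where "k N = \<epsilon>\<^sup>2 / (\<bar>annealing.C N c l c' c'' L a b\<bar> + 1)" for N
  \<comment> \<open>The minimum over the finitely many possible N makes \<kappa> independent of N;
    the inserted 1 covers an empty S.\<close>
  define \<kappa> where "\<kappa> = Min (insert 1 (k ` S))"
  have "0 < k N" for N using \<open>\<epsilon> > 0\<close> by (auto simp: k_def intro!: divide_pos_pos add_nonneg_pos)
  then have \<kappa>_pos: "0 < \<kappa>" using fin by (auto simp: \<kappa>_def)
  show ?thesis
  proof (intro exI[of _ \<kappa>] conjI allI impI)
    show "0 < \<kappa>" by (rule \<kappa>_pos)
  next
    fix C0 :: real and N0 N :: nat and J :: "nat set \<Rightarrow> real" and \<delta> :: real
      and g g' g'' :: "real \<Rightarrow> real" and \<psi> \<phi> :: "real \<Rightarrow> cvec"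
    assume gap: "gap_constants C0 c a b N0" and N: "N \<ge> 1" "N \<ge> N0" and L: "L < 1 / (3 * real N - 2)"
      and adm: "admissible_ising C0 N J" and \<delta>: "0 < \<delta>"
      and \<delta>_le: "\<delta> \<le> \<kappa> * real N powr (- 1 / 2) * exp (- 3 * b * real N)"
      and g: "\<forall>t\<ge>0. (g has_real_derivative g' t) (at t within {0..})"
        "\<forall>t\<ge>0. (g' has_real_derivative g'' t) (at t within {0..})"
        "\<forall>t\<ge>0. 0 < g t \<and> g t \<le> L"
        "\<forall>t\<ge>0. \<bar>g' t\<bar> \<le> \<delta> * c' / (\<delta> * t + c) powr (1 + l)"
        "\<forall>t\<ge>0. \<bar>g'' t\<bar> * \<bar>ln (\<delta> * t + c)\<bar>
          \<le> \<delta>\<^sup>2 * c'' * (\<delta> * t + c) powr (- 1 - (2 * real N - 1) / (3 * real N - 2))"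
      and evo: "schrodinger_evolution (2 ^ N) (annealing_hamiltonian N J \<delta> c g) \<psi>"
        "ground_state (annealing_hamiltonian N J \<delta> c g 0) (\<psi> 0)"
        "\<forall>t\<ge>0. ground_state (annealing_hamiltonian N J \<delta> c g t) (\<phi> t)"
    interpret annealing N c l c' c'' L \<delta> g g' g'' a b C0 N0 J \<psi> \<phi>
      by unfold_locales (use assms gap N L adm \<delta> g evo in auto)
    \<comment> \<open>The factor depending on N is at most 1, so the hypothesis on \<delta> gives
      \<delta> \<le> \<kappa>.\<close>
    have "real N powr (- 1 / 2) \<le> real N powr 0" using N by (intro powr_mono) auto
    then have "real N powr (- 1 / 2) * exp (- 3 * b * real N) \<le> 1 * 1"
      using N \<open>b > 0\<close> by (intro mult_mono) auto
    then have "\<kappa> * (real N powr (- 1 / 2) * exp (- 3 * b * real N)) \<le> \<kappa> * 1"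
      using \<kappa>_pos by (intro mult_left_mono) auto
    with \<delta>_le have "\<delta> \<le> \<kappa>" by (simp add: mult.assoc)
    moreover have "\<kappa> \<le> k N"
      using fin N L by (auto simp: \<kappa>_def S_def intro!: Min_le)
    ultimately have "\<delta> \<le> k N" by (rule order_trans)
    then have "\<delta> * (C + 1) \<le> \<epsilon>\<^sup>2"
      using bound_const_nonneg(4) by (simp add: k_def pos_le_divide_eq)
    then have "C * \<delta> \<le> \<epsilon>\<^sup>2" using \<delta> by (simp add: algebra_simps)
    then show "(excitation \<psi> \<phi> \<longlongrightarrow> P_excited \<psi> \<phi>) at_top" "P_excited \<psi> \<phi> \<le> \<epsilon>"
      using P_excited_bound[OF \<open>\<epsilon> > 0\<close>] by auto
  qed
qed

end
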